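(* Let $X$ be a topological space and $\mathcal H=(\mathcal H_j)$ a sheaf of AQ normal series on $X$ of AQ degree $2$. Then the primary complex of $\mathcal H$, $$H^0(X,\mathcal A_{j})\xrightarrow{\ \partial^1_{j+1}\ }H^1(X,\mathcal A_{j+1})\xrightarrow{\ \partial^2_{j+2}\ }H^2(X,\mathcal A_{j+2})\qquad(\text{all } j),$$ where $\mathcal A_j=\mathcal H_j/\mathcal H_{j+1}$, is a complex of vector spaces (that is, its terms are vector spaces and the maps $\partial^1_{j+1}$ and $\partial^2_{j+2}$ are linear, with trivial composition).
   Context: A sheaf of AQ normal series on $X$ is a finite descending collection of sheaves of groups $\mathcal G=\mathcal H_0\supseteq \mathcal H_1\supseteq\cdots\supseteq\mathcal H_N=\{e\}$ on $X$ (put $\mathcal H_j=\{e\}$ for $j\ge N$) such that each $\mathcal H_j$ is a sheaf of normal subgroups of $\mathcal G$ and each quotient $\mathcal A_j=\mathcal H_j/\mathcal H_{j+1}$ is a sheaf of abelian groups. It has AQ degree $d$ if for each $j$ the quotients $\mathcal H_j/\mathcal H_{j+1},\dots,\mathcal H_j/\mathcal H_{j+d}$ are abelian. A series of AQ degree $d>1$ is central: for each $j>0$ there is some $k<j$ such that $\mathcal A_j$ lies in the centre of $\mathcal H_k/\mathcal H_{j+1}$. Convention: the cohomology groups of sheaves of abelian groups are regarded as (complex) vector spaces, and the long exact cohomology sequence of a short exact sequence of sheaves of abelian groups as an exact sequence of vector spaces and linear maps. For a sheaf of (possibly non-abelian) groups, $H^0$ is the group of global sections and $\check H^1$ is the non-abelian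 Čech cohomology pointed set. A central short exact sequence of sheaves of groups induces an exact sequence of pointed sets on cohomology extending by a connecting map to degree $2$. Primary complex: $\partial^1_{j+1}$ is the composite $H^0(X,\mathcal A_j)\to H^0(X,\mathcal H_k/\mathcal H_{j+1})\xrightarrow{\delta^1}H^1(X,\mathcal A_{j+1})$, where $\delta^1$ is the connecting map of the central sequence $\{e\}\to\mathcal A_{j+1}\to\mathcal H_k/\mathcal H_{j+2}\to\mathcal H_k/\mathcal H_{j+1}\to\{e\}$, $k<j+1$; and $\partial^2_{j+2}$ is the composite $H^1(X,\mathcal A_{j+1})\to\check H^1(X,\mathcal H_k/\mathcal H_{j+2})\xrightarrow{\delta^2}H^2(X,\mathcal A_{j+2})$, where $\delta^2$ is the degree-2 connecting map of the central sequence $\{e\}\to\mathcal A_{j+2}\to\mathcal H_k/\mathcal H_{j+3}\to\mathcal H_k/\mathcal H_{j+2}\to\{e\}$, $k<j+2$. (First maps in the composites are induced by inclusions.) A priori these are only maps of pointed sets. *)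

theory Defs
  imports
    "HOL-Analysis.Abstract_Topology"
    "HOL-Algebra.Product_Groups"
    "HOL-Algebra.Module"
    Complex_Main
begin

section \<open>Sheaves of groups\<close>

record ('x, 'a) sheaf =
  sec :: "'x set \<Rightarrow> 'a monoid"
  res :: "'x set \<Rightarrow> 'x set \<Rightarrow> 'a \<Rightarrow> 'a"

text \<open>Only the values on open sets matter. In \<open>res F U V\<close> the larger set \<open>U\<close> comes first.
  The gluing axiom for the empty family forces \<open>sec F {}\<close> to be trivial.\<close>

definition group_sheaf :: "'x topology \<Rightarrow> ('x, 'a) sheaf \<Rightarrow> bool" where
  "group_sheaf X F \<longleftrightarrow>
     (\<forall>U. openin X U \<longrightarrow> group (sec F U)) \<and>
     (\<forall>U V. openin X U \<and> openin X V \<and> V \<subseteq> U \<longrightarrow> res F U V \<in> hom (sec F U) (sec F V)) \<and>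
     (\<forall>U. openin X U \<longrightarrow> (\<forall>s \<in> carrier (sec F U). res F U U s = s)) \<and>
     (\<forall>U V W. openin X U \<and> openin X V \<and> openin X W \<and> W \<subseteq> V \<and> V \<subseteq> U \<longrightarrow>
        (\<forall>s \<in> carrier (sec F U). res F V W (res F U V s) = res F U W s)) \<and>
     (\<forall>\<U> s. (\<forall>U \<in> \<U>. openin X U \<and> s U \<in> carrier (sec F U)) \<and>
        (\<forall>U \<in> \<U>. \<forall>V \<in> \<U>. res F U (U \<inter> V) (s U) = res F V (U \<inter> V) (s V)) \<longrightarrow>
        (\<exists>!t. t \<in> carrier (sec F (\<Union>\<U>)) \<and> (\<forall>U \<in> \<U>. res F (\<Union>\<U>) U t = s U)))"

definition abelian_sheaf :: "'x topology \<Rightarrow> ('x, 'a) sheaf \<Rightarrow> bool" where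
  "abelian_sheaf X F \<longleftrightarrow> group_sheaf X F \<and> (\<forall>U. openin X U \<longrightarrow> comm_group (sec F U))"

definition subsheaf :: "('x, 'a) sheaf \<Rightarrow> ('x set \<Rightarrow> 'a set) \<Rightarrow> ('x, 'a) sheaf" where
  "subsheaf F K = \<lparr>sec = (\<lambda>U. (sec F U)\<lparr>carrier := K U\<rparr>), res = res F\<rparr>"

definition is_normal_subsheaf :: "'x topology \<Rightarrow> ('x, 'a) sheaf \<Rightarrow> ('x set \<Rightarrow> 'a set) \<Rightarrow> bool" where
  "is_normal_subsheaf X F K \<longleftrightarrow>
     group_sheaf X (subsheaf F K) \<and> (\<forall>U. openin X U \<longrightarrow> K U \<lhd> sec F U)"

definition triv :: "('x, 'a) sheaf \<Rightarrow> 'x set \<Rightarrow> 'a set" where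
  "triv F U = {\<one>\<^bsub>sec F U\<^esub>}"

section \<open>Stalks, quotient sheaves and the Godement resolution\<close>

definition germ_reps :: "'x topology \<Rightarrow> ('x, 'a) sheaf \<Rightarrow> 'x \<Rightarrow> ('x set \<times> 'a) set" where
  "germ_reps X F x = {(U, s). openin X U \<and> x \<in> U \<and> s \<in> carrier (sec F U)}"

text \<open>The element of \<open>F\<^sub>x/K\<^sub>x\<close> represented by a section, as the set of all pairs
  \<open>(V, t)\<close> representing it.\<close>

definition coset_germ ::
    "'x topology \<Rightarrow> ('x, 'a) sheaf \<Rightarrow> ('x set \<Rightarrow> 'a set) \<Rightarrow> 'x \<Rightarrow> 'x set \<times> 'a \<Rightarrow> ('x set \<times> 'a) set" where
  "coset_germ X F K x = (\<lambda>(U, s). {(V, t). (V, t) \<in> germ_reps X F x \<and>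
     (\<exists>W. openin X W \<and> x \<in> W \<and> W \<subseteq> U \<inter> V \<and>
        res F U W s \<otimes>\<^bsub>sec F W\<^esub> inv\<^bsub>sec F W\<^esub> (res F V W t) \<in> K W)})"

definition quot_stalk ::
    "'x topology \<Rightarrow> ('x, 'a) sheaf \<Rightarrow> ('x set \<Rightarrow> 'a set) \<Rightarrow> 'x \<Rightarrow> ('x set \<times> 'a) set monoid" where
  "quot_stalk X F K x = \<lparr>carrier = coset_germ X F K x ` germ_reps X F x,
     mult = (\<lambda>A B. \<Union>(U, s) \<in> A. \<Union>(V, t) \<in> B.
       coset_germ X F K x
         (U \<inter> V, res F U (U \<inter> V) s \<otimes>\<^bsub>sec F (U \<inter> V)\<^esub> res F V (U \<inter> V) t)),
     one = coset_germ X F K x (topspace X, \<one>\<^bsub>sec F (topspace X)\<^esub>)\<rparr>"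

text \<open>The quotient sheaf, i.e. the sheafification of \<open>U \<mapsto> F(U)/K(U)\<close>: sections over \<open>U\<close> are the
  functions on \<open>U\<close> with values in the \<open>F\<^sub>x/K\<^sub>x\<close> that are locally given by sections of \<open>F\<close>.\<close>

definition quot_proj ::
    "'x topology \<Rightarrow> ('x, 'a) sheaf \<Rightarrow> ('x set \<Rightarrow> 'a set) \<Rightarrow> 'x set \<Rightarrow> 'a \<Rightarrow> 'x \<Rightarrow> ('x set \<times> 'a) set" where
  "quot_proj X F K U s = (\<lambda>x \<in> U. coset_germ X F K x (U, s))"

definition quot_sheaf ::
    "'x topology \<Rightarrow> ('x, 'a) sheaf \<Rightarrow> ('x set \<Rightarrow> 'a set) \<Rightarrow> ('x, 'x \<Rightarrow> ('x set \<times> 'a) set) sheaf" where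
  "quot_sheaf X F K = \<lparr>
     sec = (\<lambda>U. (product_group U (quot_stalk X F K))\<lparr>carrier :=
       {\<sigma> \<in> carrier (product_group U (quot_stalk X F K)).
          \<forall>x \<in> U. \<exists>V s. openin X V \<and> x \<in> V \<and> V \<subseteq> U \<and> s \<in> carrier (sec F V) \<and>
            restrict \<sigma> V = quot_proj X F K V s}\<rparr>),
     res = (\<lambda>U V \<sigma>. restrict \<sigma> V)\<rparr>"

abbreviation stalk :: "'x topology \<Rightarrow> ('x, 'a) sheaf \<Rightarrow> 'x \<Rightarrow> ('x set \<times> 'a) set monoid" where
  "stalk X F \<equiv> quot_stalk X F (triv F)"

abbreviation germ ::
    "'x topology \<Rightarrow> ('x, 'a) sheaf \<Rightarrow> 'x \<Rightarrow> 'x set \<times> 'a \<Rightarrow> ('x set \<times> 'a) set" where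
  "germ X F \<equiv> coset_germ X F (triv F)"

text \<open>\<open>god0 X F\<close> is Godement's flasque sheaf \<open>C\<^sup>0(F)\<close> of discontinuous sections, \<open>god_img X F\<close> the
  image of \<open>F\<close> in it, and \<open>god_Z X F\<close> the quotient \<open>C\<^sup>0(F)/F\<close>.\<close>

definition god0 :: "'x topology \<Rightarrow> ('x, 'a) sheaf \<Rightarrow> ('x, 'x \<Rightarrow> ('x set \<times> 'a) set) sheaf" where
  "god0 X F = \<lparr>sec = (\<lambda>U. product_group U (stalk X F)), res = (\<lambda>U V \<sigma>. restrict \<sigma> V)\<rparr>"

definition god_img :: "'x topology \<Rightarrow> ('x, 'a) sheaf \<Rightarrow> 'x set \<Rightarrow> ('x \<Rightarrow> ('x set \<times> 'a) set) set" where
  "god_img X F U = quot_proj X F (triv F) U ` carrier (sec F U)"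

definition god_Z ::
    "'x topology \<Rightarrow> ('x, 'a) sheaf \<Rightarrow> ('x, 'x \<Rightarrow> ('x set \<times> ('x \<Rightarrow> ('x set \<times> 'a) set)) set) sheaf" where
  "god_Z X F = quot_sheaf X (god0 X F) (god_img X F)"

section \<open>Cohomology\<close>

abbreviation sheaf_H0 :: "'x topology \<Rightarrow> ('x, 'a) sheaf \<Rightarrow> 'a monoid" where
  "sheaf_H0 X F \<equiv> sec F (topspace X)"

text \<open>Cech cohomology in degree 1 is computed with Godement's coverings indexed by the points
  of the space, \<open>x \<in> U x\<close>. They are cofinal among all open coverings, and the limit over all
  coverings is the set of cocycles on such coverings, two of them being identified if they become
  cohomologous on a common refinement.\<close>

definition point_cover :: "'x topology \<Rightarrow> ('x \<Rightarrow> 'x set) \<Rightarrow> bool" where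
  "point_cover X U \<longleftrightarrow> (\<forall>x \<in> topspace X. openin X (U x) \<and> x \<in> U x)"

type_synonym ('x, 'a) cochain = "('x \<Rightarrow> 'x set) \<times> ('x \<Rightarrow> 'x \<Rightarrow> 'a)"

definition cocycles :: "'x topology \<Rightarrow> ('x, 'a) sheaf \<Rightarrow> ('x, 'a) cochain set" where
  "cocycles X F = {(U, c). point_cover X U \<and>
     (\<forall>x \<in> topspace X. \<forall>y \<in> topspace X. c x y \<in> carrier (sec F (U x \<inter> U y))) \<and>
     (\<forall>x \<in> topspace X. \<forall>y \<in> topspace X. \<forall>z \<in> topspace X. let W = U x \<inter> U y \<inter> U z in
        res F (U x \<inter> U y) W (c x y) \<otimes>\<^bsub>sec F W\<^esub> res F (U y \<inter> U z) W (c y z) =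
        res F (U x \<inter> U z) W (c x z))}"

definition cohomologous ::
    "'x topology \<Rightarrow> ('x, 'a) sheaf \<Rightarrow> (('x, 'a) cochain \<times> ('x, 'a) cochain) set" where
  "cohomologous X F = {((U, c), (V, d)). (U, c) \<in> cocycles X F \<and> (V, d) \<in> cocycles X F \<and>
     (\<exists>W h. point_cover X W \<and>
        (\<forall>x \<in> topspace X. W x \<subseteq> U x \<inter> V x \<and> h x \<in> carrier (sec F (W x))) \<and>
        (\<forall>x \<in> topspace X. \<forall>y \<in> topspace X. let N = W x \<inter> W y in
           res F (V x \<inter> V y) N (d x y) =
           inv\<^bsub>sec F N\<^esub> (res F (W x) N (h x)) \<otimes>\<^bsub>sec F N\<^esub>
             res F (U x \<inter> U y) N (c x y) \<otimes>\<^bsub>sec F N\<^esub> res F (W y) N (h y)))}"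

text \<open>For a sheaf of non-abelian groups, \<open>cech_H1\<close> is used as a pointed set only: its \<open>one\<close> is
  the base point, and its \<open>mult\<close> is meaningful only for sheaves of abelian groups. For the latter,
  \<open>cech_H1\<close> also serves as \<open>H\<^sup>1\<close>: in degree 1 sheaf cohomology and Cech cohomology agree on every
  space.\<close>

definition cech_H1 :: "'x topology \<Rightarrow> ('x, 'a) sheaf \<Rightarrow> ('x, 'a) cochain set monoid" where
  "cech_H1 X F = \<lparr>carrier = cocycles X F // cohomologous X F,
     mult = (\<lambda>A B. \<Union>(U, c) \<in> A. \<Union>(V, d) \<in> B. cohomologous X F ``
       {(\<lambda>x. U x \<inter> V x, \<lambda>x y. let N = (U x \<inter> V x) \<inter> (U y \<inter> V y) in
          res F (U x \<inter> U y) N (c x y) \<otimes>\<^bsub>sec F N\<^esub> res F (V x \<inter> V y) N (d x y))}),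
     one = cohomologous X F `` {(\<lambda>x. topspace X, \<lambda>x y. \<one>\<^bsub>sec F (topspace X)\<^esub>)}\<rparr>"

text \<open>Sheaf cohomology via Godement's canonical resolution. Put \<open>Z\<^sup>0 = F\<close>, \<open>C\<^sup>p = C\<^sup>0(Z\<^sup>p)\<close> and
  \<open>Z\<^sup>p\<^sup>+\<^sup>1 = C\<^sup>p/Z\<^sup>p \<subseteq> C\<^sup>p\<^sup>+\<^sup>1\<close>. The \<open>p\<close>-cocycles of the complex of global sections of
  \<open>C\<^sup>0 \<rightarrow> C\<^sup>1 \<rightarrow> \<dots>\<close> are the global sections of \<open>Z\<^sup>p\<close>, and for \<open>p > 0\<close> the coboundaries are the
  image of the global sections of \<open>C\<^sup>p\<^sup>-\<^sup>1\<close>.\<close>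

definition god_B1 ::
    "'x topology \<Rightarrow> ('x, 'a) sheaf \<Rightarrow> ('x \<Rightarrow> ('x set \<times> ('x \<Rightarrow> ('x set \<times> 'a) set)) set) set" where
  "god_B1 X F = quot_proj X (god0 X F) (god_img X F) (topspace X) ` carrier (sheaf_H0 X (god0 X F))"

definition god_H1 ::
    "'x topology \<Rightarrow> ('x, 'a) sheaf \<Rightarrow>
      ('x \<Rightarrow> ('x set \<times> ('x \<Rightarrow> ('x set \<times> 'a) set)) set) set monoid" where
  "god_H1 X F = sheaf_H0 X (god_Z X F) Mod god_B1 X F"

definition sheaf_H2 where
  "sheaf_H2 X F = god_H1 X (god_Z X F)"

section \<open>Maps induced by morphisms of sheaves\<close>

text \<open>A morphism \<open>F \<rightarrow> F'\<close> is given by the family \<open>\<phi> U\<close> of maps on sections; the target is passed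
  explicitly.\<close>

definition stalk_map ::
    "'x topology \<Rightarrow> ('x, 'b) sheaf \<Rightarrow> ('x set \<Rightarrow> 'a \<Rightarrow> 'b) \<Rightarrow> 'x \<Rightarrow> ('x set \<times> 'a) set \<Rightarrow> ('x set \<times> 'b) set" where
  "stalk_map X F' \<phi> x A = (\<Union>(U, s) \<in> A. germ X F' x (U, \<phi> U s))"

definition H1_map ::
    "'x topology \<Rightarrow> ('x, 'b) sheaf \<Rightarrow> ('x set \<Rightarrow> 'a \<Rightarrow> 'b) \<Rightarrow> ('x, 'a) cochain set \<Rightarrow> ('x, 'b) cochain set" where
  "H1_map X F' \<phi> \<xi> =
     (\<Union>(U, c) \<in> \<xi>. cohomologous X F' `` {(U, \<lambda>x y. \<phi> (U x \<inter> U y) (c x y))})"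

definition god_Z_map ::
    "'x topology \<Rightarrow> ('x, 'b) sheaf \<Rightarrow> ('x set \<Rightarrow> 'a \<Rightarrow> 'b) \<Rightarrow> 'x set \<Rightarrow>
      ('x \<Rightarrow> ('x set \<times> ('x \<Rightarrow> ('x set \<times> 'a) set)) set) \<Rightarrow>
      ('x \<Rightarrow> ('x set \<times> ('x \<Rightarrow> ('x set \<times> 'b) set)) set)" where
  "god_Z_map X F' \<phi> U \<sigma> = (\<lambda>x \<in> U. \<Union>(V, t) \<in> \<sigma> x.
     coset_germ X (god0 X F') (god_img X F') x (V, \<lambda>y \<in> V. stalk_map X F' \<phi> y (t y)))"

definition H2_map where
  "H2_map X F' \<phi> \<eta> = (\<Union>\<sigma> \<in> \<eta>.
     god_B1 X (god_Z X F') #>\<^bsub>sheaf_H0 X (god_Z X (god_Z X F'))\<^esub>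
       god_Z_map X (god_Z X F') (god_Z_map X F' \<phi>) (topspace X) \<sigma>)"

section \<open>Connecting maps of a central short exact sequence\<close>

text \<open>Throughout, \<open>A \<rightarrow> E \<rightarrow> Q\<close> (maps \<open>i\<close> and \<open>p\<close>) is a short exact sequence of sheaves of groups
  with \<open>A\<close> central in \<open>E\<close>. In degree 1, lift a global section \<open>s\<close> of \<open>Q\<close> to local sections \<open>g x\<close>
  of \<open>E\<close> and take the class of the cocycle \<open>(g x)\<^sup>-\<^sup>1 (g y)\<close>.\<close>

definition conn1 where
  "conn1 X A E Q i p s = (THE \<xi>. \<exists>U g a.
     (U, a) \<in> cocycles X A \<and> \<xi> = cohomologous X A `` {(U, a)} \<and>
     (\<forall>x \<in> topspace X. g x \<in> carrier (sec E (U x)) \<and> p (U x) (g x) = res Q (topspace X) (U x) s) \<and>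
     (\<forall>x \<in> topspace X. \<forall>y \<in> topspace X. let N = U x \<inter> U y in
        i N (a x y) = inv\<^bsub>sec E N\<^esub> (res E (U x) N (g x)) \<otimes>\<^bsub>sec E N\<^esub> res E (U y) N (g y)))"

text \<open>In degree 2 a cocycle of \<open>Q\<close> need not lift to \<open>E\<close> on the sets \<open>U x \<inter> U y\<close>, not even after
  refining the covering (unless the space is paracompact, say), so the usual Cech formula is not
  available. We use the embedding of \<open>A\<close> into the flasque sheaf \<open>C\<^sup>0(A)\<close> instead. The
  cocycle \<open>c\<close> of \<open>Q\<close> is split by discontinuous sections \<open>b x\<close> of \<open>E\<close> on the \<open>U x\<close>:
  \<open>(b x)\<^sup>-\<^sup>1 (b y)\<close> lifts \<open>c x y\<close>. Comparing this with a local (continuous) lift \<open>\<gamma>\<close>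
  of \<open>c x y\<close> gives a local section \<open>\<alpha>\<close> of \<open>C\<^sup>0(A)\<close> which is unique up to \<open>A\<close>. These glue
  to a cocycle \<open>u\<close> of \<open>C\<^sup>0(A)/A\<close>; its class is the image of the class of \<open>c\<close> under the connecting
  map of the push-out \<open>C\<^sup>0(A) \<rightarrow> E' \<rightarrow> Q\<close> of the given sequence.\<close>

definition shifts_to where
  "shifts_to X A E Q i p U c u \<longleftrightarrow> (\<exists>b.
     (\<forall>x \<in> topspace X. \<forall>z \<in> U x. b x z \<in> carrier (stalk X E z)) \<and>
     (\<forall>x \<in> topspace X. \<forall>y \<in> topspace X. \<forall>z \<in> U x \<inter> U y.
        stalk_map X Q p z (inv\<^bsub>stalk X E z\<^esub> (b x z) \<otimes>\<^bsub>stalk X E z\<^esub> b y z) =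
          germ X Q z (U x \<inter> U y, c x y) \<and>
        (\<exists>V \<gamma> \<alpha>. openin X V \<and> z \<in> V \<and> V \<subseteq> U x \<inter> U y \<and>
           \<gamma> \<in> carrier (sec E V) \<and> p V \<gamma> = res Q (U x \<inter> U y) V (c x y) \<and>
           \<alpha> \<in> carrier (sec (god0 X A) V) \<and>
           (\<forall>w \<in> V. stalk_map X E i w (\<alpha> w) \<otimes>\<^bsub>stalk X E w\<^esub> germ X E w (V, \<gamma>) =
              inv\<^bsub>stalk X E w\<^esub> (b x w) \<otimes>\<^bsub>stalk X E w\<^esub> b y w) \<and>
           res (god_Z X A) (U x \<inter> U y) V (u x y) = quot_proj X (god0 X A) (god_img X A) V \<alpha>)))"

definition conn_shift where
  "conn_shift X A E Q i p \<xi> = (THE \<zeta>. \<exists>U c u. (U, c) \<in> \<xi> \<and> (U, u) \<in> cocycles X (god_Z X A) \<and>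
     shifts_to X A E Q i p U c u \<and> \<zeta> = cohomologous X (god_Z X A) `` {(U, u)})"

text \<open>The canonical isomorphism from Cech to sheaf cohomology in degree 1, for a sheaf \<open>F\<close> of
  abelian groups: a cocycle \<open>c\<close> is split by discontinuous sections \<open>t x\<close>, whose
  classes modulo \<open>F\<close> glue to a global section of \<open>C\<^sup>0(F)/F\<close>.\<close>

definition cech_to_god where
  "cech_to_god X F \<xi> = (THE \<eta>. \<exists>U c t \<sigma>. (U, c) \<in> \<xi> \<and>
     (\<forall>x \<in> topspace X. t x \<in> carrier (sec (god0 X F) (U x))) \<and>
     (\<forall>x \<in> topspace X. \<forall>y \<in> topspace X. \<forall>z \<in> U x \<inter> U y.
        inv\<^bsub>stalk X F z\<^esub> (t x z) \<otimes>\<^bsub>stalk X F z\<^esub> t y z = germ X F z (U x \<inter> U y, c x y)) \<and>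
     \<sigma> \<in> carrier (sheaf_H0 X (god_Z X F)) \<and>
     (\<forall>x \<in> topspace X.
        res (god_Z X F) (topspace X) (U x) \<sigma> = quot_proj X (god0 X F) (god_img X F) (U x) (t x)) \<and>
     \<eta> = god_B1 X F #>\<^bsub>sheaf_H0 X (god_Z X F)\<^esub> \<sigma>)"

definition conn2 where
  "conn2 X A E Q i p \<xi> = cech_to_god X (god_Z X A) (conn_shift X A E Q i p \<xi>)"

section \<open>AQ normal series and the primary complex\<close>

definition aq_quot ::
    "'x topology \<Rightarrow> ('x, 'a) sheaf \<Rightarrow> (nat \<Rightarrow> 'x set \<Rightarrow> 'a set) \<Rightarrow> nat \<Rightarrow> nat \<Rightarrow>
      ('x, 'x \<Rightarrow> ('x set \<times> 'a) set) sheaf" where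
  "aq_quot X G H i l = quot_sheaf X (subsheaf G (H i)) (H l)"

text \<open>The canonical map from any \<open>H\<^sub>i'/H\<^sub>l'\<close> with \<open>i \<le> i'\<close> and \<open>l \<le> l'\<close> to \<open>H\<^sub>i/H\<^sub>l\<close>; this covers
  both the inclusions and the projections.\<close>

definition aq_can ::
    "'x topology \<Rightarrow> ('x, 'a) sheaf \<Rightarrow> (nat \<Rightarrow> 'x set \<Rightarrow> 'a set) \<Rightarrow> nat \<Rightarrow> nat \<Rightarrow>
      'x set \<Rightarrow> ('x \<Rightarrow> ('x set \<times> 'a) set) \<Rightarrow> ('x \<Rightarrow> ('x set \<times> 'a) set)" where
  "aq_can X G H i l U \<sigma> = (\<lambda>x \<in> U. \<Union>q \<in> \<sigma> x. coset_germ X (subsheaf G (H i)) (H l) x q)"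

definition AQ_normal_series ::
    "'x topology \<Rightarrow> ('x, 'a) sheaf \<Rightarrow> (nat \<Rightarrow> 'x set \<Rightarrow> 'a set) \<Rightarrow> bool" where
  "AQ_normal_series X G H \<longleftrightarrow>
     group_sheaf X G \<and>
     (\<forall>U. openin X U \<longrightarrow> H 0 U = carrier (sec G U)) \<and>
     (\<forall>j U. openin X U \<longrightarrow> H (Suc j) U \<subseteq> H j U) \<and>
     (\<exists>N. \<forall>j \<ge> N. \<forall>U. openin X U \<longrightarrow> H j U = {\<one>\<^bsub>sec G U\<^esub>}) \<and>
     (\<forall>j. is_normal_subsheaf X G (H j)) \<and>
     (\<forall>j. abelian_sheaf X (aq_quot X G H j (j + 1)))"

definition AQ_degree ::
    "'x topology \<Rightarrow> ('x, 'a) sheaf \<Rightarrow> (nat \<Rightarrow> 'x set \<Rightarrow> 'a set) \<Rightarrow> nat \<Rightarrow> bool" where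
  "AQ_degree X G H d \<longleftrightarrow> (\<forall>j. \<forall>i \<in> {1..d}. abelian_sheaf X (aq_quot X G H j (j + i)))"

text \<open>\<open>k < m\<close>, and \<open>A\<^sub>m = H\<^sub>m/H\<^sub>m\<^sub>+\<^sub>1\<close> lies in the centre of \<open>H\<^sub>k/H\<^sub>m\<^sub>+\<^sub>1\<close>, i.e. the sequence
  \<open>A\<^sub>m \<rightarrow> H\<^sub>k/H\<^sub>m\<^sub>+\<^sub>1 \<rightarrow> H\<^sub>k/H\<^sub>m\<close> is central.\<close>

definition central_at ::
    "'x topology \<Rightarrow> ('x, 'a) sheaf \<Rightarrow> (nat \<Rightarrow> 'x set \<Rightarrow> 'a set) \<Rightarrow> nat \<Rightarrow> nat \<Rightarrow> bool" where
  "central_at X G H k m \<longleftrightarrow> k < m \<and>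
     (\<forall>U. openin X U \<longrightarrow>
        (\<forall>\<sigma> \<in> carrier (sec (aq_quot X G H m (m + 1)) U).
         \<forall>\<tau> \<in> carrier (sec (aq_quot X G H k (m + 1)) U).
           aq_can X G H k (m + 1) U \<sigma> \<otimes>\<^bsub>sec (aq_quot X G H k (m + 1)) U\<^esub> \<tau> =
           \<tau> \<otimes>\<^bsub>sec (aq_quot X G H k (m + 1)) U\<^esub> aq_can X G H k (m + 1) U \<sigma>))"

text \<open>The connecting maps of \<open>A\<^sub>m \<rightarrow> H\<^sub>k/H\<^sub>m\<^sub>+\<^sub>1 \<rightarrow> H\<^sub>k/H\<^sub>m\<close>.\<close>

definition aq_conn1 where
  "aq_conn1 X G H k m =
     conn1 X (aq_quot X G H m (m + 1)) (aq_quot X G H k (m + 1)) (aq_quot X G H k m)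
       (aq_can X G H k (m + 1)) (aq_can X G H k m)"

definition aq_conn2 where
  "aq_conn2 X G H k m =
     conn2 X (aq_quot X G H m (m + 1)) (aq_quot X G H k (m + 1)) (aq_quot X G H k m)
       (aq_can X G H k (m + 1)) (aq_can X G H k m)"

text \<open>The maps \<open>\<partial>\<^sup>1\<^sub>m : H\<^sup>0(A\<^sub>m\<^sub>-\<^sub>1) \<rightarrow> H\<^sup>1(A\<^sub>m)\<close> and \<open>\<partial>\<^sup>2\<^sub>m : H\<^sup>1(A\<^sub>m\<^sub>-\<^sub>1) \<rightarrow> H\<^sup>2(A\<^sub>m)\<close>, formed with \<open>k\<close>.\<close>

definition primary1 where
  "primary1 X G H k m s = aq_conn1 X G H k m (aq_can X G H k m (topspace X) s)"

definition primary2 where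
  "primary2 X G H k m \<xi> = aq_conn2 X G H k m (H1_map X (aq_quot X G H k m) (aq_can X G H k m) \<xi>)"

section \<open>Cohomology groups as complex vector spaces\<close>

definition complex_ring :: "complex ring" where
  "complex_ring = \<lparr>carrier = UNIV, mult = (*), one = 1, zero = 0, add = (+)\<rparr>"

definition as_module :: "'a monoid \<Rightarrow> (complex \<Rightarrow> 'a \<Rightarrow> 'a) \<Rightarrow> (complex, 'a) module" where
  "as_module M sm = \<lparr>carrier = carrier M, mult = mult M, one = one M,
     zero = one M, add = mult M, smult = sm\<rparr>"

definition complex_vs :: "'a monoid \<Rightarrow> (complex \<Rightarrow> 'a \<Rightarrow> 'a) \<Rightarrow> bool" where
  "complex_vs M sm \<longleftrightarrow> Module.module complex_ring (as_module M sm)"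

definition complex_linear ::
    "'a monoid \<Rightarrow> (complex \<Rightarrow> 'a \<Rightarrow> 'a) \<Rightarrow> 'b monoid \<Rightarrow> (complex \<Rightarrow> 'b \<Rightarrow> 'b) \<Rightarrow> ('a \<Rightarrow> 'b) \<Rightarrow> bool" where
  "complex_linear M sm M' sm' f \<longleftrightarrow>
     f \<in> hom M M' \<and> (\<forall>r. \<forall>v \<in> carrier M. f (sm r v) = sm' r (f v))"

text \<open>\<open>s\<^sub>0 i l\<close>, \<open>s\<^sub>1 i l\<close>, \<open>s\<^sub>2 i l\<close> are scalar multiplications on the cohomology groups of
  \<open>H\<^sub>i/H\<^sub>l\<close>, making them complex vector spaces (with the cohomological addition) for the sheaves of
  abelian groups \<open>H\<^sub>j/H\<^sub>j\<^sub>+\<^sub>1\<close> and \<open>H\<^sub>j/H\<^sub>j\<^sub>+\<^sub>2\<close>, such that the long exact cohomology sequence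
  of \<open>A\<^sub>j\<^sub>+\<^sub>1 \<rightarrow> H\<^sub>j/H\<^sub>j\<^sub>+\<^sub>2 \<rightarrow> A\<^sub>j\<close> consists of linear maps. Nothing is required for other
  sequences: an arbitrary automorphism of a sheaf of abelian groups need not be linear on cohomology,
  and a sheaf with torsion admits no such structure.\<close>

definition cohomology_vs where
  "cohomology_vs X G H s\<^sub>0 s\<^sub>1 s\<^sub>2 \<longleftrightarrow>
     (\<forall>j. \<forall>l \<in> {j + 1, j + 2}.
        complex_vs (sheaf_H0 X (aq_quot X G H j l)) (s\<^sub>0 j l) \<and>
        complex_vs (cech_H1 X (aq_quot X G H j l)) (s\<^sub>1 j l) \<and>
        complex_vs (sheaf_H2 X (aq_quot X G H j l)) (s\<^sub>2 j l)) \<and>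
     (\<forall>j. let A = aq_quot X G H (j + 1) (j + 2); E = aq_quot X G H j (j + 2);
              Q = aq_quot X G H j (j + 1); i = aq_can X G H j (j + 2); p = aq_can X G H j (j + 1)
      in complex_linear (sheaf_H0 X A) (s\<^sub>0 (j + 1) (j + 2)) (sheaf_H0 X E) (s\<^sub>0 j (j + 2)) (i (topspace X)) \<and>
         complex_linear (sheaf_H0 X E) (s\<^sub>0 j (j + 2)) (sheaf_H0 X Q) (s\<^sub>0 j (j + 1)) (p (topspace X)) \<and>
         complex_linear (sheaf_H0 X Q) (s\<^sub>0 j (j + 1)) (cech_H1 X A) (s\<^sub>1 (j + 1) (j + 2)) (conn1 X A E Q i p) \<and>
         complex_linear (cech_H1 X A) (s\<^sub>1 (j + 1) (j + 2)) (cech_H1 X E) (s\<^sub>1 j (j + 2)) (H1_map X E i) \<and>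
         complex_linear (cech_H1 X E) (s\<^sub>1 j (j + 2)) (cech_H1 X Q) (s\<^sub>1 j (j + 1)) (H1_map X Q p) \<and>
         complex_linear (cech_H1 X Q) (s\<^sub>1 j (j + 1)) (sheaf_H2 X A) (s\<^sub>2 (j + 1) (j + 2)) (conn2 X A E Q i p) \<and>
         complex_linear (sheaf_H2 X A) (s\<^sub>2 (j + 1) (j + 2)) (sheaf_H2 X E) (s\<^sub>2 j (j + 2)) (H2_map X E i) \<and>
         complex_linear (sheaf_H2 X E) (s\<^sub>2 j (j + 2)) (sheaf_H2 X Q) (s\<^sub>2 j (j + 1)) (H2_map X Q p))"

end

theory Submission
  imports Defs
begin

text \<open>
Write \<open>A\<^sub>j = H\<^sub>j/H\<^sub>j\<^sub>+\<^sub>1\<close>. AQ degree 2 makes every \<open>H\<^sub>j/H\<^sub>j\<^sub>+\<^sub>2\<close> abelian, so each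
\<open>A\<^sub>j\<^sub>+\<^sub>1 \<rightarrow> H\<^sub>j/H\<^sub>j\<^sub>+\<^sub>2 \<rightarrow> A\<^sub>j\<close> is an extension of sheaves of abelian groups. In particular it is central,
which is the first claim, with \<open>k = m - 1\<close>.

The maps of the primary complex are formed with an arbitrary \<open>k\<close> for which
\<open>A\<^sub>m \<rightarrow> H\<^sub>k/H\<^sub>m\<^sub>+\<^sub>1 \<rightarrow> H\<^sub>k/H\<^sub>m\<close> is central. Inclusions map the abelian extension ending in \<open>A\<^sub>m\<^sub>-\<^sub>1\<close>
to this sequence, by the identity on \<open>A\<^sub>m\<close>. Connecting maps are natural, and therefore the composites
defining the two maps are simply the connecting maps of the abelian extensions (\<open>primary1_eq\<close>,
\<open>primary2_eq\<close>). These are homomorphisms, and they are linear whenever the long exact sequences of the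
abelian extensions are.

For the composition, lift a global section of \<open>A\<^sub>j\<close> to local sections \<open>g x\<close> of \<open>H\<^sub>j/H\<^sub>j\<^sub>+\<^sub>3\<close>. The
differences \<open>(g x)\<inverse> g y\<close> form a cocycle of \<open>H\<^sub>j\<^sub>+\<^sub>1/H\<^sub>j\<^sub>+\<^sub>3\<close>, whose image in \<open>A\<^sub>j\<^sub>+\<^sub>1\<close> represents the
value of the first map. The second map is the connecting map of
\<open>A\<^sub>j\<^sub>+\<^sub>2 \<rightarrow> H\<^sub>j\<^sub>+\<^sub>1/H\<^sub>j\<^sub>+\<^sub>3 \<rightarrow> A\<^sub>j\<^sub>+\<^sub>1\<close> and kills everything that comes from the middle term
(\<open>step_conn2_step_conn1\<close>).

Most of the work is to show that the connecting maps are well defined, natural and additive. In degree 1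
this is the usual argument with lifts on a covering (\<open>lift_data\<close>). In degree 2 let \<open>A \<rightarrow> E \<rightarrow> Q\<close> be
central and let \<open>e\<close> be a discontinuous section of \<open>E\<close> over an open set whose image in \<open>Q\<close> is a section
of \<open>Q\<close>. Locally \<open>e = \<alpha> \<gamma>\<close> with a section \<open>\<gamma>\<close> of \<open>E\<close> and a discontinuous section \<open>\<alpha>\<close> of \<open>A\<close>.
Two choices of \<open>\<gamma>\<close> differ by a section of \<open>A\<close>, so the classes of the \<open>\<alpha>\<close> glue to a section of
\<open>C\<^sup>0(A)/A\<close>, here called the defect of \<open>e\<close>. The defect is multiplicative because \<open>A\<close> is central, and
it vanishes on sections of \<open>E\<close>. If discontinuous sections \<open>b x\<close> of \<open>E\<close> split a cocycle of \<open>Q\<close>, then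
the cocycle of \<open>C\<^sup>0(A)/A\<close> attached to them is the defect of \<open>(b x)\<inverse> b y\<close>; independence of choices,
naturality, additivity and vanishing on the image of \<open>E\<close> all follow from the properties of the defect.
The remaining step from Cech classes of \<open>C\<^sup>0(A)/A\<close> to Godement classes is treated in the same spirit, by
splitting cocycles with discontinuous sections.
\<close>

section \<open>Presheaves of groups and their quotients\<close>

lemma (in normal) div_mem_iff:
  assumes "a \<in> carrier G" "b \<in> carrier G"
  shows "a \<otimes> inv b \<in> H \<longleftrightarrow> H #> a = H #> b"
  using assms is_subgroup
  by (metis coset_join1 coset_join2 coset_mult_inv1 coset_mult_inv2 inv_closed inv_inv m_closed subset)

text \<open>Groups of sections with their restriction maps. Uniqueness of gluing is added in
  \<open>separated_presheaf\<close>, and sections are glued as functions with values in stalks, by \<open>quot_glue\<close>.\<close>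

locale group_presheaf =
  fixes X :: "'x topology" and F :: "('x, 'a) sheaf"
  assumes sec_group: "openin X U \<Longrightarrow> group (sec F U)"
    and res_hom: "\<lbrakk>openin X U; openin X V; V \<subseteq> U\<rbrakk> \<Longrightarrow> res F U V \<in> hom (sec F U) (sec F V)"
    and res_id: "\<lbrakk>openin X U; s \<in> carrier (sec F U)\<rbrakk> \<Longrightarrow> res F U U s = s"
    and res_res: "\<lbrakk>openin X U; openin X V; openin X W; W \<subseteq> V; V \<subseteq> U; s \<in> carrier (sec F U)\<rbrakk>
      \<Longrightarrow> res F V W (res F U V s) = res F U W s"
begin

lemma res_group_hom:
  "\<lbrakk>openin X U; openin X V; V \<subseteq> U\<rbrakk> \<Longrightarrow> group_hom (sec F U) (sec F V) (res F U V)"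
  by (simp add: group_hom_axioms_def group_hom_def res_hom sec_group)

lemma res_closed:
  "\<lbrakk>openin X U; openin X V; V \<subseteq> U; s \<in> carrier (sec F U)\<rbrakk> \<Longrightarrow> res F U V s \<in> carrier (sec F V)"
  by (meson group_hom.hom_closed res_group_hom)

lemma res_mult:
  "\<lbrakk>openin X U; openin X V; V \<subseteq> U; s \<in> carrier (sec F U); t \<in> carrier (sec F U)\<rbrakk>
   \<Longrightarrow> res F U V (s \<otimes>\<^bsub>sec F U\<^esub> t) = res F U V s \<otimes>\<^bsub>sec F V\<^esub> res F U V t"
  by (meson group_hom.hom_mult res_group_hom)

lemma res_one: "\<lbrakk>openin X U; openin X V; V \<subseteq> U\<rbrakk> \<Longrightarrow> res F U V \<one>\<^bsub>sec F U\<^esub> = \<one>\<^bsub>sec F V\<^esub>"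
  by (meson group_hom.hom_one res_group_hom)

lemma res_inv:
  "\<lbrakk>openin X U; openin X V; V \<subseteq> U; s \<in> carrier (sec F U)\<rbrakk>
   \<Longrightarrow> res F U V (inv\<^bsub>sec F U\<^esub> s) = inv\<^bsub>sec F V\<^esub> (res F U V s)"
  by (meson group_hom.hom_inv res_group_hom)

lemma one_closed: "openin X U \<Longrightarrow> \<one>\<^bsub>sec F U\<^esub> \<in> carrier (sec F U)"
  by (simp add: group.is_monoid sec_group)

lemma mult_closed: "\<lbrakk>openin X U; s \<in> carrier (sec F U); t \<in> carrier (sec F U)\<rbrakk>
   \<Longrightarrow> s \<otimes>\<^bsub>sec F U\<^esub> t \<in> carrier (sec F U)"
  by (simp add: group.is_monoid monoid.m_closed sec_group)

lemma inv_closed: "\<lbrakk>openin X U; s \<in> carrier (sec F U)\<rbrakk> \<Longrightarrow> inv\<^bsub>sec F U\<^esub> s \<in> carrier (sec F U)"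
  by (simp add: group.inv_closed sec_group)

lemmas closed = res_closed one_closed mult_closed inv_closed

end

lemma group_presheafI: "group_sheaf X F \<Longrightarrow> group_presheaf X F"
  unfolding group_sheaf_def by (elim conjE, rule group_presheaf.intro) simp_all

text \<open>A normal subgroup of sections over each open set, compatible with restriction. The instances are the
  trivial subgroups (giving stalks), \<open>H\<^sub>l\<close> inside \<open>H\<^sub>i\<close>, and a sheaf inside its Godement sheaf.\<close>

locale normal_presheaf = group_presheaf +
  fixes K :: "'a set \<Rightarrow> 'b set"
  assumes K_normal: "openin X U \<Longrightarrow> K U \<lhd> sec F U"
    and K_res: "\<lbrakk>openin X U; openin X V; V \<subseteq> U; s \<in> K U\<rbrakk> \<Longrightarrow> res F U V s \<in> K V"
begin

text \<open>The elements of a quotient stalk are the classes of this equivalence relation on local sections, so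
  that the library of equivalence classes applies to them.\<close>

definition locally_congruent where
  "locally_congruent x = {((U,s),(V,t)). (U,s) \<in> germ_reps X F x \<and> (V,t) \<in> germ_reps X F x \<and>
     (\<exists>W. openin X W \<and> x \<in> W \<and> W \<subseteq> U \<and> W \<subseteq> V \<and>
       K W #>\<^bsub>sec F W\<^esub> res F U W s = K W #>\<^bsub>sec F W\<^esub> res F V W t)}"

lemma coset_germ_locally_congruent:
  assumes "p \<in> germ_reps X F x" shows "coset_germ X F K x p = locally_congruent x `` {p}"
proof -
  obtain U s where p: "p = (U, s)" "openin X U" "x \<in> U" "s \<in> carrier (sec F U)"
    using assms by (cases p) (auto simp: germ_reps_def)
  show ?thesis unfolding p(1) coset_germ_def locally_congruent_def
    using p normal.div_mem_iff[OF K_normal] by (auto simp: germ_reps_def res_closed)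
qed

lemma K_coset_res:
  assumes o: "openin X U" "openin X V" "V \<subseteq> U" and s: "s \<in> carrier (sec F U)" "t \<in> carrier (sec F U)"
    and eq: "K U #>\<^bsub>sec F U\<^esub> s = K U #>\<^bsub>sec F U\<^esub> t"
  shows "K V #>\<^bsub>sec F V\<^esub> res F U V s = K V #>\<^bsub>sec F V\<^esub> res F U V t"
proof -
  have "s \<otimes>\<^bsub>sec F U\<^esub> inv\<^bsub>sec F U\<^esub> t \<in> K U" using normal.div_mem_iff[OF K_normal] o s eq by blast
  then have "res F U V (s \<otimes>\<^bsub>sec F U\<^esub> inv\<^bsub>sec F U\<^esub> t) \<in> K V" using K_res o by blast
  then show ?thesis using normal.div_mem_iff[OF K_normal[OF o(2)]] o s
    by (simp add: closed res_mult res_inv)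
qed

lemma locally_congruent_equiv: "equiv (germ_reps X F x) (locally_congruent x)"
proof (rule equivI)
  show "locally_congruent x \<subseteq> germ_reps X F x \<times> germ_reps X F x" unfolding locally_congruent_def by auto
  show "refl_on (germ_reps X F x) (locally_congruent x)" unfolding locally_congruent_def refl_on_def
    germ_reps_def by auto
  show "sym (locally_congruent x)" unfolding locally_congruent_def sym_def by (auto; metis)
  show "trans (locally_congruent x)"
  proof (rule transI)
    fix p q r assume pq: "(p,q) \<in> locally_congruent x" and qr: "(q,r) \<in> locally_congruent x"
    obtain U s V t T r' where e: "p = (U,s)" "q = (V,t)" "r = (T,r')" by (cases p, cases q, cases r)
    obtain W where W: "openin X W" "x \<in> W" "W \<subseteq> U" "W \<subseteq> V" "K W #>\<^bsub>sec F W\<^esub> res F U W s = K W #>\<^bsub>sec F W\<^esub> res F V W t"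
      using pq unfolding e locally_congruent_def by auto
    obtain W' where W': "openin X W'" "x \<in> W'" "W' \<subseteq> V" "W' \<subseteq> T" "K W' #>\<^bsub>sec F W'\<^esub> res F V W' t = K W' #>\<^bsub>sec F
      W'\<^esub> res F T W' r'"
      using qr unfolding e locally_congruent_def by auto
    have s: "openin X U" "openin X V" "openin X T" "s \<in> carrier (sec F U)" "t \<in> carrier (sec F V)" "r' \<in> carrier
      (sec F T)"
      and pr: "p \<in> germ_reps X F x" "r \<in> germ_reps X F x"
      using pq qr unfolding e locally_congruent_def germ_reps_def by auto
    let ?N = "W \<inter> W'"
    have N: "openin X ?N" using W W' by blast
    have "K ?N #>\<^bsub>sec F ?N\<^esub> res F U ?N s = K ?N #>\<^bsub>sec F ?N\<^esub> res F V ?N t"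
      using K_coset_res[OF W(1) N _ _ _ W(5)] W s N by (simp add: res_closed res_res)
    moreover have "K ?N #>\<^bsub>sec F ?N\<^esub> res F V ?N t = K ?N #>\<^bsub>sec F ?N\<^esub> res F T ?N r'"
      using K_coset_res[OF W'(1) N _ _ _ W'(5)] W' s N by (simp add: res_closed res_res)
    ultimately show "(p,r) \<in> locally_congruent x" using pr W W' N unfolding e locally_congruent_def
      by (auto intro!: exI[of _ ?N])
  qed
qed

lemma coset_germ_eq_iff:
  assumes "openin X U" "x \<in> U" "s \<in> carrier (sec F U)" "openin X V" "x \<in> V" "t \<in> carrier (sec F V)"
  shows "coset_germ X F K x (U,s) = coset_germ X F K x (V,t) \<longleftrightarrow>
    (\<exists>W. openin X W \<and> x \<in> W \<and> W \<subseteq> U \<and> W \<subseteq> V \<and>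
       res F U W s \<otimes>\<^bsub>sec F W\<^esub> inv\<^bsub>sec F W\<^esub> (res F V W t) \<in> K W)"
proof -
  have r: "(U,s) \<in> germ_reps X F x" "(V,t) \<in> germ_reps X F x" using assms by (auto simp: germ_reps_def)
  have "coset_germ X F K x (U,s) = coset_germ X F K x (V,t) \<longleftrightarrow> ((U,s),(V,t)) \<in> locally_congruent x"
    using eq_equiv_class_iff[OF locally_congruent_equiv r] coset_germ_locally_congruent r by simp
  also have "\<dots> \<longleftrightarrow> (\<exists>W. openin X W \<and> x \<in> W \<and> W \<subseteq> U \<and> W \<subseteq> V \<and>
       res F U W s \<otimes>\<^bsub>sec F W\<^esub> inv\<^bsub>sec F W\<^esub> (res F V W t) \<in> K W)"
    unfolding locally_congruent_def using assms r normal.div_mem_iff[OF K_normal] by (auto simp: res_closed)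
  finally show ?thesis .
qed

lemma coset_germ_mem: "p \<in> germ_reps X F x \<Longrightarrow> p \<in> coset_germ X F K x p"
  using coset_germ_locally_congruent locally_congruent_equiv equiv_class_self by metis

lemma coset_germ_eq_mem:
  assumes "p \<in> germ_reps X F x" "q \<in> coset_germ X F K x p"
  shows "q \<in> germ_reps X F x" "coset_germ X F K x q = coset_germ X F K x p"
proof -
  have pq: "(p,q) \<in> locally_congruent x" using assms coset_germ_locally_congruent by blast
  then show q: "q \<in> germ_reps X F x" unfolding locally_congruent_def by auto
  show "coset_germ X F K x q = coset_germ X F K x p"
    using equiv_class_eq[OF locally_congruent_equiv pq] coset_germ_locally_congruent q assms by metis
qed

text \<open>Operations on stalks are defined as unions over all representatives of a germ; such a union collapses
  as soon as the summand depends on the germ only.\<close>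

lemma coset_germ_UNION:
  assumes U: "openin X U" "x \<in> U" "s \<in> carrier (sec F U)"
    and f: "\<And>V t. \<lbrakk>openin X V; x \<in> V; t \<in> carrier (sec F V); coset_germ X F K x (V,t) = coset_germ X F K x (U,s)\<rbrakk>
       \<Longrightarrow> f (V,t) = f (U,s)"
  shows "(\<Union>q \<in> coset_germ X F K x (U,s). f q) = f (U,s)"
proof -
  have r: "(U,s) \<in> germ_reps X F x" using U by (simp add: germ_reps_def)
  have "f q = f (U,s)" if "q \<in> coset_germ X F K x (U,s)" for q
    using coset_germ_eq_mem[OF r that] f by (cases q) (auto simp: germ_reps_def)
  then show ?thesis using coset_germ_mem[OF r] by blast
qed

lemma coset_germ_res:
  assumes "openin X U" "s \<in> carrier (sec F U)" "openin X V" "x \<in> V" "V \<subseteq> U"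
  shows "coset_germ X F K x (V, res F U V s) = coset_germ X F K x (U,s)"
proof -
  have "\<one>\<^bsub>sec F V\<^esub> \<in> K V" using K_normal[OF assms(3)] by (simp add: normal_def subgroup.one_closed)
  then show ?thesis using assms
    by (subst coset_germ_eq_iff) (auto simp: res_closed res_res subset_eq group.r_inv sec_group intro!: exI[of _ V])
qed

lemma quot_stalk_cases:
  assumes "A \<in> carrier (quot_stalk X F K x)"
  obtains U s where "openin X U" "x \<in> U" "s \<in> carrier (sec F U)" "A = coset_germ X F K x (U,s)"
  using assms unfolding quot_stalk_def germ_reps_def by auto

lemma quot_stalk_cases_in:
  assumes "A \<in> carrier (quot_stalk X F K x)" "openin X N" "x \<in> N"
  obtains U s where "openin X U" "x \<in> U" "U \<subseteq> N" "s \<in> carrier (sec F U)" "A = coset_germ X F K x (U,s)"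
proof -
  obtain U s where U: "openin X U" "x \<in> U" "s \<in> carrier (sec F U)" "A = coset_germ X F K x (U,s)"
    using quot_stalk_cases[OF assms(1)] .
  show ?thesis using U assms by (intro that[of "U \<inter> N" "res F U (U \<inter> N) s"])
      (auto simp: openin_Int res_closed coset_germ_res)
qed

lemma quot_stalk_cases2:
  assumes "A \<in> carrier (quot_stalk X F K x)" "B \<in> carrier (quot_stalk X F K x)"
  obtains U s t where "openin X U" "x \<in> U" "s \<in> carrier (sec F U)" "t \<in> carrier (sec F U)"
    "A = coset_germ X F K x (U,s)" "B = coset_germ X F K x (U,t)"
proof -
  obtain U s where U: "openin X U" "x \<in> U" "s \<in> carrier (sec F U)" "A = coset_germ X F K x (U,s)"
    using quot_stalk_cases[OF assms(1)] .
  obtain V t where V: "openin X V" "x \<in> V" "V \<subseteq> U" "t \<in> carrier (sec F V)" "B = coset_germ X F K x (V,t)"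
    using quot_stalk_cases_in[OF assms(2) U(1,2)] .
  show ?thesis using U V by (intro that[of V "res F U V s" t]) (auto simp: res_closed coset_germ_res)
qed

lemma coset_germ_closed:
  "\<lbrakk>openin X U; x \<in> U; s \<in> carrier (sec F U)\<rbrakk> \<Longrightarrow> coset_germ X F K x (U,s) \<in> carrier (quot_stalk X F K x)"
  unfolding quot_stalk_def germ_reps_def by auto

text \<open>Products of congruent sections are congruent because the subgroups are normal.\<close>

lemma coset_germ_cong_mult:
  assumes U: "openin X U" "x \<in> U" "s \<in> carrier (sec F U)" "t \<in> carrier (sec F U)"
    and V: "openin X V" "x \<in> V" "s' \<in> carrier (sec F V)" "t' \<in> carrier (sec F V)"
    and eq: "coset_germ X F K x (V,s') = coset_germ X F K x (U,s)" "coset_germ X F K x (V,t') = coset_germ X F K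
      x (U,t)"
  shows "coset_germ X F K x (V,s' \<otimes>\<^bsub>sec F V\<^esub> t') = coset_germ X F K x (U,s \<otimes>\<^bsub>sec F U\<^esub> t)"
proof -
  obtain W where W: "openin X W" "x \<in> W" "W \<subseteq> V" "W \<subseteq> U"
    "res F V W s' \<otimes>\<^bsub>sec F W\<^esub> inv\<^bsub>sec F W\<^esub> (res F U W s) \<in> K W"
    using eq(1) coset_germ_eq_iff[OF V(1-3) U(1-3)] by blast
  obtain W' where W': "openin X W'" "x \<in> W'" "W' \<subseteq> V" "W' \<subseteq> U"
    "res F V W' t' \<otimes>\<^bsub>sec F W'\<^esub> inv\<^bsub>sec F W'\<^esub> (res F U W' t) \<in> K W'"
    using eq(2) coset_germ_eq_iff[OF V(1,2,4) U(1,2,4)] by blast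
  let ?N = "W \<inter> W'"
  have N: "openin X ?N" "x \<in> ?N" "?N \<subseteq> V" "?N \<subseteq> U" using W W' by auto
  interpret N: normal "K ?N" "sec F ?N" using K_normal N by blast
  have 1: "res F V ?N s' \<otimes>\<^bsub>sec F ?N\<^esub> inv\<^bsub>sec F ?N\<^esub> (res F U ?N s) \<in> K ?N"
    using K_res[OF W(1) N(1) _ W(5)] W U V N by (simp add: res_closed res_res res_mult res_inv closed)
  have 2: "res F V ?N t' \<otimes>\<^bsub>sec F ?N\<^esub> inv\<^bsub>sec F ?N\<^esub> (res F U ?N t) \<in> K ?N"
    using K_res[OF W'(1) N(1) _ W'(5)] W' U V N by (simp add: res_closed res_res res_mult res_inv closed)
  have c: "res F V ?N s' \<in> carrier (sec F ?N)" "res F V ?N t' \<in> carrier (sec F ?N)"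
    "res F U ?N s \<in> carrier (sec F ?N)" "res F U ?N t \<in> carrier (sec F ?N)"
    using U V N by (auto simp: res_closed)
  have "K ?N #>\<^bsub>sec F ?N\<^esub> (res F V ?N s' \<otimes>\<^bsub>sec F ?N\<^esub> res F V ?N t') = 
    K ?N #>\<^bsub>sec F ?N\<^esub> (res F U ?N s \<otimes>\<^bsub>sec F ?N\<^esub> res F U ?N t)"
    using 1 2 c N.div_mem_iff N.rcos_sum by metis
  then have "(res F V ?N s' \<otimes>\<^bsub>sec F ?N\<^esub> res F V ?N t') \<otimes>\<^bsub>sec F ?N\<^esub> inv\<^bsub>sec F ?N\<^esub>
     (res F U ?N s \<otimes>\<^bsub>sec F ?N\<^esub> res F U ?N t) \<in> K ?N"
    using c N.div_mem_iff by simp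
  then show ?thesis using U V N
    by (subst coset_germ_eq_iff) (auto simp: closed res_mult intro!: exI[of _ ?N])
qed

lemma coset_germ_mult_gen:
  assumes U: "openin X U" "x \<in> U" "s \<in> carrier (sec F U)" and V: "openin X V" "x \<in> V" "t \<in> carrier (sec F V)"
  shows "coset_germ X F K x (U,s) \<otimes>\<^bsub>quot_stalk X F K x\<^esub> coset_germ X F K x (V,t) =
    coset_germ X F K x (U \<inter> V, res F U (U \<inter> V) s \<otimes>\<^bsub>sec F (U \<inter> V)\<^esub> res F V (U \<inter> V) t)"
proof -
  let ?g = "\<lambda>(U,s) (V,t). coset_germ X F K x (U \<inter> V, res F U (U \<inter> V) s \<otimes>\<^bsub>sec F (U \<inter> V)\<^esub> res F V (U \<inter> V) t)"
  have *: "?g (U',s') (V',t') = ?g (U,s) (V,t)" 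
    if "openin X U'" "x \<in> U'" "s' \<in> carrier (sec F U')" "openin X V'" "x \<in> V'" "t' \<in> carrier (sec F V')"
     and e: "coset_germ X F K x (U',s') = coset_germ X F K x (U,s)"  "coset_germ X F K x (V',t') = coset_germ X
       F K x (V,t)"
    for U' s' V' t'
    unfolding split using that U V
    by (intro coset_germ_cong_mult) (simp_all add: openin_Int res_closed coset_germ_res)
  have "coset_germ X F K x (U,s) \<otimes>\<^bsub>quot_stalk X F K x\<^esub> coset_germ X F K x (V,t) = 
    (\<Union>p \<in> coset_germ X F K x (U,s). \<Union>q \<in> coset_germ X F K x (V,t). ?g p q)"
    unfolding quot_stalk_def by (auto simp: split_def)
  also have "\<dots> = (\<Union>q \<in> coset_germ X F K x (V,t). ?g (U,s) q)"
  proof (rule coset_germ_UNION[OF U], rule SUP_cong[OF refl])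
    fix U' s' q assume a: "openin X U'" "x \<in> U'" "s' \<in> carrier (sec F U')" 
     "coset_germ X F K x (U',s') = coset_germ X F K x (U,s)" and q: "q \<in> coset_germ X F K x (V,t)"
    obtain V' t' where q': "q = (V',t')" "openin X V'" "x \<in> V'" "t' \<in> carrier (sec F V')"
      "coset_germ X F K x (V',t') = coset_germ X F K x (V,t)"
      using coset_germ_eq_mem[OF _ q] V by (cases q) (auto simp: germ_reps_def)
    show "?g (U',s') q = ?g (U,s) q"
      unfolding q' split using U a q'
      by (intro coset_germ_cong_mult) (simp_all add: openin_Int res_closed coset_germ_res)
  qed
  also have "\<dots> = ?g (U,s) (V,t)"
    by (rule coset_germ_UNION[OF V], rule *) (use U in auto)
  finally show ?thesis by simp
qed

lemma coset_germ_mult: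
  assumes U: "openin X U" "x \<in> U" "s \<in> carrier (sec F U)" "t \<in> carrier (sec F U)"
  shows "coset_germ X F K x (U,s) \<otimes>\<^bsub>quot_stalk X F K x\<^esub> coset_germ X F K x (U,t) =
    coset_germ X F K x (U, s \<otimes>\<^bsub>sec F U\<^esub> t)"
  using coset_germ_mult_gen[OF U(1-3) U(1,2,4)] U by (simp add: res_id)

lemma coset_germ_one:
  assumes "openin X U" "x \<in> U"
  shows "\<one>\<^bsub>quot_stalk X F K x\<^esub> = coset_germ X F K x (U, \<one>\<^bsub>sec F U\<^esub>)"
  using coset_germ_res[of "topspace X" "\<one>\<^bsub>sec F (topspace X)\<^esub>" U x] assms
  by (simp add: quot_stalk_def res_one one_closed openin_subset)

lemma quot_stalk_group:
  assumes x: "x \<in> topspace X" shows "group (quot_stalk X F K x)"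
proof (rule groupI)
  fix A B assume AB: "A \<in> carrier (quot_stalk X F K x)" "B \<in> carrier (quot_stalk X F K x)"
  obtain U s t where U: "openin X U" "x \<in> U" "s \<in> carrier (sec F U)" "t \<in> carrier (sec F U)"
    "A = coset_germ X F K x (U,s)" "B = coset_germ X F K x (U,t)" using quot_stalk_cases2[OF AB] .
  then show "A \<otimes>\<^bsub>quot_stalk X F K x\<^esub> B \<in> carrier (quot_stalk X F K x)"
    by (simp add: coset_germ_mult coset_germ_closed mult_closed)
  fix C assume C: "C \<in> carrier (quot_stalk X F K x)"
  obtain V r where V: "openin X V" "x \<in> V" "V \<subseteq> U" "r \<in> carrier (sec F V)" "C = coset_germ X F K x (V,r)"
    using quot_stalk_cases_in[OF C U(1,2)] .
  let ?s = "res F U V s" and ?t = "res F U V t"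
  have "A = coset_germ X F K x (V,?s)" "B = coset_germ X F K x (V,?t)" "?s \<in> carrier (sec F V)" "?t \<in> carrier
    (sec F V)"
    using U V by (auto simp: coset_germ_res res_closed)
  then show "A \<otimes>\<^bsub>quot_stalk X F K x\<^esub> B \<otimes>\<^bsub>quot_stalk X F K x\<^esub> C = A \<otimes>\<^bsub>quot_stalk X F K x\<^esub> (B \<otimes>\<^bsub>quot_stalk X F K x\<^esub> C)"
    using V by (simp add: coset_germ_mult mult_closed monoid.m_assoc sec_group group.is_monoid)
next
  show "\<one>\<^bsub>quot_stalk X F K x\<^esub> \<in> carrier (quot_stalk X F K x)"
    using x by (simp add: coset_germ_one[OF openin_topspace] coset_germ_closed one_closed)
  fix A assume "A \<in> carrier (quot_stalk X F K x)"
  then obtain U s where U: "openin X U" "x \<in> U" "s \<in> carrier (sec F U)" "A = coset_germ X F K x (U,s)"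
    using quot_stalk_cases by blast
  show "\<one>\<^bsub>quot_stalk X F K x\<^esub> \<otimes>\<^bsub>quot_stalk X F K x\<^esub> A = A"
    using U by (simp add: coset_germ_one[OF U(1,2)] coset_germ_mult one_closed monoid.l_one sec_group group.is_monoid)
  show "\<exists>B \<in> carrier (quot_stalk X F K x). B \<otimes>\<^bsub>quot_stalk X F K x\<^esub> A = \<one>\<^bsub>quot_stalk X F K x\<^esub>"
    by (rule bexI[of _ "coset_germ X F K x (U, inv\<^bsub>sec F U\<^esub> s)"])
      (use U in \<open>simp_all add: coset_germ_one[OF U(1,2)] coset_germ_mult inv_closed group.l_inv sec_group
        coset_germ_closed\<close>)
qed

lemma coset_germ_inv:
  assumes U: "openin X U" "x \<in> U" "s \<in> carrier (sec F U)"
  shows "inv\<^bsub>quot_stalk X F K x\<^esub> (coset_germ X F K x (U,s)) = coset_germ X F K x (U, inv\<^bsub>sec F U\<^esub> s)"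
proof -
  interpret group "quot_stalk X F K x" using quot_stalk_group U openin_subset by blast
  show ?thesis using U
    by (intro inv_equality) (simp_all add: coset_germ_mult coset_germ_closed group_presheaf.inv_closed
      group_presheaf_axioms group.l_inv sec_group coset_germ_one[OF U(1,2)])
qed

lemma quot_stalk_comm:
  assumes x: "x \<in> topspace X" and c: "\<And>U. openin X U \<Longrightarrow> comm_group (sec F U)"
  shows "comm_group (quot_stalk X F K x)"
proof (rule group.group_comm_groupI[OF quot_stalk_group[OF x]])
  fix A B assume AB: "A \<in> carrier (quot_stalk X F K x)" "B \<in> carrier (quot_stalk X F K x)"
  obtain U s t where U: "openin X U" "x \<in> U" "s \<in> carrier (sec F U)" "t \<in> carrier (sec F U)"
    "A = coset_germ X F K x (U,s)" "B = coset_germ X F K x (U,t)" using quot_stalk_cases2[OF AB] .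
  then show "A \<otimes>\<^bsub>quot_stalk X F K x\<^esub> B = B \<otimes>\<^bsub>quot_stalk X F K x\<^esub> A"
    using comm_monoid.m_comm[OF comm_group.axioms(1)[OF c[OF U(1)]]]
    by (simp add: coset_germ_mult)
qed

lemma quot_sec_iff:
  "\<sigma> \<in> carrier (sec (quot_sheaf X F K) U) \<longleftrightarrow>
     \<sigma> \<in> (\<Pi>\<^sub>E x\<in>U. carrier (quot_stalk X F K x)) \<and>
     (\<forall>x\<in>U. \<exists>V s. openin X V \<and> x \<in> V \<and> V \<subseteq> U \<and> s \<in> carrier (sec F V) \<and>
        (\<forall>y\<in>V. \<sigma> y = coset_germ X F K y (V,s)))"
proof -
  have "restrict \<sigma> V = quot_proj X F K V s \<longleftrightarrow> (\<forall>y\<in>V. \<sigma> y = coset_germ X F K y (V,s))" for V s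
    unfolding quot_proj_def by (auto simp: fun_eq_iff restrict_def)
  then show ?thesis by (simp add: quot_sheaf_def)
qed

lemma quot_sec_PiE:
  "\<sigma> \<in> carrier (sec (quot_sheaf X F K) U) \<Longrightarrow> \<sigma> \<in> (\<Pi>\<^sub>E x\<in>U. carrier (quot_stalk X F K x))"
  by (rule conjunct1[OF quot_sec_iff[THEN iffD1]])

lemma quot_sec_mult: "\<sigma> \<otimes>\<^bsub>sec (quot_sheaf X F K) U\<^esub> \<tau> = (\<lambda>x\<in>U. \<sigma> x \<otimes>\<^bsub>quot_stalk X F K x\<^esub> \<tau> x)"
  by (simp add: quot_sheaf_def product_group_def)

lemma quot_sec_one: "\<one>\<^bsub>sec (quot_sheaf X F K) U\<^esub> = (\<lambda>x\<in>U. \<one>\<^bsub>quot_stalk X F K x\<^esub>)"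
  by (simp add: quot_sheaf_def product_group_def)

lemma quot_res: "res (quot_sheaf X F K) U V \<sigma> = restrict \<sigma> V"
  by (simp add: quot_sheaf_def)

text \<open>The representing section can be taken on a neighbourhood inside any prescribed one.\<close>

lemma quot_secE:
  assumes "\<sigma> \<in> carrier (sec (quot_sheaf X F K) U)" "x \<in> U" "openin X N" "x \<in> N"
  obtains V s where "openin X V" "x \<in> V" "V \<subseteq> U" "V \<subseteq> N" "s \<in> carrier (sec F V)"
    "\<forall>y\<in>V. \<sigma> y = coset_germ X F K y (V,s)"
proof -
  obtain V s where V: "openin X V" "x \<in> V" "V \<subseteq> U" "s \<in> carrier (sec F V)"
    "\<forall>y\<in>V. \<sigma> y = coset_germ X F K y (V,s)" 
    using conjunct2[OF assms(1)[unfolded quot_sec_iff], THEN bspec, OF assms(2)] by blast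
  show ?thesis
    by (rule that[of "V \<inter> N" "res F V (V \<inter> N) s"]) (use V assms in \<open>auto simp: res_closed coset_germ_res openin_Int\<close>)
qed

lemma quot_sec_subgroup:
  assumes U: "openin X U"
  shows "subgroup (carrier (sec (quot_sheaf X F K) U)) (product_group U (quot_stalk X F K))"
proof -
  have g: "\<And>x. x \<in> U \<Longrightarrow> group (quot_stalk X F K x)" using quot_stalk_group U openin_subset by blast
  interpret P: group "product_group U (quot_stalk X F K)" using g by simp
  show ?thesis
  proof (rule P.subgroupI)
    show "carrier (sec (quot_sheaf X F K) U) \<subseteq> carrier (product_group U (quot_stalk X F K))"
      unfolding carrier_product_group by (rule subsetI) (rule quot_sec_PiE)
    have "\<one>\<^bsub>product_group U (quot_stalk X F K)\<^esub> \<in> carrier (sec (quot_sheaf X F K) U)"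
      unfolding quot_sec_iff using U g
      by (auto simp: group.is_monoid monoid.one_closed intro!: exI[of _ U] exI[of _ "\<one>\<^bsub>sec F U\<^esub>"] one_closed
        coset_germ_one)
    then show "carrier (sec (quot_sheaf X F K) U) \<noteq> {}" by blast
  next
    fix \<sigma> assume s: "\<sigma> \<in> carrier (sec (quot_sheaf X F K) U)"
    have e: "inv\<^bsub>product_group U (quot_stalk X F K)\<^esub> \<sigma> = (\<lambda>x\<in>U. inv\<^bsub>quot_stalk X F K x\<^esub> \<sigma> x)"
      using s g by (subst inv_product_group) (auto simp: quot_sec_iff)
    show "inv\<^bsub>product_group U (quot_stalk X F K)\<^esub> \<sigma> \<in> carrier (sec (quot_sheaf X F K) U)"
      unfolding quot_sec_iff e
    proof (intro conjI ballI)
      show "(\<lambda>x\<in>U. inv\<^bsub>quot_stalk X F K x\<^esub> \<sigma> x) \<in> (\<Pi>\<^sub>E x\<in>U. carrier (quot_stalk X F K x))"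
        using s g by (auto simp: quot_sec_iff PiE_iff group.inv_closed)
      fix x assume x: "x \<in> U"
      obtain V t where V: "openin X V" "x \<in> V" "V \<subseteq> U" "V \<subseteq> U" "t \<in> carrier (sec F V)"
         "\<forall>y\<in>V. \<sigma> y = coset_germ X F K y (V,t)" using quot_secE[OF s x U x] .
      show "\<exists>V s. openin X V \<and> x \<in> V \<and> V \<subseteq> U \<and> s \<in> carrier (sec F V) \<and>
          (\<forall>y\<in>V. (\<lambda>x\<in>U. inv\<^bsub>quot_stalk X F K x\<^esub> \<sigma> x) y = coset_germ X F K y (V, s))"
        using V by (intro exI[of _ V] exI[of _ "inv\<^bsub>sec F V\<^esub> t"]) (auto simp: inv_closed coset_germ_inv subset_eq)
    qed
  next
    fix \<sigma> \<tau> assume s: "\<sigma> \<in> carrier (sec (quot_sheaf X F K) U)" and t: "\<tau> \<in> carrier (sec (quot_sheaf X F K) U)"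
    show "\<sigma> \<otimes>\<^bsub>product_group U (quot_stalk X F K)\<^esub> \<tau> \<in> carrier (sec (quot_sheaf X F K) U)"
      unfolding quot_sec_iff mult_product_group
    proof (intro conjI ballI)
      show "(\<lambda>x\<in>U. \<sigma> x \<otimes>\<^bsub>quot_stalk X F K x\<^esub> \<tau> x) \<in> (\<Pi>\<^sub>E x\<in>U. carrier (quot_stalk X F K x))"
        using s t g by (auto simp: quot_sec_iff PiE_iff group.is_monoid monoid.m_closed)
      fix x assume x: "x \<in> U"
      obtain V a where V: "openin X V" "x \<in> V" "V \<subseteq> U" "V \<subseteq> U" "a \<in> carrier (sec F V)"
         "\<forall>y\<in>V. \<sigma> y = coset_germ X F K y (V,a)" using quot_secE[OF s x U x] .
      obtain W b where W: "openin X W" "x \<in> W" "W \<subseteq> U" "W \<subseteq> V" "b \<in> carrier (sec F W)"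
         "\<forall>y\<in>W. \<tau> y = coset_germ X F K y (W,b)" using quot_secE[OF t x V(1,2)] .
      show "\<exists>V s. openin X V \<and> x \<in> V \<and> V \<subseteq> U \<and> s \<in> carrier (sec F V) \<and>
          (\<forall>y\<in>V. (\<lambda>x\<in>U. \<sigma> x \<otimes>\<^bsub>quot_stalk X F K x\<^esub> \<tau> x) y = coset_germ X F K y (V, s))"
        using V W 
        by (intro exI[of _ W] exI[of _ "res F V W a \<otimes>\<^bsub>sec F W\<^esub> b"])
          (auto simp: closed subset_eq coset_germ_mult[symmetric] coset_germ_res)
    qed
  qed
qed

lemma quot_sec_val: "\<lbrakk>\<sigma> \<in> carrier (sec (quot_sheaf X F K) U); x \<in> U\<rbrakk> \<Longrightarrow> \<sigma> x \<in> carrier (quot_stalk X F K x)"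
  by (auto simp: quot_sec_iff)

lemma quot_sec_eqI:
  assumes "\<sigma> \<in> carrier (sec (quot_sheaf X F K) U)" "\<tau> \<in> carrier (sec (quot_sheaf X F K) U)"
    "\<And>x. x \<in> U \<Longrightarrow> \<sigma> x = \<tau> x"
  shows "\<sigma> = \<tau>"
  using assms by (auto simp: quot_sec_iff intro: PiE_ext)

lemma quot_res_closed:
  assumes "openin X U" "openin X V" "V \<subseteq> U" and s: "\<sigma> \<in> carrier (sec (quot_sheaf X F K) U)"
  shows "restrict \<sigma> V \<in> carrier (sec (quot_sheaf X F K) V)"
  unfolding quot_sec_iff
proof (intro conjI ballI)
  show "restrict \<sigma> V \<in> (\<Pi>\<^sub>E x\<in>V. carrier (quot_stalk X F K x))" using assms by (auto simp: quot_sec_iff)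
  fix x assume x: "x \<in> V"
  have xU: "x \<in> U" using x assms by blast
  obtain W t where "openin X W" "x \<in> W" "W \<subseteq> U" "W \<subseteq> V" "t \<in> carrier (sec F W)"
         "\<forall>y\<in>W. \<sigma> y = coset_germ X F K y (W,t)" using quot_secE[OF s xU assms(2) x] .
  then show "\<exists>W s. openin X W \<and> x \<in> W \<and> W \<subseteq> V \<and> s \<in> carrier (sec F W) \<and>
          (\<forall>y\<in>W. restrict \<sigma> V y = coset_germ X F K y (W, s))" by (metis restrict_apply' subsetD)
qed

lemma quot_presheaf: "group_presheaf X (quot_sheaf X F K)"
proof (rule group_presheaf.intro)
  fix U assume U: "openin X U"
  have g: "\<And>x. x \<in> U \<Longrightarrow> group (quot_stalk X F K x)" using quot_stalk_group U openin_subset by blast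
  have e: "sec (quot_sheaf X F K) U = (product_group U (quot_stalk X F K))\<lparr>carrier := carrier (sec (quot_sheaf X
    F K) U)\<rparr>"
    by (simp add: quot_sheaf_def)
  show "group (sec (quot_sheaf X F K) U)"
    by (subst e) (rule subgroup.subgroup_is_group[OF quot_sec_subgroup[OF U] product_group[OF g]])
  fix s assume s: "s \<in> carrier (sec (quot_sheaf X F K) U)"
  show "res (quot_sheaf X F K) U U s = s" using s by (auto simp: quot_res quot_sec_iff PiE_iff extensional_restrict)
  fix V W assume "openin X V" "openin X W" "W \<subseteq> V" "V \<subseteq> U"
  then show "res (quot_sheaf X F K) V W (res (quot_sheaf X F K) U V s) = res (quot_sheaf X F K) U W s"
    by (simp add: quot_res inf.absorb2)
next
  fix U V assume UV: "openin X U" "openin X V" "V \<subseteq> U"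
  show "res (quot_sheaf X F K) U V \<in> hom (sec (quot_sheaf X F K) U) (sec (quot_sheaf X F K) V)"
    using UV by (auto simp: hom_def quot_res quot_res_closed quot_sec_mult fun_eq_iff subset_eq)
qed

lemma quot_proj_PiE: "\<lbrakk>openin X U; s \<in> carrier (sec F U)\<rbrakk> \<Longrightarrow> quot_proj X F K U s \<in> (\<Pi>\<^sub>E x\<in>U. carrier (quot_stalk
  X F K x))"
  by (auto simp: quot_proj_def coset_germ_closed)

lemma quot_proj_closed: "\<lbrakk>openin X U; s \<in> carrier (sec F U)\<rbrakk> \<Longrightarrow> quot_proj X F K U s \<in> carrier (sec (quot_sheaf X
  F K) U)"
  unfolding quot_sec_iff using quot_proj_PiE
  by (intro conjI ballI exI[of _ U] exI[of _ s]) (simp_all add: quot_proj_def)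

lemma quot_proj_mult: "\<lbrakk>openin X U; s \<in> carrier (sec F U); t \<in> carrier (sec F U)\<rbrakk> \<Longrightarrow>
   quot_proj X F K U (s \<otimes>\<^bsub>sec F U\<^esub> t) = quot_proj X F K U s \<otimes>\<^bsub>sec (quot_sheaf X F K) U\<^esub> quot_proj X F K U t"
  by (auto simp: quot_sec_mult quot_proj_def coset_germ_mult fun_eq_iff)

lemma quot_proj_one: "openin X U \<Longrightarrow> quot_proj X F K U \<one>\<^bsub>sec F U\<^esub> = \<one>\<^bsub>sec (quot_sheaf X F K) U\<^esub>"
  by (auto simp: quot_sec_one quot_proj_def coset_germ_one fun_eq_iff)

lemma quot_proj_res: "\<lbrakk>openin X U; openin X V; V \<subseteq> U; s \<in> carrier (sec F U)\<rbrakk> \<Longrightarrow>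
   restrict (quot_proj X F K U s) V = quot_proj X F K V (res F U V s)"
  by (auto simp: quot_proj_def coset_germ_res fun_eq_iff subset_eq)

text \<open>Local sections satisfying \<open>R\<close>, with equal germs wherever two of them meet, glue to a section of the
  quotient sheaf. The defect, the sections defining \<open>cech_to_god\<close> and the preimages in exact sequences
  are obtained in this way.\<close>

lemma quot_glue:
  assumes U: "openin X U"
    and cover: "\<And>x. x \<in> U \<Longrightarrow> \<exists>V s. openin X V \<and> x \<in> V \<and> V \<subseteq> U \<and> s \<in> carrier (sec F V) \<and> R V s"
    and compat: "\<And>V s V' s' x. \<lbrakk>openin X V; V \<subseteq> U; s \<in> carrier (sec F V); R V s; openin X V'; V' \<subseteq> U; s' \<in>
      carrier (sec F V'); R V' s'; x \<in> V; x \<in> V'\<rbrakk>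
      \<Longrightarrow> coset_germ X F K x (V,s) = coset_germ X F K x (V',s')"
  obtains \<sigma> where "\<sigma> \<in> carrier (sec (quot_sheaf X F K) U)"
    "\<And>V s. \<lbrakk>openin X V; V \<subseteq> U; s \<in> carrier (sec F V); R V s\<rbrakk> \<Longrightarrow> restrict \<sigma> V = quot_proj X F K V s"
proof -
  have "\<forall>x. \<exists>p. x \<in> U \<longrightarrow> openin X (fst p) \<and> x \<in> fst p \<and> fst p \<subseteq> U \<and> snd p \<in> carrier (sec F (fst p)) \<and> R (fst p)
    (snd p)"
    using cover by fastforce
  then obtain p where p: "\<And>x. x \<in> U \<Longrightarrow> openin X (fst (p x)) \<and> x \<in> fst (p x) \<and> fst (p x) \<subseteq> U \<and> snd (p x) \<in> carrier
    (sec F (fst (p x))) \<and> R (fst (p x)) (snd (p x))"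
    by metis
  \<comment> \<open>Choosing a local section around every point and keeping only its germ at that point
    gives a section, since by compatibility the choice does not matter.\<close>
  define \<sigma> where "\<sigma> = (\<lambda>x\<in>U. coset_germ X F K x (p x))"
  have val: "\<sigma> x = coset_germ X F K x (V,s)" if "openin X V" "V \<subseteq> U" "s \<in> carrier (sec F V)" "R V s" "x \<in> V" for x V s
    using p[of x] compat[of "fst (p x)" "snd (p x)" V s x] that unfolding \<sigma>_def by auto
  have 1: "\<sigma> \<in> carrier (sec (quot_sheaf X F K) U)"
    unfolding quot_sec_iff
  proof (intro conjI ballI)
    show "\<sigma> \<in> (\<Pi>\<^sub>E x\<in>U. carrier (quot_stalk X F K x))"
      unfolding \<sigma>_def using p coset_germ_closed by (metis (no_types, lifting) prod.collapse restrict_PiE_iff)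
    fix x assume x: "x \<in> U"
    show "\<exists>V s. openin X V \<and> x \<in> V \<and> V \<subseteq> U \<and> s \<in> carrier (sec F V) \<and> (\<forall>y\<in>V. \<sigma> y = coset_germ X F K y (V, s))"
      using p[OF x] val by (intro exI[of _ "fst (p x)"] exI[of _ "snd (p x)"]) blast
  qed
  have 2: "restrict \<sigma> V = quot_proj X F K V s" if "openin X V" "V \<subseteq> U" "s \<in> carrier (sec F V)" "R V s" for V s
    unfolding quot_proj_def using val that by (intro restrict_ext) blast
  show ?thesis using that[OF 1 2] .
qed

end

section \<open>Nonabelian Cech cohomology in degree 1\<close>

lemma (in group) cancel_left [simp]:
  assumes "a \<in> carrier G" "b \<in> carrier G"
  shows "a \<otimes> (inv a \<otimes> b) = b" "inv a \<otimes> (a \<otimes> b) = b"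
  using assms by (simp_all flip: m_assoc)

definition cochain_res :: "('x, 'a) sheaf \<Rightarrow> ('x \<Rightarrow> 'x set) \<Rightarrow> ('x \<Rightarrow> 'x set) \<Rightarrow> ('x \<Rightarrow> 'x \<Rightarrow> 'a) \<Rightarrow> 'x \<Rightarrow> 'x \<Rightarrow> 'a" where
  "cochain_res F U W c = (\<lambda>x y. res F (U x \<inter> U y) (W x \<inter> W y) (c x y))"

lemma point_cover_open: "point_cover X U \<Longrightarrow> x \<in> topspace X \<Longrightarrow> openin X (U x)"
  and point_cover_mem: "point_cover X U \<Longrightarrow> x \<in> topspace X \<Longrightarrow> x \<in> U x"
  by (auto simp: point_cover_def)

lemma point_cover_Int: "point_cover X U \<Longrightarrow> point_cover X V \<Longrightarrow> point_cover X (\<lambda>x. U x \<inter> V x)"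
  by (auto simp: point_cover_def)

lemma point_cover_open2:
  "\<lbrakk>point_cover X U; x \<in> topspace X; y \<in> topspace X\<rbrakk> \<Longrightarrow> openin X (U x \<inter> U y)"
  by (auto simp: point_cover_def)

lemma point_cover_open3:
  "\<lbrakk>point_cover X U; x \<in> topspace X; y \<in> topspace X; z \<in> topspace X\<rbrakk> \<Longrightarrow> openin X (U x \<inter> U y \<inter> U z)"
  by (auto simp: point_cover_def)

lemma cocyclesD:
  assumes "(U, c) \<in> cocycles X F"
  shows "point_cover X U"
    and "\<lbrakk>x \<in> topspace X; y \<in> topspace X\<rbrakk> \<Longrightarrow> c x y \<in> carrier (sec F (U x \<inter> U y))"
    and "\<lbrakk>x \<in> topspace X; y \<in> topspace X; z \<in> topspace X\<rbrakk> \<Longrightarrow>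
        res F (U x \<inter> U y) (U x \<inter> U y \<inter> U z) (c x y) \<otimes>\<^bsub>sec F (U x \<inter> U y \<inter> U z)\<^esub>
        res F (U y \<inter> U z) (U x \<inter> U y \<inter> U z) (c y z) =
        res F (U x \<inter> U z) (U x \<inter> U y \<inter> U z) (c x z)"
  using assms by (auto simp: cocycles_def Let_def)

lemma cocyclesI:
  assumes "point_cover X U"
    and "\<And>x y. \<lbrakk>x \<in> topspace X; y \<in> topspace X\<rbrakk> \<Longrightarrow> c x y \<in> carrier (sec F (U x \<inter> U y))"
    and "\<And>x y z. \<lbrakk>x \<in> topspace X; y \<in> topspace X; z \<in> topspace X\<rbrakk> \<Longrightarrow>
        res F (U x \<inter> U y) (U x \<inter> U y \<inter> U z) (c x y) \<otimes>\<^bsub>sec F (U x \<inter> U y \<inter> U z)\<^esub>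
        res F (U y \<inter> U z) (U x \<inter> U y \<inter> U z) (c y z) =
        res F (U x \<inter> U z) (U x \<inter> U y \<inter> U z) (c x z)"
  shows "(U, c) \<in> cocycles X F"
  using assms by (auto simp: cocycles_def Let_def)

context group_presheaf
begin

text \<open>The relation in \<open>cohomologous\<close>, for two cochains given on the same covering \<open>W\<close>.\<close>

definition cobound :: "('x \<Rightarrow> 'x set) \<Rightarrow> ('x \<Rightarrow> 'a) \<Rightarrow> ('x \<Rightarrow> 'x \<Rightarrow> 'a) \<Rightarrow> ('x \<Rightarrow> 'x \<Rightarrow> 'a) \<Rightarrow> bool" where
  "cobound W h c d \<longleftrightarrow> (\<forall>x \<in> topspace X. \<forall>y \<in> topspace X.
     d x y = inv\<^bsub>sec F (W x \<inter> W y)\<^esub> (res F (W x) (W x \<inter> W y) (h x)) \<otimes>\<^bsub>sec F (W x \<inter> W y)\<^esub>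
       c x y \<otimes>\<^bsub>sec F (W x \<inter> W y)\<^esub> res F (W y) (W x \<inter> W y) (h y))"

lemma cohomologous_iff:
  "((U,c),(V,d)) \<in> cohomologous X F \<longleftrightarrow> (U,c) \<in> cocycles X F \<and> (V,d) \<in> cocycles X F \<and>
    (\<exists>W h. point_cover X W \<and> (\<forall>x \<in> topspace X. W x \<subseteq> U x \<and> W x \<subseteq> V x \<and> h x \<in> carrier (sec F (W x))) \<and>
      cobound W h (cochain_res F U W c) (cochain_res F V W d))"
  unfolding cohomologous_def cobound_def cochain_res_def Let_def by auto

lemma cochain_res_closed:
  assumes "(U,c) \<in> cocycles X F" "point_cover X W" "\<And>x. x \<in> topspace X \<Longrightarrow> W x \<subseteq> U x"
    and "x \<in> topspace X" "y \<in> topspace X"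
  shows "cochain_res F U W c x y \<in> carrier (sec F (W x \<inter> W y))"
  unfolding cochain_res_def by (intro res_closed) (use assms cocyclesD[OF assms(1)] in \<open>auto simp: point_cover_def\<close>)

lemma cochain_res_cochain_res:
  assumes "(U,c) \<in> cocycles X F" "point_cover X W" "\<And>x. x \<in> topspace X \<Longrightarrow> W x \<subseteq> U x"
    "point_cover X W'" "\<And>x. x \<in> topspace X \<Longrightarrow> W' x \<subseteq> W x"
    and "x \<in> topspace X" "y \<in> topspace X"
  shows "cochain_res F W W' (cochain_res F U W c) x y = cochain_res F U W' c x y"
  unfolding cochain_res_def 
  by (rule res_res) (use assms cocyclesD(1,2)[OF assms(1)] in \<open>simp_all add: point_cover_open2 le_infI1 le_infI2\<close>)

lemma cochain_res_cocycle:
  assumes c: "(U,c) \<in> cocycles X F" and W: "point_cover X W" "\<And>x. x \<in> topspace X \<Longrightarrow> W x \<subseteq> U x"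
  shows "(W, cochain_res F U W c) \<in> cocycles X F"
proof (rule cocyclesI[OF W(1) cochain_res_closed[OF c W]])
  fix x y z assume t: "x \<in> topspace X" "y \<in> topspace X" "z \<in> topspace X"
  let ?T = "U x \<inter> U y \<inter> U z" and ?S = "W x \<inter> W y \<inter> W z"
  have o: "openin X ?T" "openin X ?S" "openin X (U x \<inter> U y)" "openin X (U y \<inter> U z)" "openin X (U x \<inter> U z)"
     "openin X (W x \<inter> W y)" "openin X (W y \<inter> W z)" "openin X (W x \<inter> W z)"
    using point_cover_open3[OF cocyclesD(1)[OF c] t] point_cover_open3[OF W(1) t]
      point_cover_open2[OF cocyclesD(1)[OF c]] point_cover_open2[OF W(1)] t by simp_all
  have i: "?S \<subseteq> ?T" "W x \<inter> W y \<subseteq> U x \<inter> U y" "W y \<inter> W z \<subseteq> U y \<inter> U z" "W x \<inter> W z \<subseteq> U x \<inter> U z"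
    using W(2)[OF t(1)] W(2)[OF t(2)] W(2)[OF t(3)] by auto
  have j: "?T \<subseteq> U x \<inter> U y" "?T \<subseteq> U y \<inter> U z" "?T \<subseteq> U x \<inter> U z" by auto
  note cc = cocyclesD(2)[OF c t(1,2)] cocyclesD(2)[OF c t(2,3)] cocyclesD(2)[OF c t(1,3)]
  have "res F ?T ?S (res F (U x \<inter> U y) ?T (c x y) \<otimes>\<^bsub>sec F ?T\<^esub> res F (U y \<inter> U z) ?T (c y z)) =
    res F ?T ?S (res F (U x \<inter> U z) ?T (c x z))" using cocyclesD(3)[OF c t] by simp
  also have "res F ?T ?S (res F (U x \<inter> U y) ?T (c x y) \<otimes>\<^bsub>sec F ?T\<^esub> res F (U y \<inter> U z) ?T (c y z))
    = res F (U x \<inter> U y) ?S (c x y) \<otimes>\<^bsub>sec F ?S\<^esub> res F (U y \<inter> U z) ?S (c y z)"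
    using o i j cc by (simp add: res_mult res_closed res_res)
  also have "res F ?T ?S (res F (U x \<inter> U z) ?T (c x z)) = res F (U x \<inter> U z) ?S (c x z)"
    using o i cc t by (intro res_res) auto
  finally show "res F (W x \<inter> W y) ?S (cochain_res F U W c x y) \<otimes>\<^bsub>sec F ?S\<^esub> res F (W y \<inter> W z) ?S (cochain_res F U
    W c y z)
      = res F (W x \<inter> W z) ?S (cochain_res F U W c x z)"
    unfolding cochain_res_def
    using res_res[OF o(3,6,2) _ i(2) cc(1)] res_res[OF o(4,7,2) _ i(3) cc(2)] res_res[OF o(5,8,2) _ i(4) cc(3)]
    by (simp add: le_infI1 le_infI2)
qed

lemma cobound_res:
  assumes W: "point_cover X W" "\<And>x. x \<in> topspace X \<Longrightarrow> h x \<in> carrier (sec F (W x))"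
    and W': "point_cover X W'" "\<And>x. x \<in> topspace X \<Longrightarrow> W' x \<subseteq> W x"
    and c: "\<And>x y. x \<in> topspace X \<Longrightarrow> y \<in> topspace X \<Longrightarrow> c x y \<in> carrier (sec F (W x \<inter> W y))"
    and b: "cobound W h c d"
  shows "cobound W' (\<lambda>x. res F (W x) (W' x) (h x)) (cochain_res F W W' c) (cochain_res F W W' d)"
  unfolding cobound_def
proof (intro ballI)
  fix x y assume t: "x \<in> topspace X" "y \<in> topspace X"
  have o: "openin X (W x)" "openin X (W y)" "openin X (W' x)" "openin X (W' y)" "openin X (W x \<inter> W y)" "openin X
    (W' x \<inter> W' y)"
    using W W' t by (auto simp: point_cover_def)
  have i: "W' x \<subseteq> W x" "W' y \<subseteq> W y" "W' x \<inter> W' y \<subseteq> W x \<inter> W y" using W' t by blast+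
  have e: "d x y = inv\<^bsub>sec F (W x \<inter> W y)\<^esub> (res F (W x) (W x \<inter> W y) (h x)) \<otimes>\<^bsub>sec F (W x \<inter> W y)\<^esub>
       c x y \<otimes>\<^bsub>sec F (W x \<inter> W y)\<^esub> res F (W y) (W x \<inter> W y) (h y)" using b t unfolding cobound_def by blast
  have hr: "res F (W x) (W x \<inter> W y) (h x) \<in> carrier (sec F (W x \<inter> W y))"
    "res F (W y) (W x \<inter> W y) (h y) \<in> carrier (sec F (W x \<inter> W y))"
    using W t o by (auto intro: res_closed)
  have "res F (W x) (W' x \<inter> W' y) (h x) = res F (W' x) (W' x \<inter> W' y) (res F (W x) (W' x) (h x))"
    "res F (W y) (W' x \<inter> W' y) (h y) = res F (W' y) (W' x \<inter> W' y) (res F (W y) (W' y) (h y))"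
    using W t o i by (auto simp: res_res)
  moreover have "res F (W x \<inter> W y) (W' x \<inter> W' y) (res F (W x) (W x \<inter> W y) (h x)) = res F (W x) (W' x \<inter> W' y) (h x)"
    "res F (W x \<inter> W y) (W' x \<inter> W' y) (res F (W y) (W x \<inter> W y) (h y)) = res F (W y) (W' x \<inter> W' y) (h y)"
    using W t o i by (auto simp: res_res)
  ultimately show "cochain_res F W W' d x y = inv\<^bsub>sec F (W' x \<inter> W' y)\<^esub> (res F (W' x) (W' x \<inter> W' y) (res F (W x)
    (W' x) (h x))) \<otimes>\<^bsub>sec F (W' x \<inter> W' y)\<^esub>
       cochain_res F W W' c x y \<otimes>\<^bsub>sec F (W' x \<inter> W' y)\<^esub> res F (W' y) (W' x \<inter> W' y) (res F (W y) (W' y) (h y))"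
    unfolding cochain_res_def e using o i hr c[OF t]
    by (simp add: res_mult mult_closed inv_closed res_inv)
qed

lemma cobound_cong:
  assumes "cobound W h c d" 
    "\<And>x y. x \<in> topspace X \<Longrightarrow> y \<in> topspace X \<Longrightarrow> c x y = c' x y" "\<And>x y. x \<in> topspace X \<Longrightarrow> y \<in> topspace X \<Longrightarrow> d x y = d' x y"
  shows "cobound W h c' d'"
  using assms unfolding cobound_def by simp

lemma cohomologous_onI:
  assumes c: "(U,c) \<in> cocycles X F" "(V,d) \<in> cocycles X F"
    and W: "point_cover X W" "\<And>x. x \<in> topspace X \<Longrightarrow> W x \<subseteq> U x" "\<And>x. x \<in> topspace X \<Longrightarrow> W x \<subseteq> V x"
      "\<And>x. x \<in> topspace X \<Longrightarrow> h x \<in> carrier (sec F (W x))"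
    and b: "cobound W h (cochain_res F U W c) (cochain_res F V W d)"
  shows "((U,c),(V,d)) \<in> cohomologous X F"
  unfolding cohomologous_iff using assms by blast

lemma cohomologous_sameI:
  assumes c: "(U,c) \<in> cocycles X F" "(V,d) \<in> cocycles X F"
    and W: "point_cover X W" "\<And>x. x \<in> topspace X \<Longrightarrow> W x \<subseteq> U x" "\<And>x. x \<in> topspace X \<Longrightarrow> W x \<subseteq> V x"
    and eq: "\<And>x y. x \<in> topspace X \<Longrightarrow> y \<in> topspace X \<Longrightarrow> cochain_res F U W c x y = cochain_res F V W d x y"
  shows "((U,c),(V,d)) \<in> cohomologous X F"
proof (rule cohomologous_onI[OF c W, of "\<lambda>x. \<one>\<^bsub>sec F (W x)\<^esub>"])
  show "\<And>x. x \<in> topspace X \<Longrightarrow> \<one>\<^bsub>sec F (W x)\<^esub> \<in> carrier (sec F (W x))"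
    using W by (simp add: point_cover_def one_closed)
  show "cobound W (\<lambda>x. \<one>\<^bsub>sec F (W x)\<^esub>) (cochain_res F U W c) (cochain_res F V W d)"
    unfolding cobound_def
  proof (intro ballI)
    fix x y assume t: "x \<in> topspace X" "y \<in> topspace X"
    have o: "openin X (W x)" "openin X (W y)" "openin X (W x \<inter> W y)" using W(1) t by (auto simp: point_cover_def)
    interpret G: group "sec F (W x \<inter> W y)" using sec_group o by blast
    show "cochain_res F V W d x y = inv\<^bsub>sec F (W x \<inter> W y)\<^esub> (res F (W x) (W x \<inter> W y) \<one>\<^bsub>sec F (W x)\<^esub>) \<otimes>\<^bsub>sec F (W x
      \<inter> W y)\<^esub>
       cochain_res F U W c x y \<otimes>\<^bsub>sec F (W x \<inter> W y)\<^esub> res F (W y) (W x \<inter> W y) \<one>\<^bsub>sec F (W y)\<^esub>"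
      using o cochain_res_closed[OF c(1) W(1,2) t] eq t by (simp add: res_one)
  qed
qed

text \<open>Cohomologous cochains stay related by a \<open>0\<close>-cochain on every sufficiently fine covering. This allows
  several such relations to be moved to a common covering.\<close>

lemma cohomologous_refine:
  assumes "((U,c),(V,d)) \<in> cohomologous X F"
  obtains W where "point_cover X W" "\<And>x. x \<in> topspace X \<Longrightarrow> W x \<subseteq> U x" "\<And>x. x \<in> topspace X \<Longrightarrow> W x \<subseteq> V x"
    "\<And>N. \<lbrakk>point_cover X N; \<And>x. x \<in> topspace X \<Longrightarrow> N x \<subseteq> W x\<rbrakk> \<Longrightarrow>
      \<exists>h. (\<forall>x \<in> topspace X. h x \<in> carrier (sec F (N x))) \<and> cobound N h (cochain_res F U N c) (cochain_res F V N d)"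
proof -
  obtain W h where W: "(U,c) \<in> cocycles X F" "(V,d) \<in> cocycles X F" "point_cover X W"
      "\<forall>x \<in> topspace X. W x \<subseteq> U x \<and> W x \<subseteq> V x \<and> h x \<in> carrier (sec F (W x))"
      "cobound W h (cochain_res F U W c) (cochain_res F V W d)"
    using assms unfolding cohomologous_iff by blast
  have "\<exists>h. (\<forall>x \<in> topspace X. h x \<in> carrier (sec F (N x))) \<and> cobound N h (cochain_res F U N c) (cochain_res F V N d)"
    if N: "point_cover X N" "\<And>x. x \<in> topspace X \<Longrightarrow> N x \<subseteq> W x" for N
  proof (intro exI conjI ballI)
    have b1: "cobound N (\<lambda>x. res F (W x) (N x) (h x)) (cochain_res F W N (cochain_res F U W c)) (cochain_res F W
      N (cochain_res F V W d))"
      by (rule cobound_res[OF W(3) _ N(1,2) cochain_res_closed[OF W(1,3)] W(5)]) (use W in auto)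
    show "cobound N (\<lambda>x. res F (W x) (N x) (h x)) (cochain_res F U N c) (cochain_res F V N d)"
      by (rule cobound_cong[OF b1]; rule cochain_res_cochain_res) (use W N in auto)
    show "\<And>x. x \<in> topspace X \<Longrightarrow> res F (W x) (N x) (h x) \<in> carrier (sec F (N x))"
      using W(3,4) N by (simp add: res_closed point_cover_open)
  qed
  then show ?thesis using W by (intro that[of W]) auto
qed

text \<open>Transitivity multiplies the two \<open>0\<close>-cochains after passing to a common refinement.\<close>

lemma cohomologous_equiv: "equiv (cocycles X F) (cohomologous X F)"
proof (rule equivI)
  show "cohomologous X F \<subseteq> cocycles X F \<times> cocycles X F" unfolding cohomologous_def by auto
  show "refl_on (cocycles X F) (cohomologous X F)"
  proof (rule refl_onI)
    fix p assume p: "p \<in> cocycles X F"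
    obtain U c where e: "p = (U,c)" by (cases p)
    show "(p,p) \<in> cohomologous X F" unfolding e
      using p e cocyclesD(1) by (intro cohomologous_sameI[where W=U]) auto
  qed
  show "sym (cohomologous X F)"
  proof (rule symI)
    fix p q assume pq: "(p,q) \<in> cohomologous X F"
    obtain U c V d where e: "p = (U,c)" "q = (V,d)" by (cases p, cases q)
    obtain W h where W: "(U,c) \<in> cocycles X F" "(V,d) \<in> cocycles X F" "point_cover X W"
      "\<forall>x \<in> topspace X. W x \<subseteq> U x \<and> W x \<subseteq> V x \<and> h x \<in> carrier (sec F (W x))"
      "cobound W h (cochain_res F U W c) (cochain_res F V W d)"
      using pq unfolding e cohomologous_iff by blast
    show "(q,p) \<in> cohomologous X F" unfolding e
    proof (rule cohomologous_onI[OF W(2,1,3), of "\<lambda>x. inv\<^bsub>sec F (W x)\<^esub> h x"])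
      show "\<And>x. x \<in> topspace X \<Longrightarrow> inv\<^bsub>sec F (W x)\<^esub> h x \<in> carrier (sec F (W x))"
        using W by (simp add: inv_closed point_cover_open)
      show "cobound W (\<lambda>x. inv\<^bsub>sec F (W x)\<^esub> h x) (cochain_res F V W d) (cochain_res F U W c)"
        unfolding cobound_def
      proof (intro ballI)
        fix x y assume t: "x \<in> topspace X" "y \<in> topspace X"
        have o: "openin X (W x)" "openin X (W y)" "openin X (W x \<inter> W y)" using W(3) t by (auto simp: point_cover_def)
        interpret G: group "sec F (W x \<inter> W y)" using sec_group o by blast
        have c: "cochain_res F U W c x y \<in> carrier (sec F (W x \<inter> W y))" using cochain_res_closed W t by blast
        have h: "res F (W x) (W x \<inter> W y) (h x) \<in> carrier (sec F (W x \<inter> W y))" "res F (W y) (W x \<inter> W y) (h y) \<in>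
          carrier (sec F (W x \<inter> W y))"
          using W o t by (auto intro: res_closed)
        have "cochain_res F V W d x y = inv\<^bsub>sec F (W x \<inter> W y)\<^esub> (res F (W x) (W x \<inter> W y) (h x)) \<otimes>\<^bsub>sec F (W x \<inter> W y)\<^esub>
            cochain_res F U W c x y \<otimes>\<^bsub>sec F (W x \<inter> W y)\<^esub> res F (W y) (W x \<inter> W y) (h y)"
          using W(5) t unfolding cobound_def by blast
        then show "cochain_res F U W c x y = inv\<^bsub>sec F (W x \<inter> W y)\<^esub> (res F (W x) (W x \<inter> W y) (inv\<^bsub>sec F (W x)\<^esub> h
          x)) \<otimes>\<^bsub>sec F (W x \<inter> W y)\<^esub>
            cochain_res F V W d x y \<otimes>\<^bsub>sec F (W x \<inter> W y)\<^esub> res F (W y) (W x \<inter> W y) (inv\<^bsub>sec F (W y)\<^esub> h y)"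
          using W(4) o t h c by (simp add: res_inv G.m_assoc G.inv_solve_left')
      qed
    qed (use W in auto)
  qed
  show "trans (cohomologous X F)"
  proof (rule transI)
    fix p q r assume pq: "(p,q) \<in> cohomologous X F" and qr: "(q,r) \<in> cohomologous X F"
    obtain U c V d T e' where e: "p = (U,c)" "q = (V,d)" "r = (T,e')" by (cases p, cases q, cases r)
    have cc: "(U,c) \<in> cocycles X F" "(T,e') \<in> cocycles X F"
      using pq qr unfolding e cohomologous_def by auto
    from cohomologous_refine[OF pq[unfolded e]] obtain W where W: "point_cover X W"
      "\<And>x. x \<in> topspace X \<Longrightarrow> W x \<subseteq> U x" "\<And>x. x \<in> topspace X \<Longrightarrow> W x \<subseteq> V x"
      "\<And>N. \<lbrakk>point_cover X N; \<And>x. x \<in> topspace X \<Longrightarrow> N x \<subseteq> W x\<rbrakk> \<Longrightarrow>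
        \<exists>h. (\<forall>x \<in> topspace X. h x \<in> carrier (sec F (N x))) \<and> cobound N h (cochain_res F U N c) (cochain_res F V
          N d)" by metis
    from cohomologous_refine[OF qr[unfolded e]] obtain W' where W': "point_cover X W'"
      "\<And>x. x \<in> topspace X \<Longrightarrow> W' x \<subseteq> V x" "\<And>x. x \<in> topspace X \<Longrightarrow> W' x \<subseteq> T x"
      "\<And>N. \<lbrakk>point_cover X N; \<And>x. x \<in> topspace X \<Longrightarrow> N x \<subseteq> W' x\<rbrakk> \<Longrightarrow>
        \<exists>h. (\<forall>x \<in> topspace X. h x \<in> carrier (sec F (N x))) \<and> cobound N h (cochain_res F V N d) (cochain_res F T
          N e')" by metis
    define N where "N = (\<lambda>x. W x \<inter> W' x)"
    have N: "point_cover X N" "\<And>x. N x \<subseteq> W x" "\<And>x. N x \<subseteq> W' x"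
      unfolding N_def using point_cover_Int W W' by auto
    have N2: "\<And>x. x \<in> topspace X \<Longrightarrow> N x \<subseteq> U x" "\<And>x. x \<in> topspace X \<Longrightarrow> N x \<subseteq> T x"
      using order_trans[OF N(2) W(2)] order_trans[OF N(3) W'(3)] by auto
    obtain h where b1: "\<forall>x \<in> topspace X. h x \<in> carrier (sec F (N x))" "cobound N h (cochain_res F U N c)
      (cochain_res F V N d)"
      using W(4)[OF N(1,2)] by blast
    obtain k where b2: "\<forall>x \<in> topspace X. k x \<in> carrier (sec F (N x))" "cobound N k (cochain_res F V N d)
      (cochain_res F T N e')"
      using W'(4)[OF N(1,3)] by blast
    show "(p,r) \<in> cohomologous X F" unfolding e
    proof (rule cohomologous_onI[OF cc N(1) N2, of "\<lambda>x. h x \<otimes>\<^bsub>sec F (N x)\<^esub> k x"])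
      show "\<And>x. x \<in> topspace X \<Longrightarrow> h x \<otimes>\<^bsub>sec F (N x)\<^esub> k x \<in> carrier (sec F (N x))"
        using b1(1) b2(1) N(1) by (simp add: mult_closed point_cover_open)
      show "cobound N (\<lambda>x. h x \<otimes>\<^bsub>sec F (N x)\<^esub> k x) (cochain_res F U N c) (cochain_res F T N e')"
        unfolding cobound_def
      proof (intro ballI)
        fix x y assume t: "x \<in> topspace X" "y \<in> topspace X"
        let ?N = "N x \<inter> N y"
        have o: "openin X (N x)" "openin X (N y)" "openin X ?N" "?N \<subseteq> N x" "?N \<subseteq> N y"
          using N(1) t by (auto simp: point_cover_def)
        interpret G: group "sec F ?N" using sec_group o by blast
        have c: "cochain_res F U N c x y \<in> carrier (sec F ?N)"
          by (rule cochain_res_closed[OF cc(1) N(1) N2(1) t])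
        have hk: "h x \<in> carrier (sec F (N x))" "k x \<in> carrier (sec F (N x))" "h y \<in> carrier (sec F (N y))" "k y
          \<in> carrier (sec F (N y))"
          using b1(1) b2(1) t by auto
        note r = res_closed[OF o(1,3,4) hk(1)] res_closed[OF o(1,3,4) hk(2)] res_closed[OF o(2,3,5) hk(3)]
          res_closed[OF o(2,3,5) hk(4)]
        note e1 = b1(2)[unfolded cobound_def, rule_format, OF t] and e2 = b2(2)[unfolded cobound_def,
          rule_format, OF t]
        show "cochain_res F T N e' x y = inv\<^bsub>sec F ?N\<^esub> (res F (N x) ?N (h x \<otimes>\<^bsub>sec F (N x)\<^esub> k x)) \<otimes>\<^bsub>sec F ?N\<^esub>
            cochain_res F U N c x y \<otimes>\<^bsub>sec F ?N\<^esub> res F (N y) ?N (h y \<otimes>\<^bsub>sec F (N y)\<^esub> k y)"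
          unfolding e2 e1 res_mult[OF o(1,3,4) hk(1,2)] res_mult[OF o(2,3,5) hk(3,4)]
          using c r by (simp add: G.m_assoc G.inv_mult_group)
      qed
    qed
  qed
qed

definition cech_class :: "('x, 'a) cochain \<Rightarrow> ('x, 'a) cochain set" where
  "cech_class p = cohomologous X F `` {p}"

lemma cech_class_eq_iff: "p \<in> cocycles X F \<Longrightarrow> q \<in> cocycles X F \<Longrightarrow> cech_class p = cech_class q \<longleftrightarrow> (p,q) \<in>
  cohomologous X F"
  unfolding cech_class_def using eq_equiv_class_iff[OF cohomologous_equiv] by blast

lemma cech_class_mem: "p \<in> cocycles X F \<Longrightarrow> p \<in> cech_class p"
  unfolding cech_class_def using equiv_class_self[OF cohomologous_equiv] by blast

lemma cech_classD:
  assumes "q \<in> cech_class p" shows "q \<in> cocycles X F" "p \<in> cocycles X F" "cech_class q = cech_class p"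
proof -
  have "(p,q) \<in> cohomologous X F" using assms unfolding cech_class_def by blast
  then show "q \<in> cocycles X F" "p \<in> cocycles X F" unfolding cohomologous_def by auto
  then show "cech_class q = cech_class p" using cech_class_eq_iff \<open>(p,q) \<in> _\<close> by blast
qed

lemma cech_carrier: "carrier (cech_H1 X F) = cech_class ` cocycles X F"
  unfolding cech_H1_def quotient_def cech_class_def by auto

text \<open>Together with common refinements this allows any finite number of classes to be represented on one
  covering, where cocycles can be compared and multiplied entry by entry.\<close>

lemma cech_class_res:
  assumes c: "(U,c) \<in> cocycles X F" and W: "point_cover X W" "\<And>x. x \<in> topspace X \<Longrightarrow> W x \<subseteq> U x"
  shows "cech_class (W, cochain_res F U W c) = cech_class (U,c)"
proof -
  have "((W, cochain_res F U W c), (U,c)) \<in> cohomologous X F"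
    by (rule cohomologous_sameI[OF cochain_res_cocycle[OF c W] c W(1) order_refl W(2)])
      (use cochain_res_cochain_res[OF c W W(1)] in auto)
  then show ?thesis using cech_class_eq_iff cochain_res_cocycle[OF c W] c by blast
qed

lemma cech_one: 
  assumes W: "point_cover X W"
  shows "(W, \<lambda>x y. \<one>\<^bsub>sec F (W x \<inter> W y)\<^esub>) \<in> cocycles X F" "\<one>\<^bsub>cech_H1 X F\<^esub> = cech_class (W, \<lambda>x y. \<one>\<^bsub>sec F (W x \<inter> W y)\<^esub>)"
proof -
  have c: "(W, \<lambda>x y. \<one>\<^bsub>sec F (W x \<inter> W y)\<^esub>) \<in> cocycles X F" if W: "point_cover X W" for W
  proof (rule cocyclesI[OF W])
    fix x y z assume t: "x \<in> topspace X" "y \<in> topspace X" "z \<in> topspace X"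
    have o: "openin X (W x \<inter> W y \<inter> W z)" using point_cover_open3[OF W] t .
    interpret G: group "sec F (W x \<inter> W y \<inter> W z)" using sec_group o by blast
    show "res F (W x \<inter> W y) (W x \<inter> W y \<inter> W z) \<one>\<^bsub>sec F (W x \<inter> W y)\<^esub> \<otimes>\<^bsub>sec F (W x \<inter> W y \<inter> W z)\<^esub>
       res F (W y \<inter> W z) (W x \<inter> W y \<inter> W z) \<one>\<^bsub>sec F (W y \<inter> W z)\<^esub> = res F (W x \<inter> W z) (W x \<inter> W y \<inter> W z) \<one>\<^bsub>sec F (W
         x \<inter> W z)\<^esub>"
      using o point_cover_open2[OF W] t by (subst (1 2 3) res_one) auto
  qed (use W in \<open>simp add: point_cover_open2 one_closed\<close>)
  show "(W, \<lambda>x y. \<one>\<^bsub>sec F (W x \<inter> W y)\<^esub>) \<in> cocycles X F" using c W .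
  have T: "point_cover X (\<lambda>x. topspace X)" by (simp add: point_cover_def)
  have "cech_class (W, \<lambda>x y. \<one>\<^bsub>sec F (W x \<inter> W y)\<^esub>) = cech_class (\<lambda>x. topspace X, \<lambda>x y. \<one>\<^bsub>sec F (topspace X \<inter>
    topspace X)\<^esub>)"
    using c[OF W] c[OF T]
    by (subst cech_class_eq_iff, simp, simp, intro cohomologous_sameI[where W=W])
      (use W in \<open>auto simp: cochain_res_def res_one point_cover_open2 point_cover_open openin_subset\<close>)
  then show "\<one>\<^bsub>cech_H1 X F\<^esub> = cech_class (W, \<lambda>x y. \<one>\<^bsub>sec F (W x \<inter> W y)\<^esub>)"
    by (simp add: cech_H1_def cech_class_def)
qed

definition cochain_mult :: "('x \<Rightarrow> 'x set) \<Rightarrow> ('x \<Rightarrow> 'x \<Rightarrow> 'a) \<Rightarrow> ('x \<Rightarrow> 'x \<Rightarrow> 'a) \<Rightarrow> 'x \<Rightarrow> 'x \<Rightarrow> 'a" where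
  "cochain_mult W c d = (\<lambda>x y. c x y \<otimes>\<^bsub>sec F (W x \<inter> W y)\<^esub> d x y)"

lemma cech_class_cong:
  assumes c: "(W,c) \<in> cocycles X F" and eq: "\<And>x y. \<lbrakk>x \<in> topspace X; y \<in> topspace X\<rbrakk> \<Longrightarrow> c x y = d x y"
  shows "(W,d) \<in> cocycles X F" "cech_class (W,c) = cech_class (W,d)"
proof -
  show d: "(W,d) \<in> cocycles X F" using c eq unfolding cocycles_def by (auto simp: Let_def)
  have "((W,c),(W,d)) \<in> cohomologous X F"
    by (rule cohomologous_sameI[OF c d cocyclesD(1)[OF c]]) (auto simp: cochain_res_def eq)
  then show "cech_class (W,c) = cech_class (W,d)" using cech_class_eq_iff c d by blast
qed

lemma cech_cases:
  assumes "A \<in> carrier (cech_H1 X F)"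
  obtains U c where "(U,c) \<in> cocycles X F" "A = cech_class (U,c)"
  using assms unfolding cech_carrier by auto

lemma cech_class_closed: "(U,c) \<in> cocycles X F \<Longrightarrow> cech_class (U,c) \<in> carrier (cech_H1 X F)"
  unfolding cech_carrier by auto

lemma cech_cases2:
  assumes "A \<in> carrier (cech_H1 X F)" "B \<in> carrier (cech_H1 X F)"
  obtains W c d where "(W,c) \<in> cocycles X F" "(W,d) \<in> cocycles X F" "A = cech_class (W,c)" "B = cech_class (W,d)"
proof -
  obtain U c where c: "(U,c) \<in> cocycles X F" "A = cech_class (U,c)" using assms(1) cech_cases by blast
  obtain V d where d: "(V,d) \<in> cocycles X F" "B = cech_class (V,d)" using assms(2) cech_cases by blast
  let ?W = "\<lambda>x. U x \<inter> V x"
  have W: "point_cover X ?W" using point_cover_Int cocyclesD(1) c d by blast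
  show ?thesis
    by (rule that[OF cochain_res_cocycle[OF c(1) W] cochain_res_cocycle[OF d(1) W]]) (simp_all add: c d
      cech_class_res W)
qed

lemma cech_cases3:
  assumes "A \<in> carrier (cech_H1 X F)" "B \<in> carrier (cech_H1 X F)" "C \<in> carrier (cech_H1 X F)"
  obtains W c d e where "(W,c) \<in> cocycles X F" "(W,d) \<in> cocycles X F" "(W,e) \<in> cocycles X F"
    "A = cech_class (W,c)" "B = cech_class (W,d)" "C = cech_class (W,e)"
proof -
  obtain U c d where c: "(U,c) \<in> cocycles X F" "(U,d) \<in> cocycles X F" "A = cech_class (U,c)" "B = cech_class (U,d)"
    using assms(1,2) cech_cases2 by blast
  obtain V e where e: "(V,e) \<in> cocycles X F" "C = cech_class (V,e)" using assms(3) cech_cases by blast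
  let ?W = "\<lambda>x. U x \<inter> V x"
  have W: "point_cover X ?W" using point_cover_Int cocyclesD(1) c e by blast
  show ?thesis
    by (rule that[OF cochain_res_cocycle[OF c(1) W] cochain_res_cocycle[OF c(2) W] cochain_res_cocycle[OF e(1)
      W]]) (simp_all add: c e cech_class_res W)
qed

end

section \<open>The Cech group of a sheaf of abelian groups\<close>

locale abelian_presheaf = group_presheaf +
  assumes sec_comm: "openin X U \<Longrightarrow> comm_group (sec F U)"
begin

lemma mult_comm: "\<lbrakk>openin X U; s \<in> carrier (sec F U); t \<in> carrier (sec F U)\<rbrakk> \<Longrightarrow> s \<otimes>\<^bsub>sec F U\<^esub> t = t \<otimes>\<^bsub>sec F U\<^esub> s"
  using comm_group.axioms(1) comm_monoid.m_comm sec_comm by metis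

lemma cochain_mult_closed:
  assumes "(W,c) \<in> cocycles X F" "(W,d) \<in> cocycles X F" "x \<in> topspace X" "y \<in> topspace X"
  shows "cochain_mult W c d x y \<in> carrier (sec F (W x \<inter> W y))"
  unfolding cochain_mult_def using assms cocyclesD(1,2)[OF assms(1)] cocyclesD(2)[OF assms(2)]
  by (simp add: mult_closed point_cover_open2)

lemma cochain_mult_cocycle:
  assumes c: "(W,c) \<in> cocycles X F" and d: "(W,d) \<in> cocycles X F"
  shows "(W, cochain_mult W c d) \<in> cocycles X F"
proof (rule cocyclesI[OF cocyclesD(1)[OF c] cochain_mult_closed[OF c d]])
  fix x y z assume t: "x \<in> topspace X" "y \<in> topspace X" "z \<in> topspace X"
  note W = cocyclesD(1)[OF c]
  let ?T = "W x \<inter> W y \<inter> W z"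
  have o: "openin X ?T" "openin X (W x \<inter> W y)" "openin X (W y \<inter> W z)" "openin X (W x \<inter> W z)"
    using point_cover_open3[OF W t] point_cover_open2[OF W] t by simp_all
  have j: "?T \<subseteq> W x \<inter> W y" "?T \<subseteq> W y \<inter> W z" "?T \<subseteq> W x \<inter> W z" by auto
  interpret G: comm_group "sec F ?T" using sec_comm o by blast
  note cc = cocyclesD(2)[OF c t(1,2)] cocyclesD(2)[OF c t(2,3)] cocyclesD(2)[OF c t(1,3)]
    cocyclesD(2)[OF d t(1,2)] cocyclesD(2)[OF d t(2,3)] cocyclesD(2)[OF d t(1,3)]
  note r = cc(1,4)[THEN res_closed[OF o(2,1) j(1)]] cc(2,5)[THEN res_closed[OF o(3,1) j(2)]] cc(3,6)[THEN
    res_closed[OF o(4,1) j(3)]]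
  show "res F (W x \<inter> W y) ?T (cochain_mult W c d x y) \<otimes>\<^bsub>sec F ?T\<^esub> res F (W y \<inter> W z) ?T (cochain_mult W c d y z)
     = res F (W x \<inter> W z) ?T (cochain_mult W c d x z)"
    unfolding cochain_mult_def res_mult[OF o(2,1) j(1) cc(1,4)] res_mult[OF o(3,1) j(2) cc(2,5)] res_mult[OF
      o(4,1) j(3) cc(3,6)]
      cocyclesD(3)[OF c t, symmetric] cocyclesD(3)[OF d t, symmetric]
    using r by (simp add: G.m_ac)
qed

lemma cochain_res_cochain_mult:
  assumes c: "(U,c) \<in> cocycles X F" and d: "(U,d) \<in> cocycles X F"
    and W: "point_cover X W" "\<And>x. x \<in> topspace X \<Longrightarrow> W x \<subseteq> U x" and t: "x \<in> topspace X" "y \<in> topspace X"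
  shows "cochain_res F U W (cochain_mult U c d) x y = cochain_mult W (cochain_res F U W c) (cochain_res F U W d) x y"
  unfolding cochain_res_def cochain_mult_def
  by (rule res_mult) (use t W cocyclesD(1,2)[OF c] cocyclesD(2)[OF d] in \<open>simp_all add: point_cover_open2
    le_infI1 le_infI2\<close>)

lemma cobound_cochain_mult:
  assumes W: "point_cover X W" "\<And>x. x \<in> topspace X \<Longrightarrow> h x \<in> carrier (sec F (W x))" "\<And>x. x \<in> topspace X \<Longrightarrow> k x \<in>
    carrier (sec F (W x))"
    and c: "\<And>x y. \<lbrakk>x \<in> topspace X; y \<in> topspace X\<rbrakk> \<Longrightarrow> c x y \<in> carrier (sec F (W x \<inter> W y))"
           "\<And>x y. \<lbrakk>x \<in> topspace X; y \<in> topspace X\<rbrakk> \<Longrightarrow> d x y \<in> carrier (sec F (W x \<inter> W y))"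
    and b: "cobound W h c c'" "cobound W k d d'"
  shows "cobound W (\<lambda>x. h x \<otimes>\<^bsub>sec F (W x)\<^esub> k x) (cochain_mult W c d) (cochain_mult W c' d')"
  unfolding cobound_def
proof (intro ballI)
  fix x y assume t: "x \<in> topspace X" "y \<in> topspace X"
  let ?N = "W x \<inter> W y"
  have o: "openin X (W x)" "openin X (W y)" "openin X ?N" using W t by (auto simp: point_cover_def)
  have j: "?N \<subseteq> W x" "?N \<subseteq> W y" by auto
  interpret G: comm_group "sec F ?N" using sec_comm o by blast
  note r = W(2,3)[OF t(1), THEN res_closed[OF o(1,3) j(1)]] W(2,3)[OF t(2), THEN res_closed[OF o(2,3) j(2)]] c[OF t]
  have e: "c' x y = inv\<^bsub>sec F ?N\<^esub> (res F (W x) ?N (h x)) \<otimes>\<^bsub>sec F ?N\<^esub> c x y \<otimes>\<^bsub>sec F ?N\<^esub> res F (W y) ?N (h y)"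
    "d' x y = inv\<^bsub>sec F ?N\<^esub> (res F (W x) ?N (k x)) \<otimes>\<^bsub>sec F ?N\<^esub> d x y \<otimes>\<^bsub>sec F ?N\<^esub> res F (W y) ?N (k y)"
    using b t unfolding cobound_def by blast+
  show "cochain_mult W c' d' x y = inv\<^bsub>sec F ?N\<^esub> (res F (W x) ?N (h x \<otimes>\<^bsub>sec F (W x)\<^esub> k x)) \<otimes>\<^bsub>sec F ?N\<^esub>
    cochain_mult W c d x y \<otimes>\<^bsub>sec F ?N\<^esub>
     res F (W y) ?N (h y \<otimes>\<^bsub>sec F (W y)\<^esub> k y)"
    unfolding cochain_mult_def e res_mult[OF o(1,3) j(1) W(2,3)[OF t(1)]] res_mult[OF o(2,3) j(2) W(2,3)[OF t(2)]]
    using r by (simp add: G.m_ac G.inv_mult_group)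
qed

text \<open>The product on representatives used in \<open>cech_H1\<close>, with the two coverings intersected.\<close>

definition meet_mult :: "('a, 'b) cochain \<Rightarrow> ('a, 'b) cochain \<Rightarrow> ('a, 'b) cochain" where
  "meet_mult = (\<lambda>(U,c) (V,d). (\<lambda>x. U x \<inter> V x, cochain_mult (\<lambda>x. U x \<inter> V x) (cochain_res F U (\<lambda>x. U x \<inter> V x) c)
    (cochain_res F V (\<lambda>x. U x \<inter> V x) d)))"

lemma meet_mult_cocycle:
  assumes "(U,c) \<in> cocycles X F" "(V,d) \<in> cocycles X F" shows "meet_mult (U,c) (V,d) \<in> cocycles X F"
proof -
  have W: "point_cover X (\<lambda>x. U x \<inter> V x)" using point_cover_Int cocyclesD(1) assms by blast
  show ?thesis unfolding meet_mult_def split by (intro cochain_mult_cocycle cochain_res_cocycle assms W) auto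
qed

lemma cochain_res_meet_mult:
  assumes c: "(U,c) \<in> cocycles X F" and d: "(V,d) \<in> cocycles X F" and N: "point_cover X N"
     "\<And>x. x \<in> topspace X \<Longrightarrow> N x \<subseteq> U x" "\<And>x. x \<in> topspace X \<Longrightarrow> N x \<subseteq> V x"
    and t: "x \<in> topspace X" "y \<in> topspace X"
  shows "cochain_res F (\<lambda>x. U x \<inter> V x) N (snd (meet_mult (U,c) (V,d))) x y = cochain_mult N (cochain_res F U N
    c) (cochain_res F V N d) x y"
proof -
  let ?W = "\<lambda>x. U x \<inter> V x"
  have W: "point_cover X ?W" using point_cover_Int cocyclesD(1) assms by blast
  have NW: "\<And>x. x \<in> topspace X \<Longrightarrow> N x \<subseteq> U x \<inter> V x" using N by auto
  have "cochain_res F ?W N (cochain_mult ?W (cochain_res F U ?W c) (cochain_res F V ?W d)) x y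
    = cochain_mult N (cochain_res F ?W N (cochain_res F U ?W c)) (cochain_res F ?W N (cochain_res F V ?W d)) x y"
    by (rule cochain_res_cochain_mult[OF cochain_res_cocycle[OF c W] cochain_res_cocycle[OF d W] N(1) NW t]) auto
  also have "\<dots> = cochain_mult N (cochain_res F U N c) (cochain_res F V N d) x y"
    unfolding cochain_mult_def using cochain_res_cochain_res[OF c W _ N(1) NW t] cochain_res_cochain_res[OF d W
      _ N(1) NW t] by simp
  finally show ?thesis unfolding meet_mult_def by simp
qed

lemma meet_mult_cohomologous:
  assumes 1: "((U,c),(U',c')) \<in> cohomologous X F" and 2: "((V,d),(V',d')) \<in> cohomologous X F"
  shows "(meet_mult (U,c) (V,d), meet_mult (U',c') (V',d')) \<in> cohomologous X F"
proof -
  have cc: "(U,c) \<in> cocycles X F" "(U',c') \<in> cocycles X F" "(V,d) \<in> cocycles X F" "(V',d') \<in> cocycles X F"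
    using assms unfolding cohomologous_def by auto
  from cohomologous_refine[OF 1] obtain W where W: "point_cover X W" "\<And>x. x \<in> topspace X \<Longrightarrow> W x \<subseteq> U x" "\<And>x. x \<in>
    topspace X \<Longrightarrow> W x \<subseteq> U' x"
    "\<And>N. \<lbrakk>point_cover X N; \<And>x. x \<in> topspace X \<Longrightarrow> N x \<subseteq> W x\<rbrakk> \<Longrightarrow>
      \<exists>h. (\<forall>x \<in> topspace X. h x \<in> carrier (sec F (N x))) \<and> cobound N h (cochain_res F U N c) (cochain_res F U' N
        c')" by metis
  from cohomologous_refine[OF 2] obtain Y where Y: "point_cover X Y" "\<And>x. x \<in> topspace X \<Longrightarrow> Y x \<subseteq> V x" "\<And>x. x \<in>
    topspace X \<Longrightarrow> Y x \<subseteq> V' x"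
    "\<And>N. \<lbrakk>point_cover X N; \<And>x. x \<in> topspace X \<Longrightarrow> N x \<subseteq> Y x\<rbrakk> \<Longrightarrow>
      \<exists>h. (\<forall>x \<in> topspace X. h x \<in> carrier (sec F (N x))) \<and> cobound N h (cochain_res F V N d) (cochain_res F V' N
        d')" by metis
  define N where "N = (\<lambda>x. W x \<inter> Y x)"
  have N: "point_cover X N" "\<And>x. N x \<subseteq> W x" "\<And>x. N x \<subseteq> Y x" unfolding N_def using point_cover_Int W Y by auto
  have N2: "\<And>x. x \<in> topspace X \<Longrightarrow> N x \<subseteq> U x" "\<And>x. x \<in> topspace X \<Longrightarrow> N x \<subseteq> U' x"
     "\<And>x. x \<in> topspace X \<Longrightarrow> N x \<subseteq> V x" "\<And>x. x \<in> topspace X \<Longrightarrow> N x \<subseteq> V' x"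
    using N W(2,3) Y(2,3) by blast+
  obtain h where h: "\<forall>x \<in> topspace X. h x \<in> carrier (sec F (N x))" "cobound N h (cochain_res F U N c)
    (cochain_res F U' N c')"
    using W(4)[OF N(1,2)] by blast
  obtain k where k: "\<forall>x \<in> topspace X. k x \<in> carrier (sec F (N x))" "cobound N k (cochain_res F V N d)
    (cochain_res F V' N d')"
    using Y(4)[OF N(1,3)] by blast
  have b: "cobound N (\<lambda>x. h x \<otimes>\<^bsub>sec F (N x)\<^esub> k x) (cochain_mult N (cochain_res F U N c) (cochain_res F V N d))
    (cochain_mult N (cochain_res F U' N c') (cochain_res F V' N d'))"
    by (rule cobound_cochain_mult[OF N(1) _ _ _ _ h(2) k(2)])
      (use h k in \<open>simp_all add: cochain_res_closed[OF cc(1) N(1) N2(1)] cochain_res_closed[OF cc(3) N(1) N2(3)]\<close>)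
  have b': "cobound N (\<lambda>x. h x \<otimes>\<^bsub>sec F (N x)\<^esub> k x) (cochain_res F (\<lambda>x. U x \<inter> V x) N (snd (meet_mult (U,c)
    (V,d)))) (cochain_res F (\<lambda>x. U' x \<inter> V' x) N (snd (meet_mult (U',c') (V',d'))))"
    by (rule cobound_cong[OF b]) (simp_all add: cochain_res_meet_mult[OF cc(1,3) N(1) N2(1,3)]
      cochain_res_meet_mult[OF cc(2,4) N(1) N2(2,4)])
  have s: "meet_mult (U,c) (V,d) = (\<lambda>x. U x \<inter> V x, snd (meet_mult (U,c) (V,d)))" "meet_mult (U',c') (V',d') =
    (\<lambda>x. U' x \<inter> V' x, snd (meet_mult (U',c') (V',d')))"
    unfolding meet_mult_def by auto
  have cy: "(\<lambda>x. U x \<inter> V x, snd (meet_mult (U,c) (V,d))) \<in> cocycles X F" "(\<lambda>x. U' x \<inter> V' x, snd (meet_mult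
    (U',c') (V',d'))) \<in> cocycles X F"
    using meet_mult_cocycle[OF cc(1,3)] meet_mult_cocycle[OF cc(2,4)] s by auto
  show ?thesis
    by (subst s(1), subst s(2), rule cohomologous_onI[OF cy N(1) _ _ _ b'])
      (use N2 h k N in \<open>simp_all add: mult_closed point_cover_open\<close>)
qed

lemma cech_mult_meet_mult:
  assumes c: "(U,c) \<in> cocycles X F" and d: "(V,d) \<in> cocycles X F"
  shows "cech_class (U,c) \<otimes>\<^bsub>cech_H1 X F\<^esub> cech_class (V,d) = cech_class (meet_mult (U,c) (V,d))"
proof -
  have "cech_class (U,c) \<otimes>\<^bsub>cech_H1 X F\<^esub> cech_class (V,d) = (\<Union>p \<in> cech_class (U,c). \<Union>q \<in> cech_class (V,d).
    cech_class (meet_mult p q))"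
    unfolding cech_H1_def by (simp add: cech_class_def meet_mult_def cochain_mult_def cochain_res_def Let_def
      split_def)
  also have "\<dots> = cech_class (meet_mult (U,c) (V,d))"
  proof -
    have "cech_class (meet_mult p q) = cech_class (meet_mult (U,c) (V,d))" if p: "p \<in> cech_class (U,c)" and q:
      "q \<in> cech_class (V,d)" for p q
    proof -
      obtain U' c' V' d' where e: "p = (U',c')" "q = (V',d')" by (cases p, cases q)
      have "((U,c),(U',c')) \<in> cohomologous X F" "((V,d),(V',d')) \<in> cohomologous X F"
        using p q unfolding e cech_class_def by auto
      from meet_mult_cohomologous[OF this] show ?thesis unfolding e
        using equiv_class_eq[OF cohomologous_equiv] unfolding cech_class_def by blast
    qed
    then show ?thesis using cech_class_mem c d by blast
  qed
  finally show ?thesis .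
qed

text \<open>On a common covering the product is formed entry by entry, so the group laws of the Cech group reduce
  to those of the section groups.\<close>

lemma cech_mult:
  assumes c: "(W,c) \<in> cocycles X F" and d: "(W,d) \<in> cocycles X F"
  shows "cech_class (W,c) \<otimes>\<^bsub>cech_H1 X F\<^esub> cech_class (W,d) = cech_class (W, cochain_mult W c d)"
proof -
  have W: "point_cover X W" using c cocyclesD(1) by blast
  have s: "meet_mult (W,c) (W,d) = (W, snd (meet_mult (W,c) (W,d)))" unfolding meet_mult_def by auto
  have 1: "(W, snd (meet_mult (W,c) (W,d))) \<in> cocycles X F" using meet_mult_cocycle[OF c d] s by simp
  have "cech_class (W, snd (meet_mult (W,c) (W,d))) = cech_class (W, cochain_mult W c d)"
  proof (rule cech_class_cong(2)[OF 1])
    fix x y assume t: "x \<in> topspace X" "y \<in> topspace X"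
    show "snd (meet_mult (W,c) (W,d)) x y = cochain_mult W c d x y"
      using cocyclesD(2)[OF c t] cocyclesD(2)[OF d t] t W
      by (simp add: meet_mult_def cochain_mult_def cochain_res_def res_id point_cover_open2)
  qed
  then show ?thesis using cech_mult_meet_mult[OF c d] s by simp
qed

definition cochain_inv :: "('a \<Rightarrow> 'a set) \<Rightarrow> ('a \<Rightarrow> 'a \<Rightarrow> 'b) \<Rightarrow> 'a \<Rightarrow> 'a \<Rightarrow> 'b" where
  "cochain_inv W c = (\<lambda>x y. inv\<^bsub>sec F (W x \<inter> W y)\<^esub> c x y)"

lemma cochain_inv_cocycle:
  assumes c: "(W,c) \<in> cocycles X F"
  shows "(W, cochain_inv W c) \<in> cocycles X F"
proof (rule cocyclesI[OF cocyclesD(1)[OF c]])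
  note W = cocyclesD(1)[OF c]
  show "\<And>x y. x \<in> topspace X \<Longrightarrow> y \<in> topspace X \<Longrightarrow> cochain_inv W c x y \<in> carrier (sec F (W x \<inter> W y))"
    unfolding cochain_inv_def using cocyclesD(2)[OF c] W by (simp add: inv_closed point_cover_open2)
  fix x y z assume t: "x \<in> topspace X" "y \<in> topspace X" "z \<in> topspace X"
  let ?T = "W x \<inter> W y \<inter> W z"
  have o: "openin X ?T" "openin X (W x \<inter> W y)" "openin X (W y \<inter> W z)" "openin X (W x \<inter> W z)"
    using point_cover_open3[OF W t] point_cover_open2[OF W] t by simp_all
  have j: "?T \<subseteq> W x \<inter> W y" "?T \<subseteq> W y \<inter> W z" "?T \<subseteq> W x \<inter> W z" by auto
  interpret G: comm_group "sec F ?T" using sec_comm o by blast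
  note cc = cocyclesD(2)[OF c t(1,2)] cocyclesD(2)[OF c t(2,3)] cocyclesD(2)[OF c t(1,3)]
  note r = cc(1)[THEN res_closed[OF o(2,1) j(1)]] cc(2)[THEN res_closed[OF o(3,1) j(2)]] cc(3)[THEN
    res_closed[OF o(4,1) j(3)]]
  show "res F (W x \<inter> W y) ?T (cochain_inv W c x y) \<otimes>\<^bsub>sec F ?T\<^esub> res F (W y \<inter> W z) ?T (cochain_inv W c y z)
     = res F (W x \<inter> W z) ?T (cochain_inv W c x z)"
    unfolding cochain_inv_def res_inv[OF o(2,1) j(1) cc(1)] res_inv[OF o(3,1) j(2) cc(2)] res_inv[OF o(4,1) j(3)
      cc(3)]
      cocyclesD(3)[OF c t, symmetric]
    using r by (simp add: G.inv_mult)
qed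

lemma cech_comm_group: "comm_group (cech_H1 X F)"
proof (rule comm_groupI)
  fix A B assume AB: "A \<in> carrier (cech_H1 X F)" "B \<in> carrier (cech_H1 X F)"
  obtain W c d where c: "(W,c) \<in> cocycles X F" "(W,d) \<in> cocycles X F" "A = cech_class (W,c)" "B = cech_class (W,d)"
    using cech_cases2[OF AB] by blast
  note W = cocyclesD(1)[OF c(1)]
  show "A \<otimes>\<^bsub>cech_H1 X F\<^esub> B \<in> carrier (cech_H1 X F)" using c by (simp add: cech_mult cech_class_closed
    cochain_mult_cocycle)
  show "A \<otimes>\<^bsub>cech_H1 X F\<^esub> B = B \<otimes>\<^bsub>cech_H1 X F\<^esub> A" unfolding c(3,4) cech_mult[OF c(1,2)] cech_mult[OF c(2,1)]
    by (rule cech_class_cong(2)[OF cochain_mult_cocycle[OF c(1,2)]])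
      (use W cocyclesD(2)[OF c(1)] cocyclesD(2)[OF c(2)] in \<open>simp add: cochain_mult_def mult_comm point_cover_open2\<close>)
next
  fix A B C assume ABC: "A \<in> carrier (cech_H1 X F)" "B \<in> carrier (cech_H1 X F)" "C \<in> carrier (cech_H1 X F)"
  obtain W c d e where c: "(W,c) \<in> cocycles X F" "(W,d) \<in> cocycles X F" "(W,e) \<in> cocycles X F"
    and e: "A = cech_class (W,c)" "B = cech_class (W,d)" "C = cech_class (W,e)"
    using cech_cases3[OF ABC] by blast
  note W = cocyclesD(1)[OF c(1)]
  note m = cochain_mult_cocycle[OF c(1,2)] cochain_mult_cocycle[OF c(2,3)]
  have "cochain_mult W (cochain_mult W c d) e x y = cochain_mult W c (cochain_mult W d e) x y" if t: "x \<in>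
    topspace X" "y \<in> topspace X" for x y
  proof -
    interpret G: group "sec F (W x \<inter> W y)" using sec_group W t by (simp add: point_cover_open2)
    show ?thesis unfolding cochain_mult_def using cocyclesD(2)[OF c(1) t] cocyclesD(2)[OF c(2) t]
      cocyclesD(2)[OF c(3) t]
      by (simp add: G.m_assoc)
  qed
  from cech_class_cong(2)[OF cochain_mult_cocycle[OF m(1) c(3)] this]
  show "A \<otimes>\<^bsub>cech_H1 X F\<^esub> B \<otimes>\<^bsub>cech_H1 X F\<^esub> C = A \<otimes>\<^bsub>cech_H1 X F\<^esub> (B \<otimes>\<^bsub>cech_H1 X F\<^esub> C)"
    unfolding e cech_mult[OF c(1,2)] cech_mult[OF c(2,3)] cech_mult[OF m(1) c(3)] cech_mult[OF c(1) m(2)] .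
next
  have "point_cover X (\<lambda>x. topspace X)" by (simp add: point_cover_def)
  from cech_one[OF this] show "\<one>\<^bsub>cech_H1 X F\<^esub> \<in> carrier (cech_H1 X F)" using cech_class_closed by simp
next
  fix A assume A: "A \<in> carrier (cech_H1 X F)"
  obtain W c where c: "(W,c) \<in> cocycles X F" "A = cech_class (W,c)" using cech_cases[OF A] .
  note W = cocyclesD(1)[OF c(1)]
  note o = cech_one[OF W] and i = cochain_inv_cocycle[OF c(1)]
  have g: "group (sec F (W x \<inter> W y))" if t: "x \<in> topspace X" "y \<in> topspace X" for x y
    using sec_group W t by (simp add: point_cover_open2)
  have 1: "cochain_mult W (\<lambda>x y. \<one>\<^bsub>sec F (W x \<inter> W y)\<^esub>) c x y = c x y" if t: "x \<in> topspace X" "y \<in> topspace X" for x y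
    unfolding cochain_mult_def using g[OF t] cocyclesD(2)[OF c(1) t] by (simp add: group.is_monoid)
  show "\<one>\<^bsub>cech_H1 X F\<^esub> \<otimes>\<^bsub>cech_H1 X F\<^esub> A = A"
    unfolding c(2) o(2) cech_mult[OF o(1) c(1)] by (rule cech_class_cong(2)[OF cochain_mult_cocycle[OF o(1) c(1)] 1])
  have 2: "cochain_mult W (cochain_inv W c) c x y = \<one>\<^bsub>sec F (W x \<inter> W y)\<^esub>" if t: "x \<in> topspace X" "y \<in> topspace
    X" for x y
    unfolding cochain_mult_def cochain_inv_def using g[OF t] cocyclesD(2)[OF c(1) t] by (simp add: group.l_inv)
  have "cech_class (W, cochain_inv W c) \<otimes>\<^bsub>cech_H1 X F\<^esub> A = \<one>\<^bsub>cech_H1 X F\<^esub>"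
    unfolding c(2) o(2) cech_mult[OF i c(1)] by (rule cech_class_cong(2)[OF cochain_mult_cocycle[OF i c(1)] 2])
  then show "\<exists>B\<in>carrier (cech_H1 X F). B \<otimes>\<^bsub>cech_H1 X F\<^esub> A = \<one>\<^bsub>cech_H1 X F\<^esub>"
    using cech_class_closed[OF i] by blast
qed

end

section \<open>Stalks and morphisms\<close>

sublocale group_presheaf \<subseteq> st: normal_presheaf X F "triv F"
proof (rule normal_presheaf.intro[OF group_presheaf_axioms normal_presheaf_axioms.intro])
  show "\<And>U. openin X U \<Longrightarrow> triv F U \<lhd> sec F U" unfolding triv_def using group.one_is_normal[OF sec_group] .
  show "\<And>U V s. \<lbrakk>openin X U; openin X V; V \<subseteq> U; s \<in> triv F U\<rbrakk> \<Longrightarrow> res F U V s \<in> triv F V"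
    unfolding triv_def using res_one by simp
qed

lemma (in group_presheaf) germ_eq_iff:
  assumes "openin X U" "x \<in> U" "s \<in> carrier (sec F U)" "openin X V" "x \<in> V" "t \<in> carrier (sec F V)"
  shows "germ X F x (U,s) = germ X F x (V,t) \<longleftrightarrow>
    (\<exists>W. openin X W \<and> x \<in> W \<and> W \<subseteq> U \<and> W \<subseteq> V \<and> res F U W s = res F V W t)"
proof -
  have "res F U W s \<otimes>\<^bsub>sec F W\<^esub> inv\<^bsub>sec F W\<^esub> res F V W t \<in> triv F W \<longleftrightarrow> res F U W s = res F V W t"
    if W: "openin X W" "W \<subseteq> U" "W \<subseteq> V" for W
  proof -
    interpret G: group "sec F W" using sec_group W by blast
    have "res F U W s \<in> carrier (sec F W)" "res F V W t \<in> carrier (sec F W)" using assms W by (auto intro: res_closed)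
    then show ?thesis unfolding triv_def
      by (metis G.inv_closed G.inv_equality G.inv_inv G.r_inv singletonD singletonI)
  qed
  then show ?thesis by (subst st.coset_germ_eq_iff[OF assms]) metis
qed

text \<open>Uniqueness of gluing, stated with germs so that equalities of sections can be checked in the stalks.\<close>

locale separated_presheaf = group_presheaf +
  assumes separated: "\<lbrakk>openin X U; s \<in> carrier (sec F U); t \<in> carrier (sec F U);
    \<And>x. x \<in> U \<Longrightarrow> germ X F x (U,s) = germ X F x (U,t)\<rbrakk> \<Longrightarrow> s = t"

lemma (in normal_presheaf) quot_sep: "separated_presheaf X (quot_sheaf X F K)"
proof -
  interpret Q: group_presheaf X "quot_sheaf X F K" by (rule quot_presheaf)
  show ?thesis
  proof (rule separated_presheaf.intro[OF quot_presheaf separated_presheaf_axioms.intro])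
    fix U s t assume U: "openin X U" and s: "s \<in> carrier (sec (quot_sheaf X F K) U)" and t: "t \<in> carrier (sec
      (quot_sheaf X F K) U)"
      and e: "\<And>x. x \<in> U \<Longrightarrow> germ X (quot_sheaf X F K) x (U,s) = germ X (quot_sheaf X F K) x (U,t)"
    show "s = t"
    proof (rule quot_sec_eqI[OF s t])
      fix x assume x: "x \<in> U"
      obtain W where "x \<in> W" "restrict s W = restrict t W"
        using e[OF x] Q.germ_eq_iff[OF U x s U x t] unfolding quot_res by blast
      then show "s x = t x" by (metis restrict_apply')
    qed
  qed
qed

locale presheaf_hom = src: group_presheaf X F + tgt: group_presheaf X F'
  for X :: "'x topology" and F :: "('x, 'a) sheaf" and F' :: "('x, 'b) sheaf" +
  fixes \<phi> :: "'x set \<Rightarrow> 'a \<Rightarrow> 'b"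
  assumes map_hom: "openin X U \<Longrightarrow> \<phi> U \<in> hom (sec F U) (sec F' U)"
    and map_res: "\<lbrakk>openin X U; openin X V; V \<subseteq> U; s \<in> carrier (sec F U)\<rbrakk> \<Longrightarrow> res F' U V (\<phi> U s) = \<phi> V (res F U V s)"
begin

lemma map_group_hom: "openin X U \<Longrightarrow> group_hom (sec F U) (sec F' U) (\<phi> U)"
  by (simp add: group_hom_axioms_def group_hom_def map_hom src.sec_group tgt.sec_group)

lemma map_closed: "\<lbrakk>openin X U; s \<in> carrier (sec F U)\<rbrakk> \<Longrightarrow> \<phi> U s \<in> carrier (sec F' U)"
  by (meson group_hom.hom_closed map_group_hom)

lemma map_mult: "\<lbrakk>openin X U; s \<in> carrier (sec F U); t \<in> carrier (sec F U)\<rbrakk>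
   \<Longrightarrow> \<phi> U (s \<otimes>\<^bsub>sec F U\<^esub> t) = \<phi> U s \<otimes>\<^bsub>sec F' U\<^esub> \<phi> U t"
  by (meson group_hom.hom_mult map_group_hom)

lemma map_one: "openin X U \<Longrightarrow> \<phi> U \<one>\<^bsub>sec F U\<^esub> = \<one>\<^bsub>sec F' U\<^esub>"
  by (meson group_hom.hom_one map_group_hom)

lemma map_inv: "\<lbrakk>openin X U; s \<in> carrier (sec F U)\<rbrakk> \<Longrightarrow> \<phi> U (inv\<^bsub>sec F U\<^esub> s) = inv\<^bsub>sec F' U\<^esub> (\<phi> U s)"
  by (meson group_hom.hom_inv map_group_hom)

definition cochain_map :: "('x \<Rightarrow> 'x set) \<Rightarrow> ('x \<Rightarrow> 'x \<Rightarrow> 'a) \<Rightarrow> 'x \<Rightarrow> 'x \<Rightarrow> 'b" where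
  "cochain_map U c = (\<lambda>x y. \<phi> (U x \<inter> U y) (c x y))"

lemma cochain_map_cocycle:
  assumes c: "(U,c) \<in> cocycles X F" shows "(U, cochain_map U c) \<in> cocycles X F'"
proof (rule cocyclesI[OF cocyclesD(1)[OF c]])
  note U = cocyclesD(1)[OF c]
  show "\<And>x y. x \<in> topspace X \<Longrightarrow> y \<in> topspace X \<Longrightarrow> cochain_map U c x y \<in> carrier (sec F' (U x \<inter> U y))"
    unfolding cochain_map_def using cocyclesD(2)[OF c] U by (simp add: map_closed point_cover_open2)
  fix x y z assume t: "x \<in> topspace X" "y \<in> topspace X" "z \<in> topspace X"
  let ?T = "U x \<inter> U y \<inter> U z"
  have o: "openin X ?T" "openin X (U x \<inter> U y)" "openin X (U y \<inter> U z)" "openin X (U x \<inter> U z)"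
    using point_cover_open3[OF U t] point_cover_open2[OF U] t by simp_all
  have j: "?T \<subseteq> U x \<inter> U y" "?T \<subseteq> U y \<inter> U z" "?T \<subseteq> U x \<inter> U z" by auto
  note cc = cocyclesD(2)[OF c t(1,2)] cocyclesD(2)[OF c t(2,3)] cocyclesD(2)[OF c t(1,3)]
  note r = cc(1)[THEN src.res_closed[OF o(2,1) j(1)]] cc(2)[THEN src.res_closed[OF o(3,1) j(2)]]
  show "res F' (U x \<inter> U y) ?T (cochain_map U c x y) \<otimes>\<^bsub>sec F' ?T\<^esub> res F' (U y \<inter> U z) ?T (cochain_map U c y z)
     = res F' (U x \<inter> U z) ?T (cochain_map U c x z)"
    unfolding cochain_map_def map_res[OF o(2,1) j(1) cc(1)] map_res[OF o(3,1) j(2) cc(2)] map_res[OF o(4,1) j(3)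
      cc(3)]
      map_mult[OF o(1) r, symmetric] cocyclesD(3)[OF c t] ..
qed

lemma cochain_map_cohomologous:
  assumes cd: "((U,c),(V,d)) \<in> cohomologous X F"
  shows "((U, cochain_map U c), (V, cochain_map V d)) \<in> cohomologous X F'"
proof -
  obtain W h where W: "(U,c) \<in> cocycles X F" "(V,d) \<in> cocycles X F" "point_cover X W"
      "\<And>x. x \<in> topspace X \<Longrightarrow> W x \<subseteq> U x" "\<And>x. x \<in> topspace X \<Longrightarrow> W x \<subseteq> V x"
      "\<And>x. x \<in> topspace X \<Longrightarrow> h x \<in> carrier (sec F (W x))"
      "src.cobound W h (cochain_res F U W c) (cochain_res F V W d)"
    using cd unfolding src.cohomologous_iff by blast
  have e: "cochain_res F' U W (cochain_map U c) x y = \<phi> (W x \<inter> W y) (cochain_res F U W c x y)"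
    if "(U,c) \<in> cocycles X F" "\<And>x. x \<in> topspace X \<Longrightarrow> W x \<subseteq> U x" and t: "x \<in> topspace X" "y \<in> topspace X" for x y U c
    unfolding cochain_res_def cochain_map_def
    by (rule map_res) (use that W(3) cocyclesD(1,2)[OF that(1)] in \<open>simp_all add: point_cover_open2 le_infI1
      le_infI2\<close>)
  show ?thesis
  proof (rule tgt.cohomologous_onI[OF cochain_map_cocycle[OF W(1)] cochain_map_cocycle[OF W(2)] W(3-5)])
    show "\<And>x. x \<in> topspace X \<Longrightarrow> \<phi> (W x) (h x) \<in> carrier (sec F' (W x))"
      using W(3,6) by (simp add: map_closed point_cover_open)
    show "tgt.cobound W (\<lambda>x. \<phi> (W x) (h x)) (cochain_res F' U W (cochain_map U c)) (cochain_res F' V W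
      (cochain_map V d))"
      unfolding tgt.cobound_def
    proof (intro ballI)
      fix x y assume t: "x \<in> topspace X" "y \<in> topspace X"
      let ?N = "W x \<inter> W y"
      have o: "openin X (W x)" "openin X (W y)" "openin X ?N" using W(3) t by (auto simp: point_cover_def)
      have j: "?N \<subseteq> W x" "?N \<subseteq> W y" by auto
      note r = W(6)[OF t(1), THEN src.res_closed[OF o(1,3) j(1)]] W(6)[OF t(2), THEN src.res_closed[OF o(2,3) j(2)]]
      have 1: "cochain_res F V W d x y = inv\<^bsub>sec F ?N\<^esub> (res F (W x) ?N (h x)) \<otimes>\<^bsub>sec F ?N\<^esub> cochain_res F U W c x
        y \<otimes>\<^bsub>sec F ?N\<^esub> res F (W y) ?N (h y)"
        using W(7) t unfolding src.cobound_def by blast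
      have e1: "cochain_res F' U W (cochain_map U c) x y = \<phi> ?N (cochain_res F U W c x y)" by (rule e[OF W(1,4) t])
      have e2: "cochain_res F' V W (cochain_map V d) x y = \<phi> ?N (cochain_res F V W d x y)" by (rule e[OF W(2,5) t])
      show "cochain_res F' V W (cochain_map V d) x y = inv\<^bsub>sec F' ?N\<^esub> (res F' (W x) ?N (\<phi> (W x) (h x))) \<otimes>\<^bsub>sec F' ?N\<^esub>
          cochain_res F' U W (cochain_map U c) x y \<otimes>\<^bsub>sec F' ?N\<^esub> res F' (W y) ?N (\<phi> (W y) (h y))"
        unfolding e1 e2 1 map_res[OF o(1,3) j(1) W(6)[OF t(1)]] map_res[OF o(2,3) j(2) W(6)[OF t(2)]]
        using o r src.cochain_res_closed[OF W(1,3,4) t] by (simp add: map_mult map_inv src.mult_closed src.inv_closed)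
    qed
  qed
qed

lemma H1_map_cech_class:
  assumes c: "(U,c) \<in> cocycles X F"
  shows "H1_map X F' \<phi> (src.cech_class (U,c)) = tgt.cech_class (U, cochain_map U c)"
proof -
  have "H1_map X F' \<phi> (src.cech_class (U,c)) = (\<Union>q \<in> src.cech_class (U,c). tgt.cech_class (fst q, cochain_map
    (fst q) (snd q)))"
    unfolding H1_map_def tgt.cech_class_def cochain_map_def split_def ..
  also have "\<dots> = tgt.cech_class (U, cochain_map U c)"
  proof -
    have "tgt.cech_class (fst q, cochain_map (fst q) (snd q)) = tgt.cech_class (U, cochain_map U c)" if "q \<in>
      src.cech_class (U,c)" for q
    proof -
      have "((U,c),(fst q, snd q)) \<in> cohomologous X F" using that unfolding src.cech_class_def by simp
      from cochain_map_cohomologous[OF this] show ?thesis unfolding tgt.cech_class_def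
        using equiv_class_eq[OF tgt.cohomologous_equiv] by metis
    qed
    then show ?thesis using src.cech_class_mem[OF c] by blast
  qed
  finally show ?thesis .
qed

end

text \<open>Morphisms of pairs. They induce maps on quotient stalks and quotient sheaves; ordinary stalk maps and
  the canonical maps between the quotients \<open>H\<^sub>i/H\<^sub>l\<close> are both of this kind.\<close>

locale normal_hom = presheaf_hom X F F' \<phi> + S: normal_presheaf X F K + T: normal_presheaf X F' K'
  for X :: "'x topology" and F :: "('x, 'a) sheaf" and F' :: "('x, 'b) sheaf" and \<phi> K K' +
  assumes map_K: "\<lbrakk>openin X U; s \<in> K U\<rbrakk> \<Longrightarrow> \<phi> U s \<in> K' U"
begin

definition quot_stalk_map where "quot_stalk_map x A = (\<Union>(V,t) \<in> A. coset_germ X F' K' x (V, \<phi> V t))"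

lemma quot_stalk_map_germ:
  assumes U: "openin X U" "x \<in> U" "s \<in> carrier (sec F U)"
  shows "quot_stalk_map x (coset_germ X F K x (U,s)) = coset_germ X F' K' x (U, \<phi> U s)"
proof -
  have "quot_stalk_map x (coset_germ X F K x (U,s)) = (\<Union>q \<in> coset_germ X F K x (U,s). (\<lambda>(V,t). coset_germ X F'
    K' x (V, \<phi> V t)) q)"
    unfolding quot_stalk_map_def ..
  also have "\<dots> = (\<lambda>(V,t). coset_germ X F' K' x (V, \<phi> V t)) (U,s)"
  proof (rule S.coset_germ_UNION[OF U], unfold split)
    fix V t assume V: "openin X V" "x \<in> V" "t \<in> carrier (sec F V)" and e: "coset_germ X F K x (V,t) = coset_germ
      X F K x (U,s)"
    obtain W where W: "openin X W" "x \<in> W" "W \<subseteq> V" "W \<subseteq> U" "res F V W t \<otimes>\<^bsub>sec F W\<^esub> inv\<^bsub>sec F W\<^esub> (res F U W s) \<in> K W"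
      using e S.coset_germ_eq_iff[OF V U] by blast
    have "\<phi> W (res F V W t \<otimes>\<^bsub>sec F W\<^esub> inv\<^bsub>sec F W\<^esub> (res F U W s)) \<in> K' W" using W map_K by blast
    then have "res F' V W (\<phi> V t) \<otimes>\<^bsub>sec F' W\<^esub> inv\<^bsub>sec F' W\<^esub> (res F' U W (\<phi> U s)) \<in> K' W"
      using U V W by (simp add: map_mult map_inv map_res src.res_closed src.inv_closed)
    then show "coset_germ X F' K' x (V, \<phi> V t) = coset_germ X F' K' x (U, \<phi> U s)"
      using T.coset_germ_eq_iff[OF V(1,2) map_closed U(1,2) map_closed] U V W by blast
  qed
  finally show ?thesis by simp
qed

lemma quot_stalk_map_hom:
  assumes x: "x \<in> topspace X" shows "quot_stalk_map x \<in> hom (quot_stalk X F K x) (quot_stalk X F' K' x)"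
proof (rule homI)
  fix A B assume AB: "A \<in> carrier (quot_stalk X F K x)" "B \<in> carrier (quot_stalk X F K x)"
  obtain U s t where U: "openin X U" "x \<in> U" "s \<in> carrier (sec F U)" "t \<in> carrier (sec F U)"
    "A = coset_germ X F K x (U,s)" "B = coset_germ X F K x (U,t)" using S.quot_stalk_cases2[OF AB] .
  then show "quot_stalk_map x A \<in> carrier (quot_stalk X F' K' x)"
    by (simp add: quot_stalk_map_germ T.coset_germ_closed map_closed)
  show "quot_stalk_map x (A \<otimes>\<^bsub>quot_stalk X F K x\<^esub> B) = quot_stalk_map x A \<otimes>\<^bsub>quot_stalk X F' K' x\<^esub> quot_stalk_map x B"
    using U by (simp add: S.coset_germ_mult T.coset_germ_mult quot_stalk_map_germ map_closed map_mult src.mult_closed)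
qed

lemma quot_stalk_map_closed: "\<lbrakk>x \<in> topspace X; A \<in> carrier (quot_stalk X F K x)\<rbrakk> \<Longrightarrow> quot_stalk_map x A \<in> carrier
  (quot_stalk X F' K' x)"
  using quot_stalk_map_hom by (simp add: hom_def Pi_iff)

definition quot_sheaf_map where "quot_sheaf_map U \<sigma> = (\<lambda>x\<in>U. quot_stalk_map x (\<sigma> x))"

lemma quot_sheaf_map_closed:
  assumes U: "openin X U" and s: "\<sigma> \<in> carrier (sec (quot_sheaf X F K) U)"
  shows "quot_sheaf_map U \<sigma> \<in> carrier (sec (quot_sheaf X F' K') U)"
  unfolding T.quot_sec_iff
proof (intro conjI ballI)
  have UX: "U \<subseteq> topspace X" using U openin_subset by blast
  show "quot_sheaf_map U \<sigma> \<in> (\<Pi>\<^sub>E x\<in>U. carrier (quot_stalk X F' K' x))" unfolding quot_sheaf_map_def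
    using quot_stalk_map_closed S.quot_sec_val[OF s] UX by (simp add: subset_iff)
  fix x assume x: "x \<in> U"
  obtain V t where V: "openin X V" "x \<in> V" "V \<subseteq> U" "V \<subseteq> U" "t \<in> carrier (sec F V)"
    "\<forall>y\<in>V. \<sigma> y = coset_germ X F K y (V,t)" using S.quot_secE[OF s x U x] .
  have "quot_sheaf_map U \<sigma> y = coset_germ X F' K' y (V, \<phi> V t)" if "y \<in> V" for y
    unfolding quot_sheaf_map_def using that V by (auto simp: quot_stalk_map_germ)
  then show "\<exists>V s. openin X V \<and> x \<in> V \<and> V \<subseteq> U \<and> s \<in> carrier (sec F' V) \<and> (\<forall>y\<in>V. quot_sheaf_map U \<sigma> y =
    coset_germ X F' K' y (V, s))"
    using V by (intro exI[of _ V] exI[of _ "\<phi> V t"]) (simp add: map_closed)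
qed

lemma quot_sheaf_map_hom: "presheaf_hom X (quot_sheaf X F K) (quot_sheaf X F' K') quot_sheaf_map"
proof (rule presheaf_hom.intro[OF S.quot_presheaf T.quot_presheaf presheaf_hom_axioms.intro])
  fix U assume U: "openin X U"
  then have UX: "U \<subseteq> topspace X" using openin_subset by blast
  show "quot_sheaf_map U \<in> hom (sec (quot_sheaf X F K) U) (sec (quot_sheaf X F' K') U)"
  proof (rule homI)
    fix s assume s: "s \<in> carrier (sec (quot_sheaf X F K) U)"
    show "quot_sheaf_map U s \<in> carrier (sec (quot_sheaf X F' K') U)" using quot_sheaf_map_closed U s .
    fix t assume t: "t \<in> carrier (sec (quot_sheaf X F K) U)"
    have "quot_stalk_map x (s x \<otimes>\<^bsub>quot_stalk X F K x\<^esub> t x) = quot_stalk_map x (s x) \<otimes>\<^bsub>quot_stalk X F' K' x\<^esub>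
      quot_stalk_map x (t x)" if "x \<in> U" for x
      using hom_mult[OF quot_stalk_map_hom] S.quot_sec_val s t that UX by blast
    then show "quot_sheaf_map U (s \<otimes>\<^bsub>sec (quot_sheaf X F K) U\<^esub> t) = quot_sheaf_map U s \<otimes>\<^bsub>sec (quot_sheaf X F'
      K') U\<^esub> quot_sheaf_map U t"
      by (auto simp: S.quot_sec_mult T.quot_sec_mult quot_sheaf_map_def fun_eq_iff)
  qed
next
  fix U V s assume "openin X U" "openin X V" "V \<subseteq> U"
  then show "res (quot_sheaf X F' K') U V (quot_sheaf_map U s) = quot_sheaf_map V (res (quot_sheaf X F K) U V s)"
    by (auto simp: S.quot_res T.quot_res quot_sheaf_map_def fun_eq_iff)
qed

end

sublocale presheaf_hom \<subseteq> st: normal_hom X F F' \<phi> "triv F" "triv F'"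
  by (rule normal_hom.intro[OF presheaf_hom_axioms src.st.normal_presheaf_axioms tgt.st.normal_presheaf_axioms
    normal_hom_axioms.intro])
    (simp add: triv_def map_one)

context presheaf_hom
begin

lemma stalk_map_eq_quot: "stalk_map X F' \<phi> = st.quot_stalk_map"
  unfolding stalk_map_def st.quot_stalk_map_def fun_eq_iff by simp

lemmas stalk_map_germ = st.quot_stalk_map_germ[folded stalk_map_eq_quot]
  and stalk_map_hom = st.quot_stalk_map_hom[folded stalk_map_eq_quot]
  and stalk_map_closed = st.quot_stalk_map_closed[folded stalk_map_eq_quot]

lemma stalk_map_group_hom: "x \<in> topspace X \<Longrightarrow> group_hom (stalk X F x) (stalk X F' x) (stalk_map X F' \<phi> x)"
  by (simp add: group_hom_axioms_def group_hom_def stalk_map_hom src.st.quot_stalk_group tgt.st.quot_stalk_group)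

end

section \<open>Exact sequences and lifts of global sections\<close>

text \<open>Exactness as sheaves: on sections at the first two places, and only locally at the third.\<close>

locale exact_seq = A: separated_presheaf X A + E: separated_presheaf X E + Q: separated_presheaf X Q +
  i: presheaf_hom X A E i + p: presheaf_hom X E Q p
  for X :: "'x topology" and A :: "('x, 'a) sheaf" and E :: "('x, 'e) sheaf" and Q :: "('x, 'q) sheaf" and i p +
  assumes i_inj1: "\<lbrakk>openin X U; a \<in> carrier (sec A U); i U a = \<one>\<^bsub>sec E U\<^esub>\<rbrakk> \<Longrightarrow> a = \<one>\<^bsub>sec A U\<^esub>"
    and p_i: "\<lbrakk>openin X U; a \<in> carrier (sec A U)\<rbrakk> \<Longrightarrow> p U (i U a) = \<one>\<^bsub>sec Q U\<^esub>"
    and exact: "\<lbrakk>openin X U; s \<in> carrier (sec E U); p U s = \<one>\<^bsub>sec Q U\<^esub>\<rbrakk> \<Longrightarrow> \<exists>a \<in> carrier (sec A U). i U a = s"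
    and locally_surj: "\<lbrakk>openin X U; q \<in> carrier (sec Q U); x \<in> U\<rbrakk> \<Longrightarrow>
      \<exists>V s. openin X V \<and> x \<in> V \<and> V \<subseteq> U \<and> s \<in> carrier (sec E V) \<and> p V s = res Q U V q"
begin

lemma i_inj: "\<lbrakk>openin X U; a \<in> carrier (sec A U); b \<in> carrier (sec A U); i U a = i U b\<rbrakk> \<Longrightarrow> a = b"
  using group_hom.inj_on_one_iff[OF i.map_group_hom] i_inj1 by (metis inj_onD)

text \<open>Local lifts \<open>g\<close> of a global section \<open>s\<close> of \<open>Q\<close>, with the cocycle \<open>a\<close> of \<open>A\<close> formed by their
  differences, exactly as in the definition of the connecting map in degree 1.\<close>

definition lift_data where
  "lift_data s U g a \<longleftrightarrow> (U, a) \<in> cocycles X A \<and>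
     (\<forall>x \<in> topspace X. g x \<in> carrier (sec E (U x)) \<and> p (U x) (g x) = res Q (topspace X) (U x) s) \<and>
     (\<forall>x \<in> topspace X. \<forall>y \<in> topspace X. i (U x \<inter> U y) (a x y) =
        inv\<^bsub>sec E (U x \<inter> U y)\<^esub> (res E (U x) (U x \<inter> U y) (g x)) \<otimes>\<^bsub>sec E (U x \<inter> U y)\<^esub> res E (U y) (U x \<inter> U y) (g y))"

text \<open>The cocycle identity holds automatically: it is
  \<open>(g x)\<inverse> g y (g y)\<inverse> g z = (g x)\<inverse> g z\<close>, pulled back along the injective map
  \<open>i\<close>.\<close>

lemma lift_data_if:
  assumes U: "point_cover X U"
    and g: "\<And>x. x \<in> topspace X \<Longrightarrow> g x \<in> carrier (sec E (U x))" 
      "\<And>x. x \<in> topspace X \<Longrightarrow> p (U x) (g x) = res Q (topspace X) (U x) s"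
    and a: "\<And>x y. \<lbrakk>x \<in> topspace X; y \<in> topspace X\<rbrakk> \<Longrightarrow> a x y \<in> carrier (sec A (U x \<inter> U y))"
      "\<And>x y. \<lbrakk>x \<in> topspace X; y \<in> topspace X\<rbrakk> \<Longrightarrow> i (U x \<inter> U y) (a x y) =
        inv\<^bsub>sec E (U x \<inter> U y)\<^esub> (res E (U x) (U x \<inter> U y) (g x)) \<otimes>\<^bsub>sec E (U x \<inter> U y)\<^esub> res E (U y) (U x \<inter> U y) (g y)"
  shows "lift_data s U g a"
proof -
  have "(U, a) \<in> cocycles X A"
  proof (rule cocyclesI[OF U a(1)])
    fix x y z assume t: "x \<in> topspace X" "y \<in> topspace X" "z \<in> topspace X"
    let ?T = "U x \<inter> U y \<inter> U z"
    have o: "openin X ?T" "openin X (U x \<inter> U y)" "openin X (U y \<inter> U z)" "openin X (U x \<inter> U z)"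
      "openin X (U x)" "openin X (U y)" "openin X (U z)"
      using point_cover_open3[OF U t] point_cover_open2[OF U] point_cover_open[OF U] t by simp_all
    have j: "?T \<subseteq> U x \<inter> U y" "?T \<subseteq> U y \<inter> U z" "?T \<subseteq> U x \<inter> U z" "?T \<subseteq> U x" "?T \<subseteq> U y" "?T \<subseteq> U z"
      "U x \<inter> U y \<subseteq> U x" "U x \<inter> U y \<subseteq> U y" "U y \<inter> U z \<subseteq> U y" "U y \<inter> U z \<subseteq> U z" "U x \<inter> U z \<subseteq> U x" "U x \<inter> U z \<subseteq> U
        z" by auto
    note cc = a(1)[OF t(1,2)] a(1)[OF t(2,3)] a(1)[OF t(1,3)]
    note gg = g(1)[OF t(1)] g(1)[OF t(2)] g(1)[OF t(3)]
    interpret G: group "sec E ?T" using E.sec_group o by blast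
    note gr = gg(1)[THEN E.res_closed[OF o(5,1) j(4)]] gg(2)[THEN E.res_closed[OF o(6,1) j(5)]] gg(3)[THEN
      E.res_closed[OF o(7,1) j(6)]]
    note r = cc(1)[THEN A.res_closed[OF o(2,1) j(1)]] cc(2)[THEN A.res_closed[OF o(3,1) j(2)]] cc(3)[THEN
      A.res_closed[OF o(4,1) j(3)]]
    have xy: "i ?T (res A (U x \<inter> U y) ?T (a x y)) = inv\<^bsub>sec E ?T\<^esub> (res E (U x) ?T (g x)) \<otimes>\<^bsub>sec E ?T\<^esub> res E (U y)
      ?T (g y)"
      unfolding i.map_res[OF o(2,1) j(1) cc(1), symmetric] a(2)[OF t(1,2)]
      using o j gg by (simp add: E.res_mult E.res_inv E.res_res E.res_closed E.inv_closed)
    have yz: "i ?T (res A (U y \<inter> U z) ?T (a y z)) = inv\<^bsub>sec E ?T\<^esub> (res E (U y) ?T (g y)) \<otimes>\<^bsub>sec E ?T\<^esub> res E (U z)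
      ?T (g z)"
      unfolding i.map_res[OF o(3,1) j(2) cc(2), symmetric] a(2)[OF t(2,3)]
      using o j gg by (simp add: E.res_mult E.res_inv E.res_res E.res_closed E.inv_closed)
    have xz: "i ?T (res A (U x \<inter> U z) ?T (a x z)) = inv\<^bsub>sec E ?T\<^esub> (res E (U x) ?T (g x)) \<otimes>\<^bsub>sec E ?T\<^esub> res E (U z)
      ?T (g z)"
      unfolding i.map_res[OF o(4,1) j(3) cc(3), symmetric] a(2)[OF t(1,3)]
      using o j gg by (simp add: E.res_mult E.res_inv E.res_res E.res_closed E.inv_closed)
    show "res A (U x \<inter> U y) ?T (a x y) \<otimes>\<^bsub>sec A ?T\<^esub> res A (U y \<inter> U z) ?T (a y z) = res A (U x \<inter> U z) ?T (a x z)"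
    proof (rule i_inj[OF o(1) A.mult_closed[OF o(1) r(1,2)] r(3)])
      show "i ?T (res A (U x \<inter> U y) ?T (a x y) \<otimes>\<^bsub>sec A ?T\<^esub> res A (U y \<inter> U z) ?T (a y z)) = i ?T (res A (U x \<inter> U
        z) ?T (a x z))"
        unfolding i.map_mult[OF o(1) r(1,2)] xy yz xz using gr by (simp add: G.m_assoc)
    qed
  qed
  then show ?thesis unfolding lift_data_def using assms by blast
qed

lemma p_eq_imp:
  assumes o: "openin X U" and s: "s \<in> carrier (sec E U)" "t \<in> carrier (sec E U)" and e: "p U s = p U t"
  shows "\<exists>a \<in> carrier (sec A U). i U a = inv\<^bsub>sec E U\<^esub> s \<otimes>\<^bsub>sec E U\<^esub> t"
proof (rule exact[OF o])
  interpret G: group "sec Q U" using Q.sec_group o by blast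
  show "inv\<^bsub>sec E U\<^esub> s \<otimes>\<^bsub>sec E U\<^esub> t \<in> carrier (sec E U)" using o s by (simp add: E.closed)
  show "p U (inv\<^bsub>sec E U\<^esub> s \<otimes>\<^bsub>sec E U\<^esub> t) = \<one>\<^bsub>sec Q U\<^esub>"
    using o s e p.map_closed[OF o s(2)] by (simp add: p.map_mult p.map_inv E.inv_closed)
qed

lemma lift_data_exists:
  assumes s: "s \<in> carrier (sec Q (topspace X))"
  shows "\<exists>U g a. lift_data s U g a"
proof -
  have "\<forall>x. \<exists>V g. x \<in> topspace X \<longrightarrow> openin X V \<and> x \<in> V \<and> g \<in> carrier (sec E V) \<and> p V g = res Q (topspace X) V s"
    using locally_surj[OF openin_topspace s] by blast
  then obtain U g where Ug: "\<And>x. x \<in> topspace X \<Longrightarrow> openin X (U x) \<and> x \<in> U x \<and> g x \<in> carrier (sec E (U x)) \<and> p (U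
    x) (g x) = res Q (topspace X) (U x) s"
    by metis
  have U: "point_cover X U" using Ug by (simp add: point_cover_def)
  have "\<exists>a \<in> carrier (sec A (U x \<inter> U y)). i (U x \<inter> U y) a =
        inv\<^bsub>sec E (U x \<inter> U y)\<^esub> (res E (U x) (U x \<inter> U y) (g x)) \<otimes>\<^bsub>sec E (U x \<inter> U y)\<^esub> res E (U y) (U x \<inter> U y) (g y)"
    if t: "x \<in> topspace X" "y \<in> topspace X" for x y
  proof (rule p_eq_imp)
    show o: "openin X (U x \<inter> U y)" using point_cover_open2[OF U t] .
    show "res E (U x) (U x \<inter> U y) (g x) \<in> carrier (sec E (U x \<inter> U y))" "res E (U y) (U x \<inter> U y) (g y) \<in> carrier
      (sec E (U x \<inter> U y))"
      using Ug t o by (simp_all add: E.res_closed)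
    show "p (U x \<inter> U y) (res E (U x) (U x \<inter> U y) (g x)) = p (U x \<inter> U y) (res E (U y) (U x \<inter> U y) (g y))"
      using Ug t o s by (simp add: p.map_res[symmetric] Q.res_res openin_subset)
  qed
  then obtain a where "\<And>x y. \<lbrakk>x \<in> topspace X; y \<in> topspace X\<rbrakk> \<Longrightarrow> a x y \<in> carrier (sec A (U x \<inter> U y)) \<and> i (U x \<inter> U
    y) (a x y) =
        inv\<^bsub>sec E (U x \<inter> U y)\<^esub> (res E (U x) (U x \<inter> U y) (g x)) \<otimes>\<^bsub>sec E (U x \<inter> U y)\<^esub> res E (U y) (U x \<inter> U y) (g y)"
    by metis
  then have "lift_data s U g a" using Ug by (intro lift_data_if[OF U]) blast+
  then show ?thesis by blast
qed

text \<open>Two systems of lifts \<open>g\<close> and \<open>f\<close> of the same section differ by \<open>i (h x) = (g x)\<inverse> f x\<close>, and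
  then \<open>(f x)\<inverse> f y = (h x)\<inverse> (g x)\<inverse> g y (h y)\<close>.\<close>

lemma lift_data_unique:
  assumes l: "lift_data s U g a" "lift_data s V f b" and s: "s \<in> carrier (sec Q (topspace X))"
  shows "((U,a),(V,b)) \<in> cohomologous X A"
proof -
  have a: "(U,a) \<in> cocycles X A" and b: "(V,b) \<in> cocycles X A" using l unfolding lift_data_def by auto
  note U = cocyclesD(1)[OF a] and V = cocyclesD(1)[OF b]
  have g: "\<And>x. x \<in> topspace X \<Longrightarrow> g x \<in> carrier (sec E (U x))" "\<And>x. x \<in> topspace X \<Longrightarrow> p (U x) (g x) = res Q
    (topspace X) (U x) s"
    "\<And>x y. \<lbrakk>x \<in> topspace X; y \<in> topspace X\<rbrakk> \<Longrightarrow> i (U x \<inter> U y) (a x y) =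
        inv\<^bsub>sec E (U x \<inter> U y)\<^esub> (res E (U x) (U x \<inter> U y) (g x)) \<otimes>\<^bsub>sec E (U x \<inter> U y)\<^esub> res E (U y) (U x \<inter> U y) (g y)"
    using l(1) unfolding lift_data_def by blast+
  have f: "\<And>x. x \<in> topspace X \<Longrightarrow> f x \<in> carrier (sec E (V x))" "\<And>x. x \<in> topspace X \<Longrightarrow> p (V x) (f x) = res Q
    (topspace X) (V x) s"
    "\<And>x y. \<lbrakk>x \<in> topspace X; y \<in> topspace X\<rbrakk> \<Longrightarrow> i (V x \<inter> V y) (b x y) =
        inv\<^bsub>sec E (V x \<inter> V y)\<^esub> (res E (V x) (V x \<inter> V y) (f x)) \<otimes>\<^bsub>sec E (V x \<inter> V y)\<^esub> res E (V y) (V x \<inter> V y) (f y)"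
    using l(2) unfolding lift_data_def by blast+
  define W where "W = (\<lambda>x. U x \<inter> V x)"
  have W: "point_cover X W" "\<And>x. W x \<subseteq> U x" "\<And>x. W x \<subseteq> V x" unfolding W_def using point_cover_Int U V by auto
  have "\<exists>h \<in> carrier (sec A (W x)). i (W x) h = inv\<^bsub>sec E (W x)\<^esub> (res E (U x) (W x) (g x)) \<otimes>\<^bsub>sec E (W x)\<^esub> res E
    (V x) (W x) (f x)"
    if t: "x \<in> topspace X" for x
  proof (rule p_eq_imp)
    have o: "openin X (W x)" "openin X (U x)" "openin X (V x)" using point_cover_open[OF U t]
      point_cover_open[OF V t] point_cover_open[OF W(1) t] by simp_all
    show "openin X (W x)" by (rule o)
    show "res E (U x) (W x) (g x) \<in> carrier (sec E (W x))" "res E (V x) (W x) (f x) \<in> carrier (sec E (W x))"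
      using W(2,3) o g(1) f(1) t by (simp_all add: E.res_closed)
    show "p (W x) (res E (U x) (W x) (g x)) = p (W x) (res E (V x) (W x) (f x))"
      using W(2,3) o g(1,2) f(1,2) t s by (simp add: p.map_res[symmetric] Q.res_res openin_subset)
  qed
  then obtain h where h: "\<And>x. x \<in> topspace X \<Longrightarrow> h x \<in> carrier (sec A (W x))"
    "\<And>x. x \<in> topspace X \<Longrightarrow> i (W x) (h x) = inv\<^bsub>sec E (W x)\<^esub> (res E (U x) (W x) (g x)) \<otimes>\<^bsub>sec E (W x)\<^esub> res E (V x)
      (W x) (f x)"
    by metis
  show ?thesis
  proof (rule A.cohomologous_onI[OF a b W h(1)])
    show "A.cobound W h (cochain_res A U W a) (cochain_res A V W b)" unfolding A.cobound_def
    proof (intro ballI)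
      fix x y assume t: "x \<in> topspace X" "y \<in> topspace X"
      let ?N = "W x \<inter> W y"
      have o: "openin X (W x)" "openin X (W y)" "openin X ?N" "openin X (U x)" "openin X (U y)" "openin X (V x)"
        "openin X (V y)"
        "openin X (U x \<inter> U y)" "openin X (V x \<inter> V y)"
        using W(1) U V t by (simp_all add: point_cover_open point_cover_open2)
      have j: "?N \<subseteq> W x" "?N \<subseteq> W y" "?N \<subseteq> U x \<inter> U y" "?N \<subseteq> V x \<inter> V y" "?N \<subseteq> U x" "?N \<subseteq> U y" "?N \<subseteq> V x" "?N \<subseteq> V
        y" using W(2,3) by blast+
      interpret G: group "sec E ?N" using E.sec_group o by blast
      note gr = g(1)[OF t(1), THEN E.res_closed[OF o(4,3) j(5)]] g(1)[OF t(2), THEN E.res_closed[OF o(5,3) j(6)]]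
      note fr = f(1)[OF t(1), THEN E.res_closed[OF o(6,3) j(7)]] f(1)[OF t(2), THEN E.res_closed[OF o(7,3) j(8)]]
      note hr = h(1)[OF t(1), THEN A.res_closed[OF o(1,3) j(1)]] h(1)[OF t(2), THEN A.res_closed[OF o(2,3) j(2)]]
      note aa = cocyclesD(2)[OF a t] and bb = cocyclesD(2)[OF b t]
      note ar = aa[THEN A.res_closed[OF o(8,3) j(3)]] and br = bb[THEN A.res_closed[OF o(9,3) j(4)]]
      have 1: "i ?N (res A (U x \<inter> U y) ?N (a x y)) = inv\<^bsub>sec E ?N\<^esub> (res E (U x) ?N (g x)) \<otimes>\<^bsub>sec E ?N\<^esub> res E (U
        y) ?N (g y)"
        unfolding i.map_res[OF o(8,3) j(3) aa, symmetric] g(3)[OF t]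
        using o j g(1) t by (simp add: E.res_mult E.res_inv E.res_res E.res_closed E.inv_closed)
      have 2: "i ?N (res A (V x \<inter> V y) ?N (b x y)) = inv\<^bsub>sec E ?N\<^esub> (res E (V x) ?N (f x)) \<otimes>\<^bsub>sec E ?N\<^esub> res E (V
        y) ?N (f y)"
        unfolding i.map_res[OF o(9,3) j(4) bb, symmetric] f(3)[OF t]
        using o j f(1) t by (simp add: E.res_mult E.res_inv E.res_res E.res_closed E.inv_closed)
      have 3: "i ?N (res A (W z) ?N (h z)) = inv\<^bsub>sec E ?N\<^esub> (res E (U z) ?N (g z)) \<otimes>\<^bsub>sec E ?N\<^esub> res E (V z) ?N (f z)"
        if z: "z \<in> topspace X" "?N \<subseteq> W z" for z
      proof -
        have oz: "openin X (W z)" "openin X (U z)" "openin X (V z)" using U V W z by (simp_all add: point_cover_open)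
        show ?thesis unfolding i.map_res[OF oz(1) o(3) z(2) h(1)[OF z(1)], symmetric] h(2)[OF z(1)]
          using o oz z W(2,3) f(1) g(1) by (simp add: E.res_mult E.res_inv E.res_res E.res_closed E.inv_closed)
      qed
      note 4 = 3[OF t(1) j(1)] 3[OF t(2) j(2)]
      show "cochain_res A V W b x y = inv\<^bsub>sec A ?N\<^esub> (res A (W x) ?N (h x)) \<otimes>\<^bsub>sec A ?N\<^esub> cochain_res A U W a x y
        \<otimes>\<^bsub>sec A ?N\<^esub> res A (W y) ?N (h y)"
        unfolding cochain_res_def
      proof (rule i_inj[OF o(3) br])
        show "inv\<^bsub>sec A ?N\<^esub> (res A (W x) ?N (h x)) \<otimes>\<^bsub>sec A ?N\<^esub> res A (U x \<inter> U y) ?N (a x y) \<otimes>\<^bsub>sec A ?N\<^esub> res A (W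
          y) ?N (h y) \<in> carrier (sec A ?N)"
          using o hr ar by (simp add: A.mult_closed A.inv_closed)
        show "i ?N (res A (V x \<inter> V y) ?N (b x y)) = i ?N (inv\<^bsub>sec A ?N\<^esub> (res A (W x) ?N (h x)) \<otimes>\<^bsub>sec A ?N\<^esub> res A
          (U x \<inter> U y) ?N (a x y) \<otimes>\<^bsub>sec A ?N\<^esub> res A (W y) ?N (h y))"
          using o(3) hr ar gr fr
          by (simp add: i.map_mult i.map_inv A.mult_closed A.inv_closed 1 2 4 G.m_assoc G.inv_mult_group)
      qed
    qed
  qed
qed

lemma conn1_eq:
  assumes l: "lift_data s U g a" and s: "s \<in> carrier (sec Q (topspace X))"
  shows "conn1 X A E Q i p s = A.cech_class (U,a)"
proof -
  have "conn1 X A E Q i p s = (THE \<xi>. \<exists>V f b. lift_data s V f b \<and> \<xi> = A.cech_class (V,b))"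
    unfolding conn1_def lift_data_def A.cech_class_def Let_def by (rule arg_cong[where f=The]) (auto simp: fun_eq_iff)
  also have "\<dots> = A.cech_class (U,a)"
  proof (rule the_equality)
    show "\<exists>V f b. lift_data s V f b \<and> A.cech_class (U,a) = A.cech_class (V,b)" using l by blast
    fix \<xi> assume "\<exists>V f b. lift_data s V f b \<and> \<xi> = A.cech_class (V,b)"
    then obtain V f b where v: "lift_data s V f b" "\<xi> = A.cech_class (V,b)" by blast
    have "((U,a),(V,b)) \<in> cohomologous X A" using lift_data_unique[OF l v(1) s] .
    then show "\<xi> = A.cech_class (U,a)" unfolding v A.cech_class_def using equiv_class_eq[OF
      A.cohomologous_equiv] by metis
  qed
  finally show ?thesis .
qed

lemma conn1_closed:
  assumes s: "s \<in> carrier (sec Q (topspace X))"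
  shows "conn1 X A E Q i p s \<in> carrier (cech_H1 X A)"
proof -
  obtain U g a where l: "lift_data s U g a" using lift_data_exists[OF s] by blast
  then have "(U,a) \<in> cocycles X A" unfolding lift_data_def by blast
  then show ?thesis using conn1_eq[OF l s] A.cech_class_closed by simp
qed

end

section \<open>The Godement sheaf and splittings of cocycles\<close>

lemma god0_carrier: "carrier (sec (god0 X F) U) = (\<Pi>\<^sub>E x\<in>U. carrier (stalk X F x))"
  and god0_mult: "\<sigma> \<otimes>\<^bsub>sec (god0 X F) U\<^esub> \<tau> = (\<lambda>x\<in>U. \<sigma> x \<otimes>\<^bsub>stalk X F x\<^esub> \<tau> x)"
  and god0_one: "\<one>\<^bsub>sec (god0 X F) U\<^esub> = (\<lambda>x\<in>U. \<one>\<^bsub>stalk X F x\<^esub>)"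
  and god0_res: "res (god0 X F) U V \<sigma> = restrict \<sigma> V"
  by (simp_all add: god0_def product_group_def)

lemma (in group_presheaf) god0_presheaf: "group_presheaf X (god0 X F)"
proof (rule group_presheaf.intro)
  fix U assume U: "openin X U"
  have g: "\<And>x. x \<in> U \<Longrightarrow> group (stalk X F x)" using st.quot_stalk_group U openin_subset by blast
  then show "group (sec (god0 X F) U)" by (simp add: god0_def)
  fix s assume s: "s \<in> carrier (sec (god0 X F) U)"
  then show "res (god0 X F) U U s = s" by (simp add: god0_carrier god0_res PiE_iff extensional_restrict)
  fix V W assume "openin X V" "openin X W" "W \<subseteq> V" "V \<subseteq> U"
  then show "res (god0 X F) V W (res (god0 X F) U V s) = res (god0 X F) U W s"
    by (simp add: god0_res inf.absorb2)
next
  fix U V assume UV: "openin X U" "openin X V" "V \<subseteq> U"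
  show "res (god0 X F) U V \<in> hom (sec (god0 X F) U) (sec (god0 X F) V)"
    using UV by (auto simp: hom_def god0_res god0_carrier god0_mult fun_eq_iff)
qed

lemma (in group_presheaf) god0_inv:
  assumes U: "openin X U" and s: "\<sigma> \<in> carrier (sec (god0 X F) U)"
  shows "inv\<^bsub>sec (god0 X F) U\<^esub> \<sigma> = (\<lambda>x\<in>U. inv\<^bsub>stalk X F x\<^esub> \<sigma> x)"
proof -
  have g: "\<And>x. x \<in> U \<Longrightarrow> group (stalk X F x)" using st.quot_stalk_group U openin_subset by blast
  show ?thesis using s g unfolding god0_carrier by (simp add: god0_def)
qed

lemma (in normal_presheaf) quot_abelian:
  assumes "abelian_presheaf X F" shows "abelian_presheaf X (quot_sheaf X F K)"
proof (rule abelian_presheaf.intro[OF quot_presheaf abelian_presheaf_axioms.intro])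
  fix U assume U: "openin X U"
  interpret Q: group_presheaf X "quot_sheaf X F K" by (rule quot_presheaf)
  interpret F: abelian_presheaf X F by (rule assms)
  show "comm_group (sec (quot_sheaf X F K) U)"
  proof (rule group.group_comm_groupI[OF Q.sec_group[OF U]])
    fix s t assume s: "s \<in> carrier (sec (quot_sheaf X F K) U)" and t: "t \<in> carrier (sec (quot_sheaf X F K) U)"
    have "s x \<otimes>\<^bsub>quot_stalk X F K x\<^esub> t x = t x \<otimes>\<^bsub>quot_stalk X F K x\<^esub> s x" if x: "x \<in> U" for x
    proof -
      interpret comm_group "quot_stalk X F K x" using quot_stalk_comm F.sec_comm x U openin_subset by blast
      show ?thesis using m_comm quot_sec_val[OF s x] quot_sec_val[OF t x] by blast
    qed
    then show "s \<otimes>\<^bsub>sec (quot_sheaf X F K) U\<^esub> t = t \<otimes>\<^bsub>sec (quot_sheaf X F K) U\<^esub> s"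
      unfolding quot_sec_mult by (rule restrict_ext)
  qed
qed

lemma (in group_presheaf) germ_fun_closed: "\<lbrakk>openin X U; s \<in> carrier (sec F U)\<rbrakk> \<Longrightarrow> quot_proj X F (triv F) U s \<in>
  carrier (sec (god0 X F) U)"
  unfolding god0_carrier by (rule st.quot_proj_PiE)

text \<open>The shape in which germs enter the relation between cohomologous cocycles.\<close>

lemma (in group_presheaf) germ_conj:
  assumes "openin X U" "x \<in> U" "a \<in> carrier (sec F U)" "b \<in> carrier (sec F U)" "c \<in> carrier (sec F U)"
  shows "germ X F x (U, inv\<^bsub>sec F U\<^esub> a \<otimes>\<^bsub>sec F U\<^esub> b \<otimes>\<^bsub>sec F U\<^esub> c) =
    inv\<^bsub>stalk X F x\<^esub> germ X F x (U,a) \<otimes>\<^bsub>stalk X F x\<^esub> germ X F x (U,b) \<otimes>\<^bsub>stalk X F x\<^esub> germ X F x (U,c)"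
  using assms by (simp add: st.coset_germ_mult st.coset_germ_inv mult_closed inv_closed)

lemma (in group_presheaf) cocycle_germ:
  assumes c: "(U,c) \<in> cocycles X F" and t: "x \<in> topspace X" "y \<in> topspace X" "z \<in> topspace X"
    and w: "w \<in> U x" "w \<in> U y" "w \<in> U z"
  shows "germ X F w (U x \<inter> U y, c x y) \<otimes>\<^bsub>stalk X F w\<^esub> germ X F w (U y \<inter> U z, c y z) = germ X F w (U x \<inter> U z, c x z)"
proof -
  note U = cocyclesD(1)[OF c]
  let ?T = "U x \<inter> U y \<inter> U z"
  have o: "openin X ?T" "openin X (U x \<inter> U y)" "openin X (U y \<inter> U z)" "openin X (U x \<inter> U z)"
    using point_cover_open3[OF U t] point_cover_open2[OF U] t by simp_all
  have j: "?T \<subseteq> U x \<inter> U y" "?T \<subseteq> U y \<inter> U z" "?T \<subseteq> U x \<inter> U z" "w \<in> ?T" using w by auto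
  note cc = cocyclesD(2)[OF c t(1,2)] cocyclesD(2)[OF c t(2,3)] cocyclesD(2)[OF c t(1,3)]
  show ?thesis
    unfolding st.coset_germ_res[OF o(2) cc(1) o(1) j(4,1), symmetric] st.coset_germ_res[OF o(3) cc(2) o(1)
      j(4,2), symmetric]
      st.coset_germ_res[OF o(4) cc(3) o(1) j(4,3), symmetric] cocyclesD(3)[OF c t, symmetric]
    using o j cc by (intro st.coset_germ_mult) (simp_all add: res_closed)
qed

context group_presheaf
begin

text \<open>Discontinuous sections \<open>t x\<close> over the sets \<open>U x\<close> whose differences are the germs of the cocycle \<open>c\<close>.\<close>

definition splits :: "('x \<Rightarrow> 'x set) \<Rightarrow> ('x \<Rightarrow> 'x \<Rightarrow> 'a) \<Rightarrow> ('x \<Rightarrow> 'x \<Rightarrow> ('x set \<times> 'a) set) \<Rightarrow> bool" where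
  "splits U c t \<longleftrightarrow> (\<forall>x \<in> topspace X. \<forall>z \<in> U x. t x z \<in> carrier (stalk X F z)) \<and>
     (\<forall>x \<in> topspace X. \<forall>y \<in> topspace X. \<forall>z \<in> U x \<inter> U y.
        inv\<^bsub>stalk X F z\<^esub> (t x z) \<otimes>\<^bsub>stalk X F z\<^esub> t y z = germ X F z (U x \<inter> U y, c x y))"

lemma splitsD:
  assumes "splits U c t"
  shows "\<lbrakk>x \<in> topspace X; z \<in> U x\<rbrakk> \<Longrightarrow> t x z \<in> carrier (stalk X F z)"
    "\<lbrakk>x \<in> topspace X; y \<in> topspace X; z \<in> U x; z \<in> U y\<rbrakk> \<Longrightarrow>
       inv\<^bsub>stalk X F z\<^esub> (t x z) \<otimes>\<^bsub>stalk X F z\<^esub> t y z = germ X F z (U x \<inter> U y, c x y)"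
  using assms unfolding splits_def by auto

text \<open>Every cocycle is split by its own entries: at the point \<open>z\<close> use the entry of index \<open>(z, x)\<close>, which
  is defined near \<open>z\<close> because \<open>z \<in> U z\<close> for coverings indexed by points.\<close>

definition point_split where
  "point_split U c x = (\<lambda>z\<in>U x. germ X F z (U z \<inter> U x, c z x))"

lemma splits_point_split:
  assumes c: "(U,c) \<in> cocycles X F"
  shows "splits U c (point_split U c)"
proof -
  note U = cocyclesD(1)[OF c]
  have top: "z \<in> topspace X" "z \<in> U z" if "x \<in> topspace X" "z \<in> U x" for x z
    using point_cover_open[OF U that(1)] that(2) openin_subset point_cover_mem[OF U] by blast+
  have cl: "germ X F z (U x \<inter> U y, c x y) \<in> carrier (stalk X F z)"
    if "x \<in> topspace X" "y \<in> topspace X" "z \<in> U x" "z \<in> U y" for x y z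
    using st.coset_germ_closed[OF point_cover_open2[OF U that(1,2)] _ cocyclesD(2)[OF c that(1,2)]] that by blast
  show ?thesis unfolding splits_def point_split_def
  proof (intro conjI ballI)
    fix x z assume x: "x \<in> topspace X" and z: "z \<in> U x"
    show "(\<lambda>z\<in>U x. germ X F z (U z \<inter> U x, c z x)) z \<in> carrier (stalk X F z)"
      using cl[OF top(1)[OF x z] x top(2)[OF x z] z] z by simp
  next
    fix x y z assume x: "x \<in> topspace X" and y: "y \<in> topspace X" and z: "z \<in> U x \<inter> U y"
    have zx: "z \<in> U x" "z \<in> U y" using z by auto
    note zt = top[OF x zx(1)]
    interpret group "stalk X F z" using st.quot_stalk_group zt by blast
    show "inv\<^bsub>stalk X F z\<^esub> ((\<lambda>z\<in>U x. germ X F z (U z \<inter> U x, c z x)) z) \<otimes>\<^bsub>stalk X F z\<^esub>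
        (\<lambda>z\<in>U y. germ X F z (U z \<inter> U y, c z y)) z = germ X F z (U x \<inter> U y, c x y)"
      using cl[OF zt(1) x zt(2) zx(1)] cl[OF x y zx] zx by (simp flip: cocycle_germ[OF c zt(1) x y zt(2) zx])
  qed
qed

text \<open>Splittings of cohomologous cocycles are related by one discontinuous section over the whole space,
  because the expression below does not depend on the index.\<close>

lemma splits_transition:
  assumes t: "splits U c t" and s: "splits V d s"
    and cc: "(U,c) \<in> cocycles X F" "(V,d) \<in> cocycles X F"
    and W: "point_cover X W" "\<And>x. x \<in> topspace X \<Longrightarrow> W x \<subseteq> U x" "\<And>x. x \<in> topspace X \<Longrightarrow> W x \<subseteq> V x"
      "\<And>x. x \<in> topspace X \<Longrightarrow> h x \<in> carrier (sec F (W x))" "cobound W h (cochain_res F U W c) (cochain_res F V W d)"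
    and x: "x \<in> topspace X" "z \<in> W x" and y: "y \<in> topspace X" "z \<in> W y"
  shows "t x z \<otimes>\<^bsub>stalk X F z\<^esub> germ X F z (W x, h x) \<otimes>\<^bsub>stalk X F z\<^esub> inv\<^bsub>stalk X F z\<^esub> (s x z) =
    t y z \<otimes>\<^bsub>stalk X F z\<^esub> germ X F z (W y, h y) \<otimes>\<^bsub>stalk X F z\<^esub> inv\<^bsub>stalk X F z\<^esub> (s y z)"
proof -
  note U = cocyclesD(1)[OF cc(1)] and V = cocyclesD(1)[OF cc(2)]
  let ?N = "W x \<inter> W y"
  have o: "openin X ?N" "openin X (W x)" "openin X (W y)" "openin X (U x \<inter> U y)" "openin X (V x \<inter> V y)"
    using W(1) U V x y by (simp_all add: point_cover_open point_cover_open2)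
  have j: "z \<in> ?N" "?N \<subseteq> W x" "?N \<subseteq> W y" "?N \<subseteq> U x \<inter> U y" "?N \<subseteq> V x \<inter> V y"
    using x(2) y(2) W(2,3)[OF x(1)] W(2,3)[OF y(1)] by blast+
  have zU: "z \<in> U x" "z \<in> U y" "z \<in> V x" "z \<in> V y" and zt: "z \<in> topspace X"
    using j openin_subset[OF o(1)] by auto
  interpret group "stalk X F z" using st.quot_stalk_group[OF zt] .
  have hr: "res F (W x) ?N (h x) \<in> carrier (sec F ?N)" "res F (W y) ?N (h y) \<in> carrier (sec F ?N)"
    using res_closed[OF o(2,1) j(2) W(4)[OF x(1)]] res_closed[OF o(3,1) j(3) W(4)[OF y(1)]] .
  have "germ X F z (?N, cochain_res F V W d x y) = inv\<^bsub>stalk X F z\<^esub> germ X F z (?N, res F (W x) ?N (h x))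
    \<otimes>\<^bsub>stalk X F z\<^esub>
      germ X F z (?N, cochain_res F U W c x y) \<otimes>\<^bsub>stalk X F z\<^esub> germ X F z (?N, res F (W y) ?N (h y))"
    using germ_conj[OF o(1) j(1) hr(1) cochain_res_closed[OF cc(1) W(1,2) x(1) y(1)] hr(2)] W(5) x y
    unfolding cobound_def by simp
  then have e: "inv\<^bsub>stalk X F z\<^esub> (s x z) \<otimes>\<^bsub>stalk X F z\<^esub> s y z = inv\<^bsub>stalk X F z\<^esub> germ X F z (W x, h x) \<otimes>\<^bsub>stalk X F z\<^esub>
      (inv\<^bsub>stalk X F z\<^esub> (t x z) \<otimes>\<^bsub>stalk X F z\<^esub> t y z) \<otimes>\<^bsub>stalk X F z\<^esub> germ X F z (W y, h y)"
    unfolding cochain_res_def st.coset_germ_res[OF o(5) cocyclesD(2)[OF cc(2) x(1) y(1)] o(1) j(1,5)]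
      st.coset_germ_res[OF o(4) cocyclesD(2)[OF cc(1) x(1) y(1)] o(1) j(1,4)]
      st.coset_germ_res[OF o(2) W(4)[OF x(1)] o(1) j(1,2)] st.coset_germ_res[OF o(3) W(4)[OF y(1)] o(1) j(1,3)]
      splitsD(2)[OF t x(1) y(1) zU(1,2)] splitsD(2)[OF s x(1) y(1) zU(3,4)] .
  note cl = splitsD(1)[OF t x(1) zU(1)] splitsD(1)[OF t y(1) zU(2)] splitsD(1)[OF s x(1) zU(3)] splitsD(1)[OF s
    y(1) zU(4)]
    st.coset_germ_closed[OF o(2) x(2) W(4)[OF x(1)]] st.coset_germ_closed[OF o(3) y(2) W(4)[OF y(1)]]
  have "t x z \<otimes>\<^bsub>stalk X F z\<^esub> germ X F z (W x, h x) \<otimes>\<^bsub>stalk X F z\<^esub> inv\<^bsub>stalk X F z\<^esub> (s x z) \<otimes>\<^bsub>stalk X F z\<^esub> s y z =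
      t x z \<otimes>\<^bsub>stalk X F z\<^esub> germ X F z (W x, h x) \<otimes>\<^bsub>stalk X F z\<^esub> (inv\<^bsub>stalk X F z\<^esub> (s x z) \<otimes>\<^bsub>stalk X F z\<^esub> s y z)"
    using cl by (simp add: m_assoc)
  also have "\<dots> = t y z \<otimes>\<^bsub>stalk X F z\<^esub> germ X F z (W y, h y)" unfolding e using cl by (simp add: m_assoc)
  finally show ?thesis using cl inv_solve_right by simp
qed

end

context abelian_presheaf
begin

lemma stalk_comm: "x \<in> topspace X \<Longrightarrow> comm_group (stalk X F x)"
  using st.quot_stalk_comm sec_comm by blast

lemma god0_abelian: "abelian_presheaf X (god0 X F)"
proof (rule abelian_presheaf.intro[OF god0_presheaf abelian_presheaf_axioms.intro])
  fix U assume U: "openin X U"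
  show "comm_group (sec (god0 X F) U)"
  proof (rule group.group_comm_groupI[OF group_presheaf.sec_group[OF god0_presheaf U]])
    fix s t assume s: "s \<in> carrier (sec (god0 X F) U)" and t: "t \<in> carrier (sec (god0 X F) U)"
    have "s x \<otimes>\<^bsub>stalk X F x\<^esub> t x = t x \<otimes>\<^bsub>stalk X F x\<^esub> s x" if x: "x \<in> U" for x
    proof -
      interpret comm_group "stalk X F x" using stalk_comm x U openin_subset by blast
      show ?thesis using m_comm s t x unfolding god0_carrier by (meson PiE_mem)
    qed
    then show "s \<otimes>\<^bsub>sec (god0 X F) U\<^esub> t = t \<otimes>\<^bsub>sec (god0 X F) U\<^esub> s"
      unfolding god0_mult by (rule restrict_ext)
  qed
qed

lemma god_normal: "normal_presheaf X (god0 X F) (god_img X F)"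
proof (rule normal_presheaf.intro[OF god0_presheaf normal_presheaf_axioms.intro])
  interpret G: abelian_presheaf X "god0 X F" by (rule god0_abelian)
  fix U assume U: "openin X U"
  have UX: "U \<subseteq> topspace X" using U openin_subset by blast
  have h: "group_hom (sec F U) (sec (god0 X F) U) (quot_proj X F (triv F) U)"
  proof (rule group_hom.intro[OF sec_group[OF U] G.sec_group[OF U] group_hom_axioms.intro], rule homI)
    fix s t assume s: "s \<in> carrier (sec F U)" and t: "t \<in> carrier (sec F U)"
    show "quot_proj X F (triv F) U s \<in> carrier (sec (god0 X F) U)" using germ_fun_closed[OF U s] .
    show "quot_proj X F (triv F) U (s \<otimes>\<^bsub>sec F U\<^esub> t) = quot_proj X F (triv F) U s \<otimes>\<^bsub>sec (god0 X F) U\<^esub> quot_proj X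
      F (triv F) U t"
      unfolding st.quot_proj_mult[OF U s t] st.quot_sec_mult god0_mult ..
  qed
  have "subgroup (god_img X F U) (sec (god0 X F) U)"
    unfolding god_img_def using group_hom.img_is_subgroup[OF h] .
  then show "god_img X F U \<lhd> sec (god0 X F) U" using comm_group.subgroup_imp_normal[OF G.sec_comm[OF U]] by blast
next
  fix U V s assume "openin X U" "openin X V" "V \<subseteq> U" "s \<in> god_img X F U"
  then show "res (god0 X F) U V s \<in> god_img X F V"
    unfolding god_img_def god0_res using st.quot_proj_res res_closed by auto
qed

end

sublocale abelian_presheaf \<subseteq> god: normal_presheaf X "god0 X F" "god_img X F"
  by (rule god_normal)

context abelian_presheaf
begin

lemma god_Z_abelian: "abelian_presheaf X (god_Z X F)"
  unfolding god_Z_def using god.quot_abelian god0_abelian by auto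

lemma god_Z_res: "res (god_Z X F) U V \<sigma> = restrict \<sigma> V"
  unfolding god_Z_def by (rule god.quot_res)

abbreviation god_proj where "god_proj \<equiv> quot_proj X (god0 X F) (god_img X F)"
abbreviation god_germ where "god_germ \<equiv> coset_germ X (god0 X F) (god_img X F)"

text \<open>The test by which classes of local choices are seen to glue: the choices may differ by a section of
  \<open>F\<close>.\<close>

lemma god_germ_eqI:
  assumes V: "openin X V" "s \<in> carrier (sec (god0 X F) V)" and V': "openin X V'" "s' \<in> carrier (sec (god0 X F) V')"
    and W: "openin X W" "w \<in> W" "W \<subseteq> V" "W \<subseteq> V'" and r: "r \<in> carrier (sec F W)"
    and eq: "\<And>z. z \<in> W \<Longrightarrow> s z = germ X F z (W,r) \<otimes>\<^bsub>stalk X F z\<^esub> s' z"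
  shows "god_germ w (V,s) = god_germ w (V',s')"
proof -
  have "res (god0 X F) V W s \<otimes>\<^bsub>sec (god0 X F) W\<^esub> inv\<^bsub>sec (god0 X F) W\<^esub> (res (god0 X F) V' W s') = quot_proj X F
    (triv F) W r"
  proof -
    have s': "restrict s' W \<in> carrier (sec (god0 X F) W)" using god.res_closed[OF V'(1) W(1,4) V'(2)] unfolding
      god0_res .
    have "s z \<otimes>\<^bsub>stalk X F z\<^esub> inv\<^bsub>stalk X F z\<^esub> (s' z) = germ X F z (W,r)" if z: "z \<in> W" for z
    proof -
      interpret group "stalk X F z" using st.quot_stalk_group z W openin_subset by blast
      have "s' z \<in> carrier (stalk X F z)" using V'(2) z W unfolding god0_carrier by blast
      moreover have "germ X F z (W,r) \<in> carrier (stalk X F z)" using st.coset_germ_closed W z r by blast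
      ultimately show ?thesis unfolding eq[OF z] by (simp add: m_assoc)
    qed
    then show ?thesis unfolding god0_res god0_inv[OF W(1) s'] god0_mult quot_proj_def
      by (intro restrict_ext) simp
  qed
  then have "res (god0 X F) V W s \<otimes>\<^bsub>sec (god0 X F) W\<^esub> inv\<^bsub>sec (god0 X F) W\<^esub> (res (god0 X F) V' W s') \<in> god_img X F W"
    using r unfolding god_img_def by simp
  then show ?thesis using god.coset_germ_eq_iff[OF V(1) _ V(2) V'(1) _ V'(2)] W by blast
qed

text \<open>The data in the definition of \<open>cech_to_god\<close>: a splitting \<open>t\<close> of the cocycle \<open>c\<close> and the global
  section \<open>\<sigma>\<close> of \<open>C\<^sup>0(F)/F\<close> glued from the classes of the \<open>t x\<close>.\<close>

definition god_splitting where
  "god_splitting U c t \<sigma> \<longleftrightarrow> (\<forall>x \<in> topspace X. t x \<in> carrier (sec (god0 X F) (U x))) \<and>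
     (\<forall>x \<in> topspace X. \<forall>y \<in> topspace X. \<forall>z \<in> U x \<inter> U y.
        inv\<^bsub>stalk X F z\<^esub> (t x z) \<otimes>\<^bsub>stalk X F z\<^esub> t y z = germ X F z (U x \<inter> U y, c x y)) \<and>
     \<sigma> \<in> carrier (sheaf_H0 X (god_Z X F)) \<and>
     (\<forall>x \<in> topspace X. restrict \<sigma> (U x) = god_proj (U x) (t x))"

text \<open>The classes of the \<open>t x\<close> agree on overlaps since \<open>t x\<close> and \<open>t y\<close> differ by the section
  \<open>c x y\<close> of \<open>F\<close>.\<close>

lemma god_splitting_exists:
  assumes c: "(U,c) \<in> cocycles X F"
  shows "\<exists>t \<sigma>. god_splitting U c t \<sigma>"
proof -
  note U = cocyclesD(1)[OF c]
  let ?t = "point_split U c"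
  note sp = splits_point_split[OF c]
  have t: "?t x \<in> carrier (sec (god0 X F) (U x))" if "x \<in> topspace X" for x
    unfolding god0_carrier using splitsD(1)[OF sp that] by (simp add: PiE_iff point_split_def)
  have oT: "openin X (topspace X)" by simp
  obtain \<sigma> where s: "\<sigma> \<in> carrier (sec (quot_sheaf X (god0 X F) (god_img X F)) (topspace X))"
    "\<And>V s. \<lbrakk>openin X V; V \<subseteq> topspace X; s \<in> carrier (sec (god0 X F) V); \<exists>x \<in> topspace X. V = U x \<and> s = ?t x\<rbrakk> \<Longrightarrow>
      restrict \<sigma> V = god_proj V s"
  proof (rule god.quot_glue[OF oT, of "\<lambda>V s. \<exists>x \<in> topspace X. V = U x \<and> s = ?t x"])
    fix x assume x: "x \<in> topspace X"
    show "\<exists>V s. openin X V \<and> x \<in> V \<and> V \<subseteq> topspace X \<and> s \<in> carrier (sec (god0 X F) V) \<and> (\<exists>x \<in> topspace X. V = U x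
      \<and> s = ?t x)"
      using x U t[OF x] by (intro exI[of _ "U x"] exI[of _ "?t x"]) (auto simp: point_cover_def dest: openin_subset)
  next
    fix V s V' s' w assume V: "openin X V" "s \<in> carrier (sec (god0 X F) V)" and V': "openin X V'" "s' \<in> carrier
      (sec (god0 X F) V')"
      and R: "\<exists>x \<in> topspace X. V = U x \<and> s = ?t x" and R': "\<exists>x \<in> topspace X. V' = U x \<and> s' = ?t x" and w: "w \<in>
        V" "w \<in> V'"
    obtain x where x: "x \<in> topspace X" "V = U x" "s = ?t x" using R by blast
    obtain y where y: "y \<in> topspace X" "V' = U y" "s' = ?t y" using R' by blast
    have o: "openin X (U x \<inter> U y)" using point_cover_open2[OF U x(1) y(1)] .
    note cxy = cocyclesD(2)[OF c x(1) y(1)]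
    show "god_germ w (V,s) = god_germ w (V',s')"
    proof (rule god_germ_eqI[OF V V' o])
      show "inv\<^bsub>sec F (U x \<inter> U y)\<^esub> c x y \<in> carrier (sec F (U x \<inter> U y))" using inv_closed[OF o cxy] .
      fix z assume z: "z \<in> U x \<inter> U y"
      have zt: "z \<in> topspace X" using openin_subset[OF o] z by blast
      interpret comm_group "stalk X F z" using stalk_comm zt by blast
      have 1: "germ X F z (U x \<inter> U y, inv\<^bsub>sec F (U x \<inter> U y)\<^esub> c x y) = inv\<^bsub>stalk X F z\<^esub> (germ X F z (U x \<inter> U y, c
        x y))"
        using st.coset_germ_inv[OF o z cxy] by simp
      have 2: "?t x z \<in> carrier (stalk X F z)" "?t y z \<in> carrier (stalk X F z)" using t[OF x(1)] t[OF y(1)] z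
        unfolding god0_carrier by auto
      show "s z = germ X F z (U x \<inter> U y, inv\<^bsub>sec F (U x \<inter> U y)\<^esub> c x y) \<otimes>\<^bsub>stalk X F z\<^esub> s' z"
        unfolding 1 x y using splitsD(2)[OF sp x(1) y(1), of z, symmetric] z 2 by (simp add: inv_mult m_assoc)
    qed (use w x y in auto)
  qed blast
  have "god_splitting U c ?t \<sigma>" unfolding god_splitting_def god_Z_def
    using t sp[unfolded splits_def] s(1) s(2)[OF point_cover_open[OF U] openin_subset[OF point_cover_open[OF U]]
      t] by blast
  then show ?thesis by blast
qed

lemma god_B1_subgroup: "subgroup (god_B1 X F) (sheaf_H0 X (god_Z X F))"
proof -
  interpret Z: abelian_presheaf X "god_Z X F" by (rule god_Z_abelian)
  have "group_hom (sheaf_H0 X (god0 X F)) (sheaf_H0 X (god_Z X F)) (god_proj (topspace X))"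
  proof (rule group_hom.intro[OF god.sec_group[OF openin_topspace] Z.sec_group[OF openin_topspace]
    group_hom_axioms.intro], rule homI)
    fix s t assume s: "s \<in> carrier (sheaf_H0 X (god0 X F))" and t: "t \<in> carrier (sheaf_H0 X (god0 X F))"
    show "god_proj (topspace X) s \<in> carrier (sheaf_H0 X (god_Z X F))" unfolding god_Z_def using
      god.quot_proj_closed[OF openin_topspace s] .
    show "god_proj (topspace X) (s \<otimes>\<^bsub>sheaf_H0 X (god0 X F)\<^esub> t) = god_proj (topspace X) s \<otimes>\<^bsub>sheaf_H0 X (god_Z X
      F)\<^esub> god_proj (topspace X) t"
      unfolding god_Z_def using god.quot_proj_mult[OF openin_topspace s t] .
  qed
  then show ?thesis unfolding god_B1_def using group_hom.img_is_subgroup by blast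
qed

lemma god_B1_normal: "god_B1 X F \<lhd> sheaf_H0 X (god_Z X F)"
  using comm_group.subgroup_imp_normal[OF abelian_presheaf.sec_comm[OF god_Z_abelian openin_topspace]
    god_B1_subgroup] .

lemma god_H1_comm_group: "comm_group (god_H1 X F)"
  unfolding god_H1_def
  using comm_group.abelian_FactGroup[OF abelian_presheaf.sec_comm[OF god_Z_abelian openin_topspace] god_B1_subgroup] .

text \<open>For cohomologous cocycles the transition section between the two splittings is a global section of
  \<open>C\<^sup>0(F)\<close>, so the two global sections of \<open>C\<^sup>0(F)/F\<close> differ by an element of \<open>god_B1\<close>.\<close>

lemma god_splitting_unique:
  assumes d: "god_splitting U c t \<sigma>" and d': "god_splitting V d s \<tau>" and cd: "((U,c),(V,d)) \<in> cohomologous X F"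
  shows "god_B1 X F #>\<^bsub>sheaf_H0 X (god_Z X F)\<^esub> \<sigma> = god_B1 X F #>\<^bsub>sheaf_H0 X (god_Z X F)\<^esub> \<tau>"
proof -
  obtain W h where W: "(U,c) \<in> cocycles X F" "(V,d) \<in> cocycles X F" "point_cover X W"
      "\<And>x. x \<in> topspace X \<Longrightarrow> W x \<subseteq> U x" "\<And>x. x \<in> topspace X \<Longrightarrow> W x \<subseteq> V x"
      "\<And>x. x \<in> topspace X \<Longrightarrow> h x \<in> carrier (sec F (W x))"
      "cobound W h (cochain_res F U W c) (cochain_res F V W d)"
    using cd unfolding cohomologous_iff by blast
  note U = cocyclesD(1)[OF W(1)] and V = cocyclesD(1)[OF W(2)]
  have t: "\<And>x. x \<in> topspace X \<Longrightarrow> t x \<in> carrier (sec (god0 X F) (U x))"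
     "\<And>x y z. \<lbrakk>x \<in> topspace X; y \<in> topspace X; z \<in> U x; z \<in> U y\<rbrakk> \<Longrightarrow>
        inv\<^bsub>stalk X F z\<^esub> (t x z) \<otimes>\<^bsub>stalk X F z\<^esub> t y z = germ X F z (U x \<inter> U y, c x y)"
     "\<sigma> \<in> carrier (sheaf_H0 X (god_Z X F))" "\<And>x. x \<in> topspace X \<Longrightarrow> restrict \<sigma> (U x) = god_proj (U x) (t x)"
    using d unfolding god_splitting_def by blast+
  have s: "\<And>x. x \<in> topspace X \<Longrightarrow> s x \<in> carrier (sec (god0 X F) (V x))"
     "\<And>x y z. \<lbrakk>x \<in> topspace X; y \<in> topspace X; z \<in> V x; z \<in> V y\<rbrakk> \<Longrightarrow>
        inv\<^bsub>stalk X F z\<^esub> (s x z) \<otimes>\<^bsub>stalk X F z\<^esub> s y z = germ X F z (V x \<inter> V y, d x y)"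
     "\<tau> \<in> carrier (sheaf_H0 X (god_Z X F))" "\<And>x. x \<in> topspace X \<Longrightarrow> restrict \<tau> (V x) = god_proj (V x) (s x)"
    using d' unfolding god_splitting_def by blast+
  have sp: "splits U c t" "splits V d s"
    using d d' t(1) s(1) unfolding god_splitting_def splits_def god0_carrier by (auto simp: PiE_iff)
  have tc: "t x z \<in> carrier (stalk X F z)" "s x z \<in> carrier (stalk X F z)" "germ X F z (W x, h x) \<in> carrier
    (stalk X F z)"
    if "x \<in> topspace X" "z \<in> W x" for x z
    using splitsD(1)[OF sp(1) that(1)] splitsD(1)[OF sp(2) that(1)] W(4,5)[OF that(1)] that(2)
      st.coset_germ_closed[OF point_cover_open[OF W(3) that(1)] that(2) W(6)[OF that(1)]] by auto
  let ?T = "\<lambda>x z. t x z \<otimes>\<^bsub>stalk X F z\<^esub> germ X F z (W x, h x) \<otimes>\<^bsub>stalk X F z\<^esub> inv\<^bsub>stalk X F z\<^esub> (s x z)"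
  \<comment> \<open>The two splittings differ by the transition section \<open>?T\<close>, which does not depend on the
    index; evaluating it with the point itself as index makes it a global discontinuous section.\<close>
  define \<rho> where "\<rho> = (\<lambda>z\<in>topspace X. inv\<^bsub>stalk X F z\<^esub> (?T z z))"
  have key: "s x z = germ X F z (W x, h x) \<otimes>\<^bsub>stalk X F z\<^esub> (\<rho> z \<otimes>\<^bsub>stalk X F z\<^esub> t x z)"
    if x: "x \<in> topspace X" and z: "z \<in> W x" for x z
  proof -
    have zt: "z \<in> topspace X" using z openin_subset[OF point_cover_open[OF W(3) x]] by blast
    interpret comm_group "stalk X F z" using stalk_comm zt by blast
    have "\<rho> z = inv\<^bsub>stalk X F z\<^esub> (?T x z)"
      unfolding \<rho>_def using splits_transition[OF sp W x z zt point_cover_mem[OF W(3) zt]] zt by simp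
    then show ?thesis using tc[OF x z] by (simp add: inv_mult m_ac)
  qed
  have rc: "\<rho> \<in> carrier (sec (god0 X F) (topspace X))"
  proof -
    have "inv\<^bsub>stalk X F z\<^esub> (?T z z) \<in> carrier (stalk X F z)" if z: "z \<in> topspace X" for z
    proof -
      interpret group "stalk X F z" using st.quot_stalk_group z by blast
      show ?thesis using tc[OF z point_cover_mem[OF W(3) z]] by simp
    qed
    then show ?thesis unfolding \<rho>_def god0_carrier by simp
  qed
  interpret Z: abelian_presheaf X "god_Z X F" by (rule god_Z_abelian)
  interpret HZ: comm_group "sheaf_H0 X (god_Z X F)" using Z.sec_comm[OF openin_topspace] .
  have bB: "god_proj (topspace X) \<rho> \<in> god_B1 X F" using rc unfolding god_B1_def by blast
  then have bc: "god_proj (topspace X) \<rho> \<in> carrier (sheaf_H0 X (god_Z X F))" using subgroup.subset[OF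
    god_B1_subgroup] by blast
  have "\<tau> = god_proj (topspace X) \<rho> \<otimes>\<^bsub>sheaf_H0 X (god_Z X F)\<^esub> \<sigma>"
  proof (rule god.quot_sec_eqI[OF s(3)[unfolded god_Z_def]])
    show "god_proj (topspace X) \<rho> \<otimes>\<^bsub>sheaf_H0 X (god_Z X F)\<^esub> \<sigma> \<in> carrier (sec (quot_sheaf X (god0 X F) (god_img X
      F)) (topspace X))"
      using HZ.m_closed[OF bc t(3)] unfolding god_Z_def .
    fix z assume z: "z \<in> topspace X"
    note zW = point_cover_mem[OF W(3) z]
    have o: "openin X (W z)" "openin X (U z)" "openin X (V z)" "openin X (topspace X)" using W(3) U V z by
      (simp_all add: point_cover_open)
    have j: "z \<in> U z" "z \<in> V z" "W z \<subseteq> topspace X" using zW W(4,5)[OF z] o(1) openin_subset by blast+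
    have "\<tau> z = god_germ z (V z, s z)" using fun_cong[OF s(4)[OF z], of z] j unfolding quot_proj_def by simp
    also have "\<dots> = god_germ z (W z, res (god0 X F) (topspace X) (W z) \<rho> \<otimes>\<^bsub>sec (god0 X F) (W z)\<^esub> res (god0 X F)
      (U z) (W z) (t z))"
    proof (rule god_germ_eqI[OF o(3) s(1)[OF z] o(1) _ o(1) zW W(5)[OF z] order_refl W(6)[OF z]])
      show "res (god0 X F) (topspace X) (W z) \<rho> \<otimes>\<^bsub>sec (god0 X F) (W z)\<^esub> res (god0 X F) (U z) (W z) (t z) \<in>
        carrier (sec (god0 X F) (W z))"
        using god.mult_closed god.res_closed o j rc t(1)[OF z] W(4)[OF z] by blast
      fix y assume "y \<in> W z"
      then show "s z y = germ X F y (W z, h z) \<otimes>\<^bsub>stalk X F y\<^esub> (res (god0 X F) (topspace X) (W z) \<rho> \<otimes>\<^bsub>sec (god0 X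
        F) (W z)\<^esub> res (god0 X F) (U z) (W z) (t z)) y"
        using key[OF z, of y] by (simp add: god0_mult god0_res)
    qed
    also have "\<dots> = god_germ z (topspace X, \<rho>) \<otimes>\<^bsub>quot_stalk X (god0 X F) (god_img X F) z\<^esub> god_germ z (U z, t z)"
      using god.coset_germ_mult[OF o(1) zW god.res_closed[OF o(4,1) j(3) rc] god.res_closed[OF o(2,1) W(4)[OF z]
        t(1)[OF z]]]
        god.coset_germ_res[OF o(4) rc o(1) zW j(3)] god.coset_germ_res[OF o(2) t(1)[OF z] o(1) zW W(4)[OF z]] by simp
    also have "\<dots> = (god_proj (topspace X) \<rho> \<otimes>\<^bsub>sheaf_H0 X (god_Z X F)\<^esub> \<sigma>) z"
    proof -
      have "\<sigma> z = god_germ z (U z, t z)" using fun_cong[OF t(4)[OF z], of z] j unfolding quot_proj_def by simp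
      then show ?thesis unfolding god_Z_def god.quot_sec_mult using z by (simp add: quot_proj_def)
    qed
    finally show "\<tau> z = (god_proj (topspace X) \<rho> \<otimes>\<^bsub>sheaf_H0 X (god_Z X F)\<^esub> \<sigma>) z" .
  qed
  then have "god_B1 X F #>\<^bsub>sheaf_H0 X (god_Z X F)\<^esub> \<tau> = (god_B1 X F #>\<^bsub>sheaf_H0 X (god_Z X F)\<^esub> god_proj (topspace
    X) \<rho>) #>\<^bsub>sheaf_H0 X (god_Z X F)\<^esub> \<sigma>"
    using HZ.coset_mult_assoc[OF subgroup.subset[OF god_B1_subgroup] bc t(3)] by simp
  also have "\<dots> = god_B1 X F #>\<^bsub>sheaf_H0 X (god_Z X F)\<^esub> \<sigma>"
    using HZ.coset_join2[OF bc god_B1_subgroup bB] by simp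
  finally show ?thesis by simp
qed

lemma cech_to_god_eq:
  assumes d: "god_splitting U c t \<sigma>" and c: "(U,c) \<in> cocycles X F"
  shows "cech_to_god X F (cech_class (U,c)) = god_B1 X F #>\<^bsub>sheaf_H0 X (god_Z X F)\<^esub> \<sigma>"
proof -
  have "cech_to_god X F (cech_class (U,c)) = (THE \<eta>. \<exists>V d s \<tau>. (V,d) \<in> cech_class (U,c) \<and> god_splitting V d s \<tau>
    \<and> \<eta> = god_B1 X F #>\<^bsub>sheaf_H0 X (god_Z X F)\<^esub> \<tau>)"
    unfolding cech_to_god_def god_splitting_def god_Z_res conj_assoc ..
  also have "\<dots> = god_B1 X F #>\<^bsub>sheaf_H0 X (god_Z X F)\<^esub> \<sigma>"
  proof (rule the_equality)
    show "\<exists>V d s \<tau>. (V,d) \<in> cech_class (U,c) \<and> god_splitting V d s \<tau> \<and> god_B1 X F #>\<^bsub>sheaf_H0 X (god_Z X F)\<^esub> \<sigma> =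
      god_B1 X F #>\<^bsub>sheaf_H0 X (god_Z X F)\<^esub> \<tau>"
      using cech_class_mem[OF c] d by blast
    fix \<eta> assume "\<exists>V d s \<tau>. (V,d) \<in> cech_class (U,c) \<and> god_splitting V d s \<tau> \<and> \<eta> = god_B1 X F #>\<^bsub>sheaf_H0 X
      (god_Z X F)\<^esub> \<tau>"
    then obtain V d s \<tau> where v: "(V,d) \<in> cech_class (U,c)" "god_splitting V d s \<tau>" "\<eta> = god_B1 X F #>\<^bsub>sheaf_H0
      X (god_Z X F)\<^esub> \<tau>" by blast
    have "((U,c),(V,d)) \<in> cohomologous X F" using v(1) unfolding cech_class_def by blast
    then show "\<eta> = god_B1 X F #>\<^bsub>sheaf_H0 X (god_Z X F)\<^esub> \<sigma>" using god_splitting_unique[OF d v(2)] v(3) by simp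
  qed
  finally show ?thesis .
qed

lemma god_splitting_mult:
  assumes d: "god_splitting W c t \<sigma>" and d': "god_splitting W d s \<tau>" and cc: "(W,c) \<in> cocycles X F" "(W,d) \<in>
    cocycles X F"
  shows "god_splitting W (cochain_mult W c d) (\<lambda>x. t x \<otimes>\<^bsub>sec (god0 X F) (W x)\<^esub> s x) (\<sigma> \<otimes>\<^bsub>sheaf_H0 X (god_Z X F)\<^esub> \<tau>)"
proof -
  note W = cocyclesD(1)[OF cc(1)]
  have t: "\<And>x. x \<in> topspace X \<Longrightarrow> t x \<in> carrier (sec (god0 X F) (W x))"
     "\<And>x y z. \<lbrakk>x \<in> topspace X; y \<in> topspace X; z \<in> W x; z \<in> W y\<rbrakk> \<Longrightarrow>
        inv\<^bsub>stalk X F z\<^esub> (t x z) \<otimes>\<^bsub>stalk X F z\<^esub> t y z = germ X F z (W x \<inter> W y, c x y)"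
     "\<sigma> \<in> carrier (sheaf_H0 X (god_Z X F))" "\<And>x. x \<in> topspace X \<Longrightarrow> restrict \<sigma> (W x) = god_proj (W x) (t x)"
    using d unfolding god_splitting_def by blast+
  have s: "\<And>x. x \<in> topspace X \<Longrightarrow> s x \<in> carrier (sec (god0 X F) (W x))"
     "\<And>x y z. \<lbrakk>x \<in> topspace X; y \<in> topspace X; z \<in> W x; z \<in> W y\<rbrakk> \<Longrightarrow>
        inv\<^bsub>stalk X F z\<^esub> (s x z) \<otimes>\<^bsub>stalk X F z\<^esub> s y z = germ X F z (W x \<inter> W y, d x y)"
     "\<tau> \<in> carrier (sheaf_H0 X (god_Z X F))" "\<And>x. x \<in> topspace X \<Longrightarrow> restrict \<tau> (W x) = god_proj (W x) (s x)"
    using d' unfolding god_splitting_def by blast+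
  interpret Z: abelian_presheaf X "god_Z X F" by (rule god_Z_abelian)
  show ?thesis unfolding god_splitting_def
  proof (intro conjI ballI)
    fix x assume x: "x \<in> topspace X"
    have o: "openin X (W x)" "W x \<subseteq> topspace X" using point_cover_open[OF W x] openin_subset by auto
    show "t x \<otimes>\<^bsub>sec (god0 X F) (W x)\<^esub> s x \<in> carrier (sec (god0 X F) (W x))"
      using god.mult_closed o t(1) s(1) x by blast
    have "restrict (\<sigma> \<otimes>\<^bsub>sheaf_H0 X (god_Z X F)\<^esub> \<tau>) (W x) = restrict \<sigma> (W x) \<otimes>\<^bsub>sec (god_Z X F) (W x)\<^esub> restrict \<tau> (W x)"
      using Z.res_mult[OF openin_topspace o t(3) s(3)] unfolding god_Z_res .
    then show "restrict (\<sigma> \<otimes>\<^bsub>sheaf_H0 X (god_Z X F)\<^esub> \<tau>) (W x) = god_proj (W x) (t x \<otimes>\<^bsub>sec (god0 X F) (W x)\<^esub> s x)"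
      unfolding t(4)[OF x] s(4)[OF x] god.quot_proj_mult[OF o(1) t(1)[OF x] s(1)[OF x]] god_Z_def .
  next
    show "\<sigma> \<otimes>\<^bsub>sheaf_H0 X (god_Z X F)\<^esub> \<tau> \<in> carrier (sheaf_H0 X (god_Z X F))"
      using Z.mult_closed[OF openin_topspace t(3) s(3)] .
  next
    fix x y z assume x: "x \<in> topspace X" and y: "y \<in> topspace X" and z: "z \<in> W x \<inter> W y"
    have o: "openin X (W x \<inter> W y)" using point_cover_open2[OF W x y] .
    then have zt: "z \<in> topspace X" using z openin_subset by blast
    interpret comm_group "stalk X F z" using stalk_comm zt by blast
    have cl: "t x z \<in> carrier (stalk X F z)" "t y z \<in> carrier (stalk X F z)" "s x z \<in> carrier (stalk X F z)" "s
      y z \<in> carrier (stalk X F z)"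
      using t(1)[OF x] t(1)[OF y] s(1)[OF x] s(1)[OF y] z unfolding god0_carrier by auto
    have "germ X F z (W x \<inter> W y, cochain_mult W c d x y) = (inv\<^bsub>stalk X F z\<^esub> (t x z) \<otimes>\<^bsub>stalk X F z\<^esub> t y z)
      \<otimes>\<^bsub>stalk X F z\<^esub> (inv\<^bsub>stalk X F z\<^esub> (s x z) \<otimes>\<^bsub>stalk X F z\<^esub> s y z)"
      unfolding cochain_mult_def st.coset_germ_mult[OF o z cocyclesD(2)[OF cc(1) x y] cocyclesD(2)[OF cc(2) x
        y], symmetric]
      using t(2)[OF x y] s(2)[OF x y] z by simp
    then show "inv\<^bsub>stalk X F z\<^esub> ((t x \<otimes>\<^bsub>sec (god0 X F) (W x)\<^esub> s x) z) \<otimes>\<^bsub>stalk X F z\<^esub> (t y \<otimes>\<^bsub>sec (god0 X F) (W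
      y)\<^esub> s y) z = germ X F z (W x \<inter> W y, cochain_mult W c d x y)"
      using cl z by (simp add: god0_mult inv_mult m_ac)
  qed
qed

lemma cech_to_god_hom: "cech_to_god X F \<in> hom (cech_H1 X F) (god_H1 X F)"
proof (rule homI)
  fix A B assume AB: "A \<in> carrier (cech_H1 X F)" "B \<in> carrier (cech_H1 X F)"
  obtain W c d where c: "(W,c) \<in> cocycles X F" "(W,d) \<in> cocycles X F" "A = cech_class (W,c)" "B = cech_class (W,d)"
    using cech_cases2[OF AB] by blast
  obtain t \<sigma> where t: "god_splitting W c t \<sigma>" using god_splitting_exists[OF c(1)] by blast
  obtain s \<tau> where s: "god_splitting W d s \<tau>" using god_splitting_exists[OF c(2)] by blast
  have st: "\<sigma> \<in> carrier (sheaf_H0 X (god_Z X F))" "\<tau> \<in> carrier (sheaf_H0 X (god_Z X F))" using s t unfolding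
    god_splitting_def by auto
  interpret B: normal "god_B1 X F" "sheaf_H0 X (god_Z X F)" by (rule god_B1_normal)
  show "cech_to_god X F A \<in> carrier (god_H1 X F)"
    unfolding c(3) cech_to_god_eq[OF t c(1)] god_H1_def carrier_FactGroup using st by blast
  show "cech_to_god X F (A \<otimes>\<^bsub>cech_H1 X F\<^esub> B) = cech_to_god X F A \<otimes>\<^bsub>god_H1 X F\<^esub> cech_to_god X F B"
    unfolding c(3,4) cech_mult[OF c(1,2)] cech_to_god_eq[OF t c(1)] cech_to_god_eq[OF s c(2)]
      cech_to_god_eq[OF god_splitting_mult[OF t s c(1,2)] cochain_mult_cocycle[OF c(1,2)]] god_H1_def
        mult_FactGroup B.rcos_sum[OF st] ..
qed

end

section \<open>Central extensions and the defect\<close>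

context exact_seq
begin

lemma lift_dataD:
  assumes "lift_data s U g a"
  shows "(U, a) \<in> cocycles X A"
    "\<And>x. x \<in> topspace X \<Longrightarrow> g x \<in> carrier (sec E (U x))" "\<And>x. x \<in> topspace X \<Longrightarrow> p (U x) (g x) = res Q (topspace X)
      (U x) s"
    "\<And>x y. \<lbrakk>x \<in> topspace X; y \<in> topspace X\<rbrakk> \<Longrightarrow> i (U x \<inter> U y) (a x y) =
        inv\<^bsub>sec E (U x \<inter> U y)\<^esub> (res E (U x) (U x \<inter> U y) (g x)) \<otimes>\<^bsub>sec E (U x \<inter> U y)\<^esub> res E (U y) (U x \<inter> U y) (g y)"
  using assms unfolding lift_data_def by blast+

lemma lift_data_res:
  assumes l: "lift_data s U g a" and s: "s \<in> carrier (sec Q (topspace X))"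
    and W: "point_cover X W" "\<And>x. x \<in> topspace X \<Longrightarrow> W x \<subseteq> U x"
  shows "lift_data s W (\<lambda>x. res E (U x) (W x) (g x)) (cochain_res A U W a)"
proof (rule lift_data_if[OF W(1)])
  note g = lift_dataD[OF l]
  note U = cocyclesD(1)[OF g(1)]
  show "\<And>x y. x \<in> topspace X \<Longrightarrow> y \<in> topspace X \<Longrightarrow> cochain_res A U W a x y \<in> carrier (sec A (W x \<inter> W y))"
    by (rule A.cochain_res_closed[OF g(1) W])
  fix x assume x: "x \<in> topspace X"
  have ox: "openin X (W x)" "openin X (U x)" using U W(1) x by (simp_all add: point_cover_open)
  show "res E (U x) (W x) (g x) \<in> carrier (sec E (W x))" using E.res_closed[OF ox(2,1) W(2)[OF x] g(2)[OF x]] .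
  show "p (W x) (res E (U x) (W x) (g x)) = res Q (topspace X) (W x) s"
    using p.map_res[OF ox(2,1) W(2)[OF x] g(2)[OF x]] g(3)[OF x] Q.res_res[OF openin_topspace ox(2,1) W(2)[OF x]
      openin_subset[OF ox(2)] s] by simp
  fix y assume y: "y \<in> topspace X"
  have oy: "openin X (W y)" "openin X (U y)" using U W(1) y by (simp_all add: point_cover_open)
  have o: "openin X (W x \<inter> W y)" "openin X (U x \<inter> U y)" using ox oy by auto
  have j: "W x \<inter> W y \<subseteq> U x \<inter> U y" "W x \<inter> W y \<subseteq> U x" "W x \<inter> W y \<subseteq> U y" using W(2)[OF x] W(2)[OF y] by auto
  show "i (W x \<inter> W y) (cochain_res A U W a x y) = inv\<^bsub>sec E (W x \<inter> W y)\<^esub> (res E (W x) (W x \<inter> W y) (res E (U x)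
    (W x) (g x))) \<otimes>\<^bsub>sec E (W x \<inter> W y)\<^esub>
     res E (W y) (W x \<inter> W y) (res E (U y) (W y) (g y))"
    unfolding cochain_res_def i.map_res[OF o(2,1) j(1) cocyclesD(2)[OF g(1) x y], symmetric] g(4)[OF x y]
    using ox oy o j W(2)[OF x] W(2)[OF y] g(2)[OF x] g(2)[OF y]
    by (simp add: E.res_mult E.res_inv E.res_res E.res_closed E.inv_closed)
qed

lemma stalk_I_inj:
  assumes x: "x \<in> topspace X" and a: "a \<in> carrier (stalk X A x)" and e: "stalk_map X E i x a = \<one>\<^bsub>stalk X E x\<^esub>"
  shows "a = \<one>\<^bsub>stalk X A x\<^esub>"
proof -
  obtain U s where U: "openin X U" "x \<in> U" "s \<in> carrier (sec A U)" "a = germ X A x (U,s)"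
    using A.st.quot_stalk_cases[OF a] .
  have "germ X E x (U, i U s) = germ X E x (U, \<one>\<^bsub>sec E U\<^esub>)"
    using e i.stalk_map_germ[OF U(1-3)] E.st.coset_germ_one[OF U(1,2)] U(4) by simp
  then obtain W where W: "openin X W" "x \<in> W" "W \<subseteq> U" "res E U W (i U s) = res E U W \<one>\<^bsub>sec E U\<^esub>"
    using E.germ_eq_iff[OF U(1,2) i.map_closed[OF U(1,3)] U(1,2) E.one_closed[OF U(1)]] by blast
  then have "i W (res A U W s) = \<one>\<^bsub>sec E W\<^esub>" using i.map_res[OF U(1) W(1,3) U(3)] E.res_one[OF U(1) W(1,3)] by simp
  then have "res A U W s = \<one>\<^bsub>sec A W\<^esub>" using i_inj1[OF W(1) A.res_closed[OF U(1) W(1,3) U(3)]] by blast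
  then show ?thesis using A.st.coset_germ_res[OF U(1,3) W(1,2,3)] A.st.coset_germ_one[OF W(1,2)] U(4) by simp
qed

lemma stalk_I_injD:
  assumes x: "x \<in> topspace X" and "a \<in> carrier (stalk X A x)" "b \<in> carrier (stalk X A x)" "stalk_map X E i x a =
    stalk_map X E i x b"
  shows "a = b"
  using group_hom.inj_on_one_iff[OF i.stalk_map_group_hom[OF x]] stalk_I_inj[OF x] assms by (metis inj_onD)

lemma stalk_exact:
  assumes x: "x \<in> topspace X" and a: "a \<in> carrier (stalk X E x)" and e: "stalk_map X Q p x a = \<one>\<^bsub>stalk X Q x\<^esub>"
  shows "\<exists>b \<in> carrier (stalk X A x). stalk_map X E i x b = a"
proof -
  obtain U s where U: "openin X U" "x \<in> U" "s \<in> carrier (sec E U)" "a = germ X E x (U,s)"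
    using E.st.quot_stalk_cases[OF a] .
  have "germ X Q x (U, p U s) = germ X Q x (U, \<one>\<^bsub>sec Q U\<^esub>)"
    using e p.stalk_map_germ[OF U(1-3)] Q.st.coset_germ_one[OF U(1,2)] U(4) by simp
  then obtain W where W: "openin X W" "x \<in> W" "W \<subseteq> U" "res Q U W (p U s) = res Q U W \<one>\<^bsub>sec Q U\<^esub>"
    using Q.germ_eq_iff[OF U(1,2) p.map_closed[OF U(1,3)] U(1,2) Q.one_closed[OF U(1)]] by blast
  then have "p W (res E U W s) = \<one>\<^bsub>sec Q W\<^esub>" using p.map_res[OF U(1) W(1,3) U(3)] Q.res_one[OF U(1) W(1,3)] by simp
  then obtain r where r: "r \<in> carrier (sec A W)" "i W r = res E U W s" using exact[OF W(1) E.res_closed[OF U(1)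
    W(1,3) U(3)]] by blast
  show ?thesis
    using A.st.coset_germ_closed[OF W(1,2) r(1)] i.stalk_map_germ[OF W(1,2) r(1)] E.st.coset_germ_res[OF U(1,3)
      W(1,2,3)] U(4) r(2) by auto
qed

lemma stalk_P_I:
  assumes x: "x \<in> topspace X" and a: "a \<in> carrier (stalk X A x)"
  shows "stalk_map X Q p x (stalk_map X E i x a) = \<one>\<^bsub>stalk X Q x\<^esub>"
proof -
  obtain U s where U: "openin X U" "x \<in> U" "s \<in> carrier (sec A U)" "a = germ X A x (U,s)"
    using A.st.quot_stalk_cases[OF a] .
  then show ?thesis by (simp add: i.stalk_map_germ p.stalk_map_germ i.map_closed p_i Q.st.coset_germ_one[OF U(1,2)])
qed

lemma stalk_P_surj:
  assumes x: "x \<in> topspace X" and a: "q \<in> carrier (stalk X Q x)"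
  shows "\<exists>e \<in> carrier (stalk X E x). stalk_map X Q p x e = q"
proof -
  obtain U s where U: "openin X U" "x \<in> U" "s \<in> carrier (sec Q U)" "q = germ X Q x (U,s)"
    using Q.st.quot_stalk_cases[OF a] .
  obtain V g where V: "openin X V" "x \<in> V" "V \<subseteq> U" "g \<in> carrier (sec E V)" "p V g = res Q U V s"
    using locally_surj[OF U(1,3,2)] by blast
  show ?thesis
    using E.st.coset_germ_closed[OF V(1,2,4)] p.stalk_map_germ[OF V(1,2,4)] Q.st.coset_germ_res[OF U(1,3)
      V(1,2,3)] U(4) V(5) by auto
qed

end

text \<open>Here \<open>A\<close> is a sheaf of abelian groups in the centre of \<open>E\<close>, while \<open>E\<close> and \<open>Q\<close> may be
  nonabelian.\<close>

locale central_seq = exact_seq X A E Q i p + Ab: abelian_presheaf X A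
  for X :: "'x topology" and A :: "('x, 'a) sheaf" and E :: "('x, 'e) sheaf" and Q :: "('x, 'q) sheaf" and i p +
  assumes central: "\<lbrakk>openin X U; a \<in> carrier (sec A U); s \<in> carrier (sec E U)\<rbrakk> \<Longrightarrow>
    i U a \<otimes>\<^bsub>sec E U\<^esub> s = s \<otimes>\<^bsub>sec E U\<^esub> i U a"
begin

text \<open>Since the values of \<open>a\<close> are central,
  \<open>(g x f x)\<inverse> g y f y = (f x)\<inverse> ((g x)\<inverse> g y) f y\<close> is the product of the two differences.\<close>

lemma lift_data_mult:
  assumes l: "lift_data s W g a" and l': "lift_data s' W f b" and s: "s \<in> carrier (sec Q (topspace X))" "s' \<in>
    carrier (sec Q (topspace X))"
  shows "lift_data (s \<otimes>\<^bsub>sec Q (topspace X)\<^esub> s') W (\<lambda>x. g x \<otimes>\<^bsub>sec E (W x)\<^esub> f x) (A.cochain_mult W a b)"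
proof -
  note g = lift_dataD[OF l] and f = lift_dataD[OF l']
  note W = cocyclesD(1)[OF g(1)]
  show ?thesis
  proof (rule lift_data_if[OF W])
    show "\<And>x y. x \<in> topspace X \<Longrightarrow> y \<in> topspace X \<Longrightarrow> A.cochain_mult W a b x y \<in> carrier (sec A (W x \<inter> W y))"
      by (rule Ab.cochain_mult_closed[OF g(1) f(1)])
    fix x assume x: "x \<in> topspace X"
    have ox: "openin X (W x)" "W x \<subseteq> topspace X" using point_cover_open[OF W x] openin_subset by auto
    show "g x \<otimes>\<^bsub>sec E (W x)\<^esub> f x \<in> carrier (sec E (W x))" using E.mult_closed[OF ox(1) g(2)[OF x] f(2)[OF x]] .
    show "p (W x) (g x \<otimes>\<^bsub>sec E (W x)\<^esub> f x) = res Q (topspace X) (W x) (s \<otimes>\<^bsub>sec Q (topspace X)\<^esub> s')"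
      unfolding p.map_mult[OF ox(1) g(2)[OF x] f(2)[OF x]] Q.res_mult[OF openin_topspace ox s] g(3)[OF x]
        f(3)[OF x] ..
    fix y assume y: "y \<in> topspace X"
    have oy: "openin X (W y)" using point_cover_open[OF W y] .
    let ?N = "W x \<inter> W y"
    have o: "openin X ?N" "?N \<subseteq> W x" "?N \<subseteq> W y" using ox oy by auto
    interpret G: group "sec E ?N" using E.sec_group o by blast
    note gr = E.res_closed[OF ox(1) o(1,2) g(2)[OF x]] E.res_closed[OF oy o(1,3) g(2)[OF y]]
    note fr = E.res_closed[OF ox(1) o(1,2) f(2)[OF x]] E.res_closed[OF oy o(1,3) f(2)[OF y]]
    note ca = cocyclesD(2)[OF g(1) x y] and cb = cocyclesD(2)[OF f(1) x y]
    have "i ?N (A.cochain_mult W a b x y) = i ?N (a x y) \<otimes>\<^bsub>sec E ?N\<^esub> i ?N (b x y)"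
      unfolding A.cochain_mult_def i.map_mult[OF o(1) ca cb] ..
    also have "\<dots> = i ?N (a x y) \<otimes>\<^bsub>sec E ?N\<^esub> inv\<^bsub>sec E ?N\<^esub> (res E (W x) ?N (f x)) \<otimes>\<^bsub>sec E ?N\<^esub> res E (W y) ?N (f y)"
      unfolding f(4)[OF x y] using fr i.map_closed[OF o(1) ca] by (simp add: G.m_assoc)
    also have "i ?N (a x y) \<otimes>\<^bsub>sec E ?N\<^esub> inv\<^bsub>sec E ?N\<^esub> (res E (W x) ?N (f x)) = inv\<^bsub>sec E ?N\<^esub> (res E (W x) ?N (f
      x)) \<otimes>\<^bsub>sec E ?N\<^esub> i ?N (a x y)"
      using central[OF o(1) ca] fr by simp
    finally show "i ?N (A.cochain_mult W a b x y) = inv\<^bsub>sec E ?N\<^esub> (res E (W x) ?N (g x \<otimes>\<^bsub>sec E (W x)\<^esub> f x))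
      \<otimes>\<^bsub>sec E ?N\<^esub> res E (W y) ?N (g y \<otimes>\<^bsub>sec E (W y)\<^esub> f y)"
      unfolding E.res_mult[OF ox(1) o(1,2) g(2)[OF x] f(2)[OF x]] E.res_mult[OF oy o(1,3) g(2)[OF y] f(2)[OF y]]
        g(4)[OF x y]
      using gr fr by (simp add: G.m_assoc G.inv_mult_group)
  qed
qed

lemma conn1_hom: "conn1 X A E Q i p \<in> hom (sheaf_H0 X Q) (cech_H1 X A)"
proof (rule homI)
  fix s t assume s: "s \<in> carrier (sheaf_H0 X Q)" and t: "t \<in> carrier (sheaf_H0 X Q)"
  show "conn1 X A E Q i p s \<in> carrier (cech_H1 X A)" using conn1_closed[OF s] .
  obtain U g a where l: "lift_data s U g a" using lift_data_exists[OF s] by blast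
  obtain V f b where l': "lift_data t V f b" using lift_data_exists[OF t] by blast
  note U = cocyclesD(1)[OF lift_dataD(1)[OF l]] and V = cocyclesD(1)[OF lift_dataD(1)[OF l']]
  let ?W = "\<lambda>x. U x \<inter> V x"
  have W: "point_cover X ?W" using point_cover_Int U V .
  have m: "lift_data s ?W (\<lambda>x. res E (U x) (?W x) (g x)) (cochain_res A U ?W a)"
    by (rule lift_data_res[OF l s W]) auto
  have m': "lift_data t ?W (\<lambda>x. res E (V x) (?W x) (f x)) (cochain_res A V ?W b)"
    by (rule lift_data_res[OF l' t W]) auto
  show "conn1 X A E Q i p (s \<otimes>\<^bsub>sheaf_H0 X Q\<^esub> t) = conn1 X A E Q i p s \<otimes>\<^bsub>cech_H1 X A\<^esub> conn1 X A E Q i p t"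
    unfolding conn1_eq[OF m s] conn1_eq[OF m' t] conn1_eq[OF lift_data_mult[OF m m' s t] Q.mult_closed[OF
      openin_topspace s t]]
      Ab.cech_mult[OF lift_dataD(1)[OF m] lift_dataD(1)[OF m']] ..
qed

lemma stalk_central:
  assumes x: "x \<in> topspace X" and a: "a \<in> carrier (stalk X A x)" and e: "e \<in> carrier (stalk X E x)"
  shows "stalk_map X E i x a \<otimes>\<^bsub>stalk X E x\<^esub> e = e \<otimes>\<^bsub>stalk X E x\<^esub> stalk_map X E i x a"
proof -
  obtain U s where U: "openin X U" "x \<in> U" "s \<in> carrier (sec A U)" "a = germ X A x (U,s)"
    using A.st.quot_stalk_cases[OF a] .
  obtain V g where V: "openin X V" "x \<in> V" "V \<subseteq> U" "g \<in> carrier (sec E V)" "e = germ X E x (V,g)"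
    using E.st.quot_stalk_cases_in[OF e U(1,2)] .
  have r: "res A U V s \<in> carrier (sec A V)" using A.res_closed[OF U(1) V(1,3) U(3)] .
  have "a = germ X A x (V, res A U V s)" using A.st.coset_germ_res[OF U(1,3) V(1,2,3)] U(4) by simp
  then show ?thesis using V r
    by (simp add: i.stalk_map_germ E.st.coset_germ_mult i.map_closed central)
qed

text \<open>A factorization \<open>e = \<alpha> \<gamma>\<close> over \<open>N\<close> with \<open>\<gamma>\<close> a section of \<open>E\<close> and \<open>\<alpha>\<close> a discontinuous
  section of \<open>A\<close>.\<close>

definition local_defect where
  "local_defect e N \<gamma> \<alpha> \<longleftrightarrow> \<gamma> \<in> carrier (sec E N) \<and> \<alpha> \<in> carrier (sec (god0 X A) N) \<and>
     (\<forall>w\<in>N. stalk_map X E i w (\<alpha> w) \<otimes>\<^bsub>stalk X E w\<^esub> germ X E w (N,\<gamma>) = e w)"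

text \<open>The section \<open>\<tau>\<close> of \<open>C\<^sup>0(A)/A\<close> that is locally the class of \<open>\<alpha>\<close> for some factorization
  \<open>e = \<alpha> \<gamma>\<close>. A relation, because only those \<open>e\<close> have a defect whose image in \<open>Q\<close> is locally a section.\<close>

definition defect where
  "defect V e \<tau> \<longleftrightarrow> \<tau> \<in> carrier (sec (god_Z X A) V) \<and>
     (\<forall>z\<in>V. \<exists>N \<gamma> \<alpha>. openin X N \<and> z \<in> N \<and> N \<subseteq> V \<and> local_defect e N \<gamma> \<alpha> \<and> restrict \<tau> N = Ab.god_proj N \<alpha>)"

lemma local_defect_res:
  assumes t: "local_defect e N \<gamma> \<alpha>" and o: "openin X N" "openin X M" "M \<subseteq> N"
  shows "local_defect e M (res E N M \<gamma>) (restrict \<alpha> M)"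
proof -
  have a: "\<gamma> \<in> carrier (sec E N)" "\<alpha> \<in> carrier (sec (god0 X A) N)" using t unfolding local_defect_def by auto
  have "germ X E w (M, res E N M \<gamma>) = germ X E w (N,\<gamma>)" if "w \<in> M" for w
    using E.st.coset_germ_res[OF o(1) a(1) o(2) that o(3)] .
  moreover have "restrict \<alpha> M \<in> carrier (sec (god0 X A) M)"
    using Ab.god.res_closed[OF o a(2)] unfolding god0_res .
  ultimately show ?thesis using t o E.res_closed[OF o a(1)] unfolding local_defect_def by (simp add: subset_iff)
qed

text \<open>Both \<open>\<gamma>\<close> lift the same section of \<open>Q\<close>, so they differ by a section of \<open>A\<close>; this section is central
  and hence is also the difference of the two \<open>\<alpha>\<close>.\<close>

lemma local_defect_compare_same:
  assumes t: "local_defect e N \<gamma> \<alpha>" and t': "local_defect e N \<gamma>' \<alpha>'" and o: "openin X N" "w \<in> N"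
  shows "Ab.god_germ w (N,\<alpha>) = Ab.god_germ w (N,\<alpha>')"
proof -
  have g: "\<gamma> \<in> carrier (sec E N)" "\<gamma>' \<in> carrier (sec E N)" using t t' unfolding local_defect_def by auto
  have a: "\<alpha> \<in> carrier (sec (god0 X A) N)" "\<alpha>' \<in> carrier (sec (god0 X A) N)" using t t' unfolding
    local_defect_def by auto
  have NX: "N \<subseteq> topspace X" using o openin_subset by blast
  have ac: "\<alpha> z \<in> carrier (stalk X A z)" "\<alpha>' z \<in> carrier (stalk X A z)" if "z \<in> N" for z
    using a that unfolding god0_carrier by auto
  have gc: "germ X E z (N,\<gamma>) \<in> carrier (stalk X E z)" "germ X E z (N,\<gamma>') \<in> carrier (stalk X E z)" if "z \<in> N" for z
    using E.st.coset_germ_closed o that g by auto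
  have eq: "stalk_map X E i z (\<alpha> z) \<otimes>\<^bsub>stalk X E z\<^esub> germ X E z (N,\<gamma>) = stalk_map X E i z (\<alpha>' z) \<otimes>\<^bsub>stalk X E z\<^esub>
    germ X E z (N,\<gamma>')" if "z \<in> N" for z
    using t t' that unfolding local_defect_def by simp
  \<comment> \<open>Discontinuous sections of \<open>A\<close> die in \<open>Q\<close>, so both lifts have the same image there and differ
    by a section \<open>r\<close> of \<open>A\<close>; moving \<open>r\<close> across \<open>\<gamma>\<close> uses centrality.\<close>
  have "p N \<gamma> = p N \<gamma>'"
  proof (rule Q.separated[OF o(1) p.map_closed[OF o(1) g(1)] p.map_closed[OF o(1) g(2)]])
    fix z assume z: "z \<in> N"
    have zt: "z \<in> topspace X" using z NX by blast
    interpret P: group_hom "stalk X E z" "stalk X Q z" "stalk_map X Q p z" using p.stalk_map_group_hom[OF zt] .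
    have "stalk_map X Q p z (germ X E z (N,\<gamma>)) = stalk_map X Q p z (germ X E z (N,\<gamma>'))"
      using arg_cong[OF eq[OF z], of "stalk_map X Q p z"] stalk_P_I[OF zt] ac[OF z] gc[OF z]
        i.stalk_map_closed[OF zt] by simp
    then show "germ X Q z (N, p N \<gamma>) = germ X Q z (N, p N \<gamma>')" using o z g by (simp add: p.stalk_map_germ)
  qed
  then obtain r where r: "r \<in> carrier (sec A N)" "i N r = inv\<^bsub>sec E N\<^esub> \<gamma> \<otimes>\<^bsub>sec E N\<^esub> \<gamma>'"
    using p_eq_imp[OF o(1) g] by blast
  show ?thesis
  proof (rule Ab.god_germ_eqI[OF o(1) a(1) o(1) a(2) o order_refl order_refl r(1)])
    fix z assume z: "z \<in> N"
    have zt: "z \<in> topspace X" using z NX by blast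
    interpret Az: group "stalk X A z" using A.st.quot_stalk_group zt by blast
    interpret I: group_hom "stalk X A z" "stalk X E z" "stalk_map X E i z" using i.stalk_map_group_hom[OF zt] .
    have rz: "germ X A z (N,r) \<in> carrier (stalk X A z)" using A.st.coset_germ_closed o z r by blast
    have Ir: "stalk_map X E i z (germ X A z (N,r)) = inv\<^bsub>stalk X E z\<^esub> germ X E z (N,\<gamma>) \<otimes>\<^bsub>stalk X E z\<^esub> germ X E z
      (N,\<gamma>')"
      using o z g r by (simp add: i.stalk_map_germ E.st.coset_germ_mult E.st.coset_germ_inv E.inv_closed)
    show "\<alpha> z = germ X A z (N,r) \<otimes>\<^bsub>stalk X A z\<^esub> \<alpha>' z"
    proof (rule stalk_I_injD[OF zt])
      have "germ X E z (N,\<gamma>) \<otimes>\<^bsub>stalk X E z\<^esub> stalk_map X E i z (germ X A z (N,r)) = germ X E z (N,\<gamma>')"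
        unfolding Ir using gc[OF z] by simp
      then have "germ X E z (N,\<gamma>') = stalk_map X E i z (germ X A z (N,r)) \<otimes>\<^bsub>stalk X E z\<^esub> germ X E z (N,\<gamma>)"
        using stalk_central[OF zt rz gc(1)[OF z]] by simp
      then have "stalk_map X E i z (\<alpha> z) \<otimes>\<^bsub>stalk X E z\<^esub> germ X E z (N,\<gamma>) =
          (stalk_map X E i z (\<alpha>' z) \<otimes>\<^bsub>stalk X E z\<^esub> stalk_map X E i z (germ X A z (N,r))) \<otimes>\<^bsub>stalk X E z\<^esub> germ X E
            z (N,\<gamma>)"
        using eq[OF z] ac[OF z] rz gc[OF z] by (simp add: I.H.m_assoc)
      then have "stalk_map X E i z (\<alpha> z) = stalk_map X E i z (\<alpha>' z) \<otimes>\<^bsub>stalk X E z\<^esub> stalk_map X E i z (germ X A z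
        (N,r))"
        using ac[OF z] rz gc[OF z] by simp
      then show "stalk_map X E i z (\<alpha> z) = stalk_map X E i z (germ X A z (N,r) \<otimes>\<^bsub>stalk X A z\<^esub> \<alpha>' z)"
        using stalk_central[OF zt rz, of "stalk_map X E i z (\<alpha>' z)"] ac[OF z] rz by simp
    qed (use ac[OF z] rz in auto)
  qed
qed

lemma local_defect_compare:
  assumes t: "local_defect e N \<gamma> \<alpha>" and t': "local_defect e N' \<gamma>' \<alpha>'" and o: "openin X N" "w \<in> N" "openin X N'"
    "w \<in> N'"
  shows "Ab.god_germ w (N,\<alpha>) = Ab.god_germ w (N',\<alpha>')"
proof -
  have M: "openin X (N \<inter> N')" "w \<in> N \<inter> N'" "N \<inter> N' \<subseteq> N" "N \<inter> N' \<subseteq> N'" using o by auto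
  have a: "\<alpha> \<in> carrier (sec (god0 X A) N)" "\<alpha>' \<in> carrier (sec (god0 X A) N')" using t t' unfolding
    local_defect_def by auto
  have "Ab.god_germ w (N \<inter> N', restrict \<alpha> (N \<inter> N')) = Ab.god_germ w (N \<inter> N', restrict \<alpha>' (N \<inter> N'))"
    by (rule local_defect_compare_same[OF local_defect_res[OF t o(1) M(1,3)] local_defect_res[OF t' o(3) M(1,4)]
      M(1,2)])
  then show ?thesis
    using Ab.god.coset_germ_res[OF o(1) a(1) M(1,2,3)] Ab.god.coset_germ_res[OF o(3) a(2) M(1,2,4)] unfolding
      god0_res by simp
qed

lemma defect_unique:
  assumes V: "openin X V" and t: "defect V e \<tau>" "defect V f \<upsilon>" and ef: "\<And>z. z \<in> V \<Longrightarrow> e z = f z"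
  shows "\<tau> = \<upsilon>"
proof (rule Ab.god.quot_sec_eqI)
  show "\<tau> \<in> carrier (sec (quot_sheaf X (god0 X A) (god_img X A)) V)" "\<upsilon> \<in> carrier (sec (quot_sheaf X (god0 X A)
    (god_img X A)) V)"
    using t unfolding defect_def god_Z_def by auto
  fix z assume z: "z \<in> V"
  obtain N \<gamma> \<alpha> where N: "openin X N" "z \<in> N" "N \<subseteq> V" "local_defect e N \<gamma> \<alpha>" "restrict \<tau> N = Ab.god_proj N \<alpha>"
    using t(1) z unfolding defect_def by blast
  obtain M \<delta> \<beta> where M: "openin X M" "z \<in> M" "M \<subseteq> V" "local_defect f M \<delta> \<beta>" "restrict \<upsilon> M = Ab.god_proj M \<beta>"
    using t(2) z unfolding defect_def by blast
  have "local_defect e M \<delta> \<beta>" using M(3,4) ef unfolding local_defect_def by (simp add: subset_iff)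
  then have "Ab.god_germ z (N,\<alpha>) = Ab.god_germ z (M,\<beta>)" using local_defect_compare N M by blast
  moreover have "\<tau> z = Ab.god_germ z (N,\<alpha>)" "\<upsilon> z = Ab.god_germ z (M,\<beta>)"
    using fun_cong[OF N(5), of z] fun_cong[OF M(5), of z] N(2) M(2) unfolding quot_proj_def by auto
  ultimately show "\<tau> z = \<upsilon> z" by simp
qed

lemma defect_cong: "\<lbrakk>defect V e \<tau>; \<And>z. z \<in> V \<Longrightarrow> e z = f z\<rbrakk> \<Longrightarrow> defect V f \<tau>"
  unfolding defect_def local_defect_def by (simp add: subset_iff) metis

lemma defect_res:
  assumes t: "defect V e \<tau>" and o: "openin X V" "openin X W" "W \<subseteq> V"
  shows "defect W e (restrict \<tau> W)"
  unfolding defect_def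
proof (intro conjI ballI)
  interpret Z: abelian_presheaf X "god_Z X A" by (rule Ab.god_Z_abelian)
  have tc: "\<tau> \<in> carrier (sec (god_Z X A) V)" using t unfolding defect_def by blast
  show "restrict \<tau> W \<in> carrier (sec (god_Z X A) W)" using Z.res_closed[OF o tc] unfolding Ab.god_Z_res .
  fix z assume z: "z \<in> W"
  then obtain N \<gamma> \<alpha> where N: "openin X N" "z \<in> N" "N \<subseteq> V" "local_defect e N \<gamma> \<alpha>" "restrict \<tau> N = Ab.god_proj N \<alpha>"
    using t o unfolding defect_def by blast
  have M: "openin X (N \<inter> W)" "N \<inter> W \<subseteq> N" using N o by auto
  have a: "\<alpha> \<in> carrier (sec (god0 X A) N)" using N unfolding local_defect_def by auto
  have "restrict (restrict \<tau> W) (N \<inter> W) = restrict (restrict \<tau> N) (N \<inter> W)" by (auto simp: fun_eq_iff)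
  also have "\<dots> = Ab.god_proj (N \<inter> W) (restrict \<alpha> (N \<inter> W))"
    unfolding N(5) Ab.god.quot_proj_res[OF N(1) M a] god0_res ..
  finally show "\<exists>N \<gamma> \<alpha>. openin X N \<and> z \<in> N \<and> N \<subseteq> W \<and> local_defect e N \<gamma> \<alpha> \<and> restrict (restrict \<tau> W) N =
    Ab.god_proj N \<alpha>"
    using local_defect_res[OF N(4,1) M] M N(2) z by blast
qed

text \<open>Divide \<open>e\<close> by a local lift \<open>\<gamma>\<close> of the section \<open>q\<close>; the quotient dies in the stalks of \<open>Q\<close> and so
  comes from \<open>A\<close>.\<close>

lemma defect_exists:
  assumes V: "openin X V" and e: "\<And>w. w \<in> V \<Longrightarrow> e w \<in> carrier (stalk X E w)"
    and q: "q \<in> carrier (sec Q V)" "\<And>w. w \<in> V \<Longrightarrow> stalk_map X Q p w (e w) = germ X Q w (V,q)"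
  shows "\<exists>\<tau>. defect V e \<tau>"
proof -
  have VX: "V \<subseteq> topspace X" using V openin_subset by blast
  have ex: "\<exists>N \<alpha>. openin X N \<and> z \<in> N \<and> N \<subseteq> V \<and> \<alpha> \<in> carrier (sec (god0 X A) N) \<and> (\<exists>\<gamma>. local_defect e N \<gamma> \<alpha>)" if
    z: "z \<in> V" for z
  proof -
    obtain N \<gamma> where N: "openin X N" "z \<in> N" "N \<subseteq> V" "\<gamma> \<in> carrier (sec E N)" "p N \<gamma> = res Q V N q"
      using locally_surj[OF V q(1) z] by blast
    have "\<exists>a. a \<in> carrier (stalk X A w) \<and> stalk_map X E i w a \<otimes>\<^bsub>stalk X E w\<^esub> germ X E w (N,\<gamma>) = e w" if w: "w \<in>
      N" for w
    proof -
      have wV: "w \<in> V" and wt: "w \<in> topspace X" using w N VX by auto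
      interpret P: group_hom "stalk X E w" "stalk X Q w" "stalk_map X Q p w" using p.stalk_map_group_hom[OF wt] .
      have g: "germ X E w (N,\<gamma>) \<in> carrier (stalk X E w)" using E.st.coset_germ_closed N w by blast
      have "stalk_map X Q p w (germ X E w (N,\<gamma>)) = stalk_map X Q p w (e w)"
        unfolding q(2)[OF wV] p.stalk_map_germ[OF N(1) w N(4)] N(5) using Q.st.coset_germ_res[OF V q(1) N(1) w N(3)] .
      then have "stalk_map X Q p w (e w \<otimes>\<^bsub>stalk X E w\<^esub> inv\<^bsub>stalk X E w\<^esub> germ X E w (N,\<gamma>)) = \<one>\<^bsub>stalk X Q w\<^esub>"
        using e[OF wV] g by simp
      then obtain a where "a \<in> carrier (stalk X A w)" "stalk_map X E i w a = e w \<otimes>\<^bsub>stalk X E w\<^esub> inv\<^bsub>stalk X E w\<^esub>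
        germ X E w (N,\<gamma>)"
        using stalk_exact[OF wt] e[OF wV] g by (meson P.G.inv_closed P.G.m_closed)
      then show ?thesis using e[OF wV] g by (intro exI[of _ a]) (simp add: P.G.m_assoc)
    qed
    then obtain a where a: "\<And>w. w \<in> N \<Longrightarrow> a w \<in> carrier (stalk X A w) \<and> stalk_map X E i w (a w) \<otimes>\<^bsub>stalk X E w\<^esub>
      germ X E w (N,\<gamma>) = e w" by metis
    have "restrict a N \<in> carrier (sec (god0 X A) N)" using a unfolding god0_carrier by simp
    moreover from this have "local_defect e N \<gamma> (restrict a N)" using a N unfolding local_defect_def by simp
    ultimately show ?thesis using N by blast
  qed
  obtain \<tau> where \<tau>: "\<tau> \<in> carrier (sec (quot_sheaf X (god0 X A) (god_img X A)) V)"
    "\<And>N \<alpha>. \<lbrakk>openin X N; N \<subseteq> V; \<alpha> \<in> carrier (sec (god0 X A) N); \<exists>\<gamma>. local_defect e N \<gamma> \<alpha>\<rbrakk> \<Longrightarrow> restrict \<tau> N =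
      Ab.god_proj N \<alpha>"
  proof (rule Ab.god.quot_glue[OF V, of "\<lambda>N \<alpha>. \<exists>\<gamma>. local_defect e N \<gamma> \<alpha>"])
    show "\<And>x. x \<in> V \<Longrightarrow> \<exists>N \<alpha>. openin X N \<and> x \<in> N \<and> N \<subseteq> V \<and> \<alpha> \<in> carrier (sec (god0 X A) N) \<and> (\<exists>\<gamma>. local_defect e N
      \<gamma> \<alpha>)" by (rule ex)
    show "\<And>N \<alpha> N' \<alpha>' w. \<lbrakk>openin X N; N \<subseteq> V; \<alpha> \<in> carrier (sec (god0 X A) N); \<exists>\<gamma>. local_defect e N \<gamma> \<alpha>; openin X
      N'; N' \<subseteq> V; \<alpha>' \<in> carrier (sec (god0 X A) N');
      \<exists>\<gamma>. local_defect e N' \<gamma> \<alpha>'; w \<in> N; w \<in> N'\<rbrakk> \<Longrightarrow> Ab.god_germ w (N,\<alpha>) = Ab.god_germ w (N',\<alpha>')" using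
        local_defect_compare by blast
  qed blast
  have "defect V e \<tau>" unfolding defect_def
  proof (intro conjI ballI)
    show "\<tau> \<in> carrier (sec (god_Z X A) V)" using \<tau>(1) unfolding god_Z_def .
    fix z assume "z \<in> V"
    from ex[OF this] show "\<exists>N \<gamma> \<alpha>. openin X N \<and> z \<in> N \<and> N \<subseteq> V \<and> local_defect e N \<gamma> \<alpha> \<and> restrict \<tau> N = Ab.god_proj N \<alpha>"
      using \<tau>(2) by blast
  qed
  then show ?thesis by blast
qed

text \<open>By centrality \<open>\<alpha> \<gamma> \<beta> \<delta> = (\<alpha> \<beta>) (\<gamma> \<delta>)\<close>.\<close>

lemma defect_mult:
  assumes V: "openin X V" and t: "defect V e \<tau>" "defect V f \<upsilon>"
  shows "defect V (\<lambda>z. e z \<otimes>\<^bsub>stalk X E z\<^esub> f z) (\<tau> \<otimes>\<^bsub>sec (god_Z X A) V\<^esub> \<upsilon>)"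
  unfolding defect_def
proof (intro conjI ballI)
  interpret Z: abelian_presheaf X "god_Z X A" by (rule Ab.god_Z_abelian)
  have tc: "\<tau> \<in> carrier (sec (god_Z X A) V)" "\<upsilon> \<in> carrier (sec (god_Z X A) V)" using t unfolding defect_def by blast+
  show "\<tau> \<otimes>\<^bsub>sec (god_Z X A) V\<^esub> \<upsilon> \<in> carrier (sec (god_Z X A) V)" using Z.mult_closed[OF V tc] .
  fix z assume z: "z \<in> V"
  obtain N' \<gamma>' \<alpha>' where N': "openin X N'" "z \<in> N'" "N' \<subseteq> V" "local_defect e N' \<gamma>' \<alpha>'" "restrict \<tau> N' =
    Ab.god_proj N' \<alpha>'"
    using t(1) z unfolding defect_def by blast
  obtain M' \<delta>' \<beta>' where M': "openin X M'" "z \<in> M'" "M' \<subseteq> V" "local_defect f M' \<delta>' \<beta>'" "restrict \<upsilon> M' =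
    Ab.god_proj M' \<beta>'"
    using t(2) z unfolding defect_def by blast
  define N where "N = N' \<inter> M'"
  have N: "openin X N" "z \<in> N" "N \<subseteq> V" "N \<subseteq> N'" "N \<subseteq> M'" unfolding N_def using N' M' by auto
  define \<gamma> \<alpha> \<delta> \<beta> where d: "\<gamma> = res E N' N \<gamma>'" "\<alpha> = restrict \<alpha>' N" "\<delta> = res E M' N \<delta>'" "\<beta> = restrict \<beta>' N"
  have r: "local_defect e N \<gamma> \<alpha>" "local_defect f N \<delta> \<beta>" unfolding d using local_defect_res N N' M' by blast+
  have c: "\<gamma> \<in> carrier (sec E N)" "\<delta> \<in> carrier (sec E N)" "\<alpha> \<in> carrier (sec (god0 X A) N)" "\<beta> \<in> carrier (sec
    (god0 X A) N)"
    using r unfolding local_defect_def by auto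
  have ab': "\<alpha>' \<in> carrier (sec (god0 X A) N')" "\<beta>' \<in> carrier (sec (god0 X A) M')" using N' M' unfolding
    local_defect_def by auto
  have "restrict \<tau> N = restrict (restrict \<tau> N') N" using N by (simp add: inf.absorb2)
  also have "\<dots> = Ab.god_proj N \<alpha>" unfolding N'(5) Ab.god.quot_proj_res[OF N'(1) N(1,4) ab'(1)] god0_res d ..
  finally have 1: "restrict \<tau> N = Ab.god_proj N \<alpha>" .
  have "restrict \<upsilon> N = restrict (restrict \<upsilon> M') N" using N by (simp add: inf.absorb2)
  also have "\<dots> = Ab.god_proj N \<beta>" unfolding M'(5) Ab.god.quot_proj_res[OF M'(1) N(1,5) ab'(2)] god0_res d ..
  finally have 2: "restrict \<upsilon> N = Ab.god_proj N \<beta>" .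
  have "restrict (\<tau> \<otimes>\<^bsub>sec (god_Z X A) V\<^esub> \<upsilon>) N = restrict \<tau> N \<otimes>\<^bsub>sec (god_Z X A) N\<^esub> restrict \<upsilon> N"
    using Z.res_mult[OF V N(1,3) tc] unfolding Ab.god_Z_res .
  also have "\<dots> = Ab.god_proj N (\<alpha> \<otimes>\<^bsub>sec (god0 X A) N\<^esub> \<beta>)"
    unfolding 1 2 god_Z_def Ab.god.quot_proj_mult[OF N(1) c(3,4)] ..
  finally have 3: "restrict (\<tau> \<otimes>\<^bsub>sec (god_Z X A) V\<^esub> \<upsilon>) N = Ab.god_proj N (\<alpha> \<otimes>\<^bsub>sec (god0 X A) N\<^esub> \<beta>)" .
  have 4: "local_defect (\<lambda>z. e z \<otimes>\<^bsub>stalk X E z\<^esub> f z) N (\<gamma> \<otimes>\<^bsub>sec E N\<^esub> \<delta>) (\<alpha> \<otimes>\<^bsub>sec (god0 X A) N\<^esub> \<beta>)"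
    unfolding local_defect_def
  proof (intro conjI ballI)
    show "\<gamma> \<otimes>\<^bsub>sec E N\<^esub> \<delta> \<in> carrier (sec E N)" "\<alpha> \<otimes>\<^bsub>sec (god0 X A) N\<^esub> \<beta> \<in> carrier (sec (god0 X A) N)"
      using E.mult_closed[OF N(1) c(1,2)] Ab.god.mult_closed[OF N(1) c(3,4)] .
    fix w assume w: "w \<in> N"
    have wt: "w \<in> topspace X" using w N(1) openin_subset by blast
    interpret I: group_hom "stalk X A w" "stalk X E w" "stalk_map X E i w" using i.stalk_map_group_hom[OF wt] .
    have ac: "\<alpha> w \<in> carrier (stalk X A w)" "\<beta> w \<in> carrier (stalk X A w)" using c w unfolding god0_carrier by auto
    have gc: "germ X E w (N,\<gamma>) \<in> carrier (stalk X E w)" "germ X E w (N,\<delta>) \<in> carrier (stalk X E w)" using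
      E.st.coset_germ_closed N w c by auto
    have "e w \<otimes>\<^bsub>stalk X E w\<^esub> f w = (stalk_map X E i w (\<alpha> w) \<otimes>\<^bsub>stalk X E w\<^esub> germ X E w (N,\<gamma>)) \<otimes>\<^bsub>stalk X E w\<^esub>
      (stalk_map X E i w (\<beta> w) \<otimes>\<^bsub>stalk X E w\<^esub> germ X E w (N,\<delta>))"
      using r w unfolding local_defect_def by simp
    also have "\<dots> = stalk_map X E i w (\<alpha> w) \<otimes>\<^bsub>stalk X E w\<^esub> (germ X E w (N,\<gamma>) \<otimes>\<^bsub>stalk X E w\<^esub> stalk_map X E i w (\<beta>
      w)) \<otimes>\<^bsub>stalk X E w\<^esub> germ X E w (N,\<delta>)"
      using ac gc by (simp add: I.H.m_assoc)
    also have "germ X E w (N,\<gamma>) \<otimes>\<^bsub>stalk X E w\<^esub> stalk_map X E i w (\<beta> w) = stalk_map X E i w (\<beta> w) \<otimes>\<^bsub>stalk X E w\<^esub>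
      germ X E w (N,\<gamma>)"
      using stalk_central[OF wt ac(2) gc(1)] by simp
    finally show "stalk_map X E i w ((\<alpha> \<otimes>\<^bsub>sec (god0 X A) N\<^esub> \<beta>) w) \<otimes>\<^bsub>stalk X E w\<^esub> germ X E w (N, \<gamma> \<otimes>\<^bsub>sec E N\<^esub> \<delta>)
      = e w \<otimes>\<^bsub>stalk X E w\<^esub> f w"
      using ac gc w N(1) c(1,2) by (simp add: god0_mult I.H.m_assoc E.st.coset_germ_mult[symmetric])
  qed
  show "\<exists>N \<gamma> \<alpha>. openin X N \<and> z \<in> N \<and> N \<subseteq> V \<and> local_defect (\<lambda>z. e z \<otimes>\<^bsub>stalk X E z\<^esub> f z) N \<gamma> \<alpha> \<and> restrict (\<tau> \<otimes>\<^bsub>sec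
    (god_Z X A) V\<^esub> \<upsilon>) N = Ab.god_proj N \<alpha>"
    using N 3 4 by blast
qed

text \<open>A section of \<open>E\<close> is its own \<open>\<gamma>\<close>, with trivial \<open>\<alpha>\<close>.\<close>

lemma defect_germ:
  assumes V: "openin X V" and g: "\<gamma> \<in> carrier (sec E V)"
  shows "defect V (\<lambda>z. germ X E z (V,\<gamma>)) \<one>\<^bsub>sec (god_Z X A) V\<^esub>"
  unfolding defect_def
proof (intro conjI ballI)
  interpret Z: abelian_presheaf X "god_Z X A" by (rule Ab.god_Z_abelian)
  have o: "\<one>\<^bsub>sec (god_Z X A) V\<^esub> \<in> carrier (sec (god_Z X A) V)" using Z.one_closed[OF V] .
  show "\<one>\<^bsub>sec (god_Z X A) V\<^esub> \<in> carrier (sec (god_Z X A) V)" by (rule o)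
  fix z assume z: "z \<in> V"
  have "local_defect (\<lambda>z. germ X E z (V,\<gamma>)) V \<gamma> \<one>\<^bsub>sec (god0 X A) V\<^esub>" unfolding local_defect_def
  proof (intro conjI ballI g)
    show "\<one>\<^bsub>sec (god0 X A) V\<^esub> \<in> carrier (sec (god0 X A) V)" using Ab.god.one_closed[OF V] .
    fix w assume w: "w \<in> V"
    have wt: "w \<in> topspace X" using w V openin_subset by blast
    interpret I: group_hom "stalk X A w" "stalk X E w" "stalk_map X E i w" using i.stalk_map_group_hom[OF wt] .
    show "stalk_map X E i w (\<one>\<^bsub>sec (god0 X A) V\<^esub> w) \<otimes>\<^bsub>stalk X E w\<^esub> germ X E w (V, \<gamma>) = germ X E w (V, \<gamma>)"
      using w E.st.coset_germ_closed[OF V w g] by (simp add: god0_one)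
  qed
  moreover have "restrict \<one>\<^bsub>sec (god_Z X A) V\<^esub> V = Ab.god_proj V \<one>\<^bsub>sec (god0 X A) V\<^esub>"
    using Z.res_id[OF V o] unfolding Ab.god_Z_res unfolding Ab.god.quot_proj_one[OF V] god_Z_def .
  ultimately show "\<exists>N \<gamma>' \<alpha>. openin X N \<and> z \<in> N \<and> N \<subseteq> V \<and> local_defect (\<lambda>z. germ X E z (V, \<gamma>)) N \<gamma>' \<alpha> \<and> restrict
    \<one>\<^bsub>sec (god_Z X A) V\<^esub> N = Ab.god_proj N \<alpha>"
    using V z by blast
qed

text \<open>Discontinuous sections \<open>b x\<close> of \<open>E\<close> whose images in \<open>Q\<close> split the cocycle \<open>c\<close>, together with the
  defects \<open>u x y\<close> of \<open>(b x)\<inverse> b y\<close>.\<close>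

definition split_defect where
  "split_defect U c u b \<longleftrightarrow> (\<forall>x \<in> topspace X. \<forall>z \<in> U x. b x z \<in> carrier (stalk X E z)) \<and>
     (\<forall>x \<in> topspace X. \<forall>y \<in> topspace X.
        (\<forall>z \<in> U x \<inter> U y. stalk_map X Q p z (inv\<^bsub>stalk X E z\<^esub> (b x z) \<otimes>\<^bsub>stalk X E z\<^esub> b y z) = germ X Q z (U x \<inter> U
          y, c x y)) \<and>
        defect (U x \<inter> U y) (\<lambda>z. inv\<^bsub>stalk X E z\<^esub> (b x z) \<otimes>\<^bsub>stalk X E z\<^esub> b y z) (u x y))"

lemma split_defectD:
  assumes "split_defect U c u b"
  shows "\<And>x z. \<lbrakk>x \<in> topspace X; z \<in> U x\<rbrakk> \<Longrightarrow> b x z \<in> carrier (stalk X E z)"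
    "\<And>x y z. \<lbrakk>x \<in> topspace X; y \<in> topspace X; z \<in> U x; z \<in> U y\<rbrakk> \<Longrightarrow>
       stalk_map X Q p z (inv\<^bsub>stalk X E z\<^esub> (b x z) \<otimes>\<^bsub>stalk X E z\<^esub> b y z) = germ X Q z (U x \<inter> U y, c x y)"
    "\<And>x y. \<lbrakk>x \<in> topspace X; y \<in> topspace X\<rbrakk> \<Longrightarrow> defect (U x \<inter> U y) (\<lambda>z. inv\<^bsub>stalk X E z\<^esub> (b x z) \<otimes>\<^bsub>stalk X E z\<^esub> b
      y z) (u x y)"
  using assms unfolding split_defect_def by blast+

lemma split_defectI:
  assumes "\<And>x z. \<lbrakk>x \<in> topspace X; z \<in> U x\<rbrakk> \<Longrightarrow> b x z \<in> carrier (stalk X E z)"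
    "\<And>x y z. \<lbrakk>x \<in> topspace X; y \<in> topspace X; z \<in> U x; z \<in> U y\<rbrakk> \<Longrightarrow>
       stalk_map X Q p z (inv\<^bsub>stalk X E z\<^esub> (b x z) \<otimes>\<^bsub>stalk X E z\<^esub> b y z) = germ X Q z (U x \<inter> U y, c x y)"
    "\<And>x y. \<lbrakk>x \<in> topspace X; y \<in> topspace X\<rbrakk> \<Longrightarrow> defect (U x \<inter> U y) (\<lambda>z. inv\<^bsub>stalk X E z\<^esub> (b x z) \<otimes>\<^bsub>stalk X E z\<^esub> b
      y z) (u x y)"
  shows "split_defect U c u b"
  using assms unfolding split_defect_def by simp

lemma split_defect_splits:
  assumes s: "split_defect U c u b" and U: "point_cover X U"
  shows "Q.splits U c (\<lambda>x z. stalk_map X Q p z (b x z))"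
proof -
  note b = split_defectD[OF s]
  have h: "group_hom (stalk X E z) (stalk X Q z) (stalk_map X Q p z)" if "x \<in> topspace X" "z \<in> U x" for x z
    using p.stalk_map_group_hom openin_subset[OF point_cover_open[OF U that(1)]] that(2) by blast
  show ?thesis unfolding Q.splits_def
  proof (intro conjI ballI)
    fix x z assume x: "x \<in> topspace X" and z: "z \<in> U x"
    show "stalk_map X Q p z (b x z) \<in> carrier (stalk X Q z)" using group_hom.hom_closed[OF h[OF x z] b(1)[OF x z]] .
  next
    fix x y z assume x: "x \<in> topspace X" and y: "y \<in> topspace X" and z: "z \<in> U x \<inter> U y"
    then interpret P: group_hom "stalk X E z" "stalk X Q z" "stalk_map X Q p z" using h[of x z] by blast
    show "inv\<^bsub>stalk X Q z\<^esub> stalk_map X Q p z (b x z) \<otimes>\<^bsub>stalk X Q z\<^esub> stalk_map X Q p z (b y z) = germ X Q z (U x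
      \<inter> U y, c x y)"
      using b(1)[OF x, of z] b(1)[OF y, of z] b(2)[OF x y, of z] z by simp
  qed
qed

text \<open>The defect turns \<open>(b x)\<inverse> b y (b y)\<inverse> b z = (b x)\<inverse> b z\<close> into the cocycle identity.\<close>

lemma split_defect_cocycle:
  assumes s: "split_defect U c u b" and U: "point_cover X U"
  shows "(U,u) \<in> cocycles X (god_Z X A)"
proof (rule cocyclesI[OF U])
  interpret Z: abelian_presheaf X "god_Z X A" by (rule Ab.god_Z_abelian)
  note b = split_defectD[OF s]
  show uc: "\<And>x y. \<lbrakk>x \<in> topspace X; y \<in> topspace X\<rbrakk> \<Longrightarrow> u x y \<in> carrier (sec (god_Z X A) (U x \<inter> U y))"
    using b(3) unfolding defect_def by blast
  fix x y z assume t: "x \<in> topspace X" "y \<in> topspace X" "z \<in> topspace X"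
  let ?T = "U x \<inter> U y \<inter> U z"
  have o: "openin X ?T" "openin X (U x \<inter> U y)" "openin X (U y \<inter> U z)" "openin X (U x \<inter> U z)"
    using point_cover_open3[OF U t] point_cover_open2[OF U] t by simp_all
  have j: "?T \<subseteq> U x \<inter> U y" "?T \<subseteq> U y \<inter> U z" "?T \<subseteq> U x \<inter> U z" by auto
  show "res (god_Z X A) (U x \<inter> U y) ?T (u x y) \<otimes>\<^bsub>sec (god_Z X A) ?T\<^esub> res (god_Z X A) (U y \<inter> U z) ?T (u y z) =
    res (god_Z X A) (U x \<inter> U z) ?T (u x z)"
    unfolding Ab.god_Z_res
  proof (rule defect_unique[OF o(1) defect_mult[OF o(1) defect_res[OF b(3)[OF t(1,2)] o(2,1) j(1)] defect_res[OF
    b(3)[OF t(2,3)] o(3,1) j(2)]]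
        defect_res[OF b(3)[OF t(1,3)] o(4,1) j(3)]])
    fix w assume w: "w \<in> ?T"
    then have "w \<in> topspace X" using o openin_subset by blast
    then interpret G: group "stalk X E w" using E.st.quot_stalk_group by blast
    show "inv\<^bsub>stalk X E w\<^esub> b x w \<otimes>\<^bsub>stalk X E w\<^esub> b y w \<otimes>\<^bsub>stalk X E w\<^esub> (inv\<^bsub>stalk X E w\<^esub> b y w \<otimes>\<^bsub>stalk X E w\<^esub> b z w) =
         inv\<^bsub>stalk X E w\<^esub> b x w \<otimes>\<^bsub>stalk X E w\<^esub> b z w"
      using b(1)[OF t(1), of w] b(1)[OF t(2), of w] b(1)[OF t(3), of w] w by (simp add: G.m_assoc)
  qed
qed

text \<open>This identifies the data in the definition of \<open>conn_shift\<close> with \<open>split_defect\<close>. From right to left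
  the section \<open>\<gamma>\<close> must lift \<open>c x y\<close>; this follows by comparing germs, as \<open>\<alpha>\<close> dies in \<open>Q\<close>.\<close>

lemma shifts_to_iff:
  assumes c: "(U,c) \<in> cocycles X Q"
  shows "(U,u) \<in> cocycles X (god_Z X A) \<and> shifts_to X A E Q i p U c u \<longleftrightarrow> (\<exists>b. split_defect U c u b)"
proof
  note U = cocyclesD(1)[OF c]
  assume l: "(U,u) \<in> cocycles X (god_Z X A) \<and> shifts_to X A E Q i p U c u"
  then obtain b where b: "\<forall>x \<in> topspace X. \<forall>z \<in> U x. b x z \<in> carrier (stalk X E z)"
     "\<And>x y z. \<lbrakk>x \<in> topspace X; y \<in> topspace X; z \<in> U x \<inter> U y\<rbrakk> \<Longrightarrow>
        stalk_map X Q p z (inv\<^bsub>stalk X E z\<^esub> (b x z) \<otimes>\<^bsub>stalk X E z\<^esub> b y z) = germ X Q z (U x \<inter> U y, c x y) \<and>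
        (\<exists>V \<gamma> \<alpha>. openin X V \<and> z \<in> V \<and> V \<subseteq> U x \<inter> U y \<and>
           \<gamma> \<in> carrier (sec E V) \<and> p V \<gamma> = res Q (U x \<inter> U y) V (c x y) \<and>
           \<alpha> \<in> carrier (sec (god0 X A) V) \<and>
           (\<forall>w \<in> V. stalk_map X E i w (\<alpha> w) \<otimes>\<^bsub>stalk X E w\<^esub> germ X E w (V, \<gamma>) =
              inv\<^bsub>stalk X E w\<^esub> (b x w) \<otimes>\<^bsub>stalk X E w\<^esub> b y w) \<and>
           res (god_Z X A) (U x \<inter> U y) V (u x y) = quot_proj X (god0 X A) (god_img X A) V \<alpha>)"
    unfolding shifts_to_def by blast
  have "split_defect U c u b"
  proof (rule split_defectI)
    fix x y assume t: "x \<in> topspace X" "y \<in> topspace X"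
    show "defect (U x \<inter> U y) (\<lambda>z. inv\<^bsub>stalk X E z\<^esub> (b x z) \<otimes>\<^bsub>stalk X E z\<^esub> b y z) (u x y)"
      unfolding defect_def local_defect_def
    proof (intro conjI ballI)
      show "u x y \<in> carrier (sec (god_Z X A) (U x \<inter> U y))" using cocyclesD(2)[OF conjunct1[OF l] t] .
      fix z assume z: "z \<in> U x \<inter> U y"
      show "\<exists>N \<gamma> \<alpha>. openin X N \<and> z \<in> N \<and> N \<subseteq> U x \<inter> U y \<and>
          (\<gamma> \<in> carrier (sec E N) \<and> \<alpha> \<in> carrier (sec (god0 X A) N) \<and>
           (\<forall>w\<in>N. stalk_map X E i w (\<alpha> w) \<otimes>\<^bsub>stalk X E w\<^esub> germ X E w (N, \<gamma>) = inv\<^bsub>stalk X E w\<^esub> b x w \<otimes>\<^bsub>stalk X E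
             w\<^esub> b y w)) \<and>
          restrict (u x y) N = Ab.god_proj N \<alpha>"
        using conjunct2[OF b(2)[OF t z]] unfolding Ab.god_Z_res by blast
    qed
  qed (use b in blast)+
  then show "\<exists>b. split_defect U c u b" by blast
next
  note U = cocyclesD(1)[OF c]
  assume "\<exists>b. split_defect U c u b"
  then obtain b where s: "split_defect U c u b" by blast
  note b = split_defectD[OF s]
  have "shifts_to X A E Q i p U c u" unfolding shifts_to_def
  proof (intro exI[of _ b] conjI ballI)
    fix x y z assume t: "x \<in> topspace X" "y \<in> topspace X" and z: "z \<in> U x \<inter> U y"
    have o: "openin X (U x \<inter> U y)" using point_cover_open2[OF U t] .
    note cc = cocyclesD(2)[OF c t]
    show "stalk_map X Q p z (inv\<^bsub>stalk X E z\<^esub> (b x z) \<otimes>\<^bsub>stalk X E z\<^esub> b y z) = germ X Q z (U x \<inter> U y, c x y)"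
      using b(2) t z by blast
    obtain N \<gamma> \<alpha> where N: "openin X N" "z \<in> N" "N \<subseteq> U x \<inter> U y" "local_defect (\<lambda>z. inv\<^bsub>stalk X E z\<^esub> (b x z)
      \<otimes>\<^bsub>stalk X E z\<^esub> b y z) N \<gamma> \<alpha>"
      "restrict (u x y) N = Ab.god_proj N \<alpha>"
      using b(3)[OF t] z unfolding defect_def by blast
    have g: "\<gamma> \<in> carrier (sec E N)" "\<alpha> \<in> carrier (sec (god0 X A) N)"
      "\<And>w. w \<in> N \<Longrightarrow> stalk_map X E i w (\<alpha> w) \<otimes>\<^bsub>stalk X E w\<^esub> germ X E w (N, \<gamma>) = inv\<^bsub>stalk X E w\<^esub> b x w \<otimes>\<^bsub>stalk X E
        w\<^esub> b y w"
      using N(4) unfolding local_defect_def by auto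
    have "p N \<gamma> = res Q (U x \<inter> U y) N (c x y)"
    proof (rule Q.separated[OF N(1) p.map_closed[OF N(1) g(1)] Q.res_closed[OF o N(1,3) cc]])
      fix w assume w: "w \<in> N"
      have wt: "w \<in> topspace X" using w N(1) openin_subset by blast
      interpret P: group_hom "stalk X E w" "stalk X Q w" "stalk_map X Q p w" using p.stalk_map_group_hom[OF wt] .
      have ac: "\<alpha> w \<in> carrier (stalk X A w)" using g(2) w unfolding god0_carrier by auto
      have gc: "germ X E w (N,\<gamma>) \<in> carrier (stalk X E w)" using E.st.coset_germ_closed N w g by auto
      have "germ X Q w (N, p N \<gamma>) = stalk_map X Q p w (stalk_map X E i w (\<alpha> w) \<otimes>\<^bsub>stalk X E w\<^esub> germ X E w (N, \<gamma>))"
        using ac gc i.stalk_map_closed[OF wt ac] stalk_P_I[OF wt ac] by (simp add: p.stalk_map_germ[OF N(1) w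
          g(1), symmetric])
      also have "\<dots> = germ X Q w (U x \<inter> U y, c x y)" unfolding g(3)[OF w] using b(2) t w N(3) by blast
      also have "\<dots> = germ X Q w (N, res Q (U x \<inter> U y) N (c x y))" using Q.st.coset_germ_res[OF o cc N(1) w N(3)]
        by simp
      finally show "germ X Q w (N, p N \<gamma>) = germ X Q w (N, res Q (U x \<inter> U y) N (c x y))" .
    qed
    then show "\<exists>V \<gamma> \<alpha>. openin X V \<and> z \<in> V \<and> V \<subseteq> U x \<inter> U y \<and>
           \<gamma> \<in> carrier (sec E V) \<and> p V \<gamma> = res Q (U x \<inter> U y) V (c x y) \<and>
           \<alpha> \<in> carrier (sec (god0 X A) V) \<and>
           (\<forall>w \<in> V. stalk_map X E i w (\<alpha> w) \<otimes>\<^bsub>stalk X E w\<^esub> germ X E w (V, \<gamma>) =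
              inv\<^bsub>stalk X E w\<^esub> (b x w) \<otimes>\<^bsub>stalk X E w\<^esub> b y w) \<and>
           res (god_Z X A) (U x \<inter> U y) V (u x y) = quot_proj X (god0 X A) (god_img X A) V \<alpha>"
      unfolding Ab.god_Z_res using N(1,2,3,5) g by blast
  qed (use b in blast)
  then show "(U,u) \<in> cocycles X (god_Z X A) \<and> shifts_to X A E Q i p U c u" using split_defect_cocycle[OF s U] by blast
qed

lemma split_defect_exists:
  assumes c: "(U,c) \<in> cocycles X Q"
  shows "\<exists>u b. split_defect U c u b"
proof -
  note U = cocyclesD(1)[OF c]
  have top: "z \<in> topspace X" if "x \<in> topspace X" "z \<in> U x" for x z
    using point_cover_open[OF U that(1)] that(2) openin_subset by blast
  note sp = Q.splits_point_split[OF c]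
  let ?q = "Q.point_split U c"
  have "\<exists>e. e \<in> carrier (stalk X E z) \<and> stalk_map X Q p z e = ?q x z" if x: "x \<in> topspace X" and z: "z \<in> U x" for x z
    using stalk_P_surj[OF top[OF x z] Q.splitsD(1)[OF sp x z]] by blast
  then obtain b where b: "\<And>x z. \<lbrakk>x \<in> topspace X; z \<in> U x\<rbrakk> \<Longrightarrow> b x z \<in> carrier (stalk X E z) \<and> stalk_map X Q p z (b
    x z) = ?q x z"
    by metis
  have P: "stalk_map X Q p z (inv\<^bsub>stalk X E z\<^esub> (b x z) \<otimes>\<^bsub>stalk X E z\<^esub> b y z) = germ X Q z (U x \<inter> U y, c x y)"
    if x: "x \<in> topspace X" and y: "y \<in> topspace X" and z: "z \<in> U x" "z \<in> U y" for x y z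
  proof -
    interpret P: group_hom "stalk X E z" "stalk X Q z" "stalk_map X Q p z" using p.stalk_map_group_hom[OF top[OF
      x z(1)]] .
    show ?thesis using b[OF x z(1)] b[OF y z(2)] Q.splitsD(2)[OF sp x y z] by simp
  qed
  have tex: "\<exists>\<tau>. defect (U x \<inter> U y) (\<lambda>z. inv\<^bsub>stalk X E z\<^esub> (b x z) \<otimes>\<^bsub>stalk X E z\<^esub> b y z) \<tau>" if x: "x \<in> topspace
    X" and y: "y \<in> topspace X" for x y
  proof (rule defect_exists[OF point_cover_open2[OF U x y] _ cocyclesD(2)[OF c x y]])
    fix w assume w: "w \<in> U x \<inter> U y"
    interpret G: group "stalk X E w" using E.st.quot_stalk_group top[OF x, of w] w by blast
    show "inv\<^bsub>stalk X E w\<^esub> (b x w) \<otimes>\<^bsub>stalk X E w\<^esub> b y w \<in> carrier (stalk X E w)" using b[OF x] b[OF y] w by simp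
    show "stalk_map X Q p w (inv\<^bsub>stalk X E w\<^esub> (b x w) \<otimes>\<^bsub>stalk X E w\<^esub> b y w) = germ X Q w (U x \<inter> U y, c x y)"
      using P[OF x y] w by blast
  qed
  define u where "u x y = (SOME \<tau>. defect (U x \<inter> U y) (\<lambda>z. inv\<^bsub>stalk X E z\<^esub> (b x z) \<otimes>\<^bsub>stalk X E z\<^esub> b y z) \<tau>)" for x y
  have u: "defect (U x \<inter> U y) (\<lambda>z. inv\<^bsub>stalk X E z\<^esub> (b x z) \<otimes>\<^bsub>stalk X E z\<^esub> b y z) (u x y)" if "x \<in> topspace X"
    "y \<in> topspace X" for x y
    unfolding u_def by (rule someI_ex[OF tex[OF that]])
  have "split_defect U c u b" by (rule split_defectI) (simp_all add: b P u)
  then show ?thesis by blast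
qed

text \<open>By \<open>splits_transition\<close> the images of the two splittings in \<open>Q\<close> differ by one discontinuous section.
  Once this section is lifted to \<open>E\<close>, the comparison of \<open>b x\<close> and \<open>f x\<close> has a defect, and these
  defects relate \<open>u\<close> to \<open>v\<close>.\<close>

lemma split_defect_unique:
  assumes s: "split_defect U c u b" and s': "split_defect V d v f" and cd: "((U,c),(V,d)) \<in> cohomologous X Q"
  shows "((U,u),(V,v)) \<in> cohomologous X (god_Z X A)"
proof -
  interpret Z: abelian_presheaf X "god_Z X A" by (rule Ab.god_Z_abelian)
  obtain W h where W: "(U,c) \<in> cocycles X Q" "(V,d) \<in> cocycles X Q" "point_cover X W"
      "\<And>x. x \<in> topspace X \<Longrightarrow> W x \<subseteq> U x" "\<And>x. x \<in> topspace X \<Longrightarrow> W x \<subseteq> V x"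
      "\<And>x. x \<in> topspace X \<Longrightarrow> h x \<in> carrier (sec Q (W x))"
      "Q.cobound W h (cochain_res Q U W c) (cochain_res Q V W d)"
    using cd unfolding Q.cohomologous_iff by blast
  note U = cocyclesD(1)[OF W(1)] and V = cocyclesD(1)[OF W(2)]
  note b = split_defectD[OF s] and f = split_defectD[OF s']
  have top: "z \<in> topspace X" if "x \<in> topspace X" "z \<in> W x" for x z
    using point_cover_open[OF W(3) that(1)] that(2) openin_subset by blast
  let ?P = "\<lambda>z. stalk_map X Q p z"
  have cl: "b x z \<in> carrier (stalk X E z)" "f x z \<in> carrier (stalk X E z)" "germ X Q z (W x, h x) \<in> carrier
    (stalk X Q z)"
    "?P z (b x z) \<in> carrier (stalk X Q z)" "?P z (f x z) \<in> carrier (stalk X Q z)"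
    if "x \<in> topspace X" "z \<in> W x" for x z
  proof -
    show 1: "b x z \<in> carrier (stalk X E z)" "f x z \<in> carrier (stalk X E z)"
      using b(1)[OF that(1)] f(1)[OF that(1)] W(4,5)[OF that(1)] that(2) by blast+
    show "germ X Q z (W x, h x) \<in> carrier (stalk X Q z)"
      using Q.st.coset_germ_closed[OF point_cover_open[OF W(3) that(1)] that(2) W(6)[OF that(1)]] .
    show "?P z (b x z) \<in> carrier (stalk X Q z)" "?P z (f x z) \<in> carrier (stalk X Q z)"
      using p.stalk_map_closed[OF top[OF that]] 1 by blast+
  qed
  let ?t = "\<lambda>x z. ?P z (b x z) \<otimes>\<^bsub>stalk X Q z\<^esub> germ X Q z (W x, h x) \<otimes>\<^bsub>stalk X Q z\<^esub> inv\<^bsub>stalk X Q z\<^esub> (?P z (f x z))"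
  have sp: "Q.splits U c (\<lambda>x z. ?P z (b x z))" "Q.splits V d (\<lambda>x z. ?P z (f x z))" 
    using split_defect_splits[OF s U] split_defect_splits[OF s' V] .
  have "\<exists>e. e \<in> carrier (stalk X E z) \<and> ?P z e = ?t z z" if z: "z \<in> topspace X" for z
  proof -
    interpret Qz: group "stalk X Q z" using Q.st.quot_stalk_group[OF z] .
    have "?t z z \<in> carrier (stalk X Q z)" using cl[OF z point_cover_mem[OF W(3) z]] by simp
    then show ?thesis using stalk_P_surj[OF z] by blast
  qed
  \<comment> \<open>\<open>T\<close> lifts the transition section to discontinuous sections of \<open>E\<close>. Replacing \<open>f x\<close> by
    \<open>T \<otimes> f x\<close> leaves the quotients \<open>(f x)\<inverse> f y\<close> unchanged and makes \<open>(b x)\<inverse> T f x\<close> a lift of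
    the section \<open>h x\<close>, so that its defect \<open>k x\<close> makes sense.\<close>
  then obtain T where T: "\<And>z. z \<in> topspace X \<Longrightarrow> T z \<in> carrier (stalk X E z) \<and> ?P z (T z) = ?t z z" by metis
  have PT: "?P z (T z) = ?t x z" if x: "x \<in> topspace X" "z \<in> W x" for x z
    using T[OF top[OF x]] Q.splits_transition[OF sp W x top[OF x] point_cover_mem[OF W(3) top[OF x]]] by simp
  let ?e = "\<lambda>x z. inv\<^bsub>stalk X E z\<^esub> (b x z) \<otimes>\<^bsub>stalk X E z\<^esub> (T z \<otimes>\<^bsub>stalk X E z\<^esub> f x z)"
  have kex: "\<exists>k. defect (W x) (?e x) k" if x: "x \<in> topspace X" for x
  proof (rule defect_exists[OF point_cover_open[OF W(3) x] _ W(6)[OF x]])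
    fix z assume z: "z \<in> W x"
    interpret P: group_hom "stalk X E z" "stalk X Q z" "?P z" using p.stalk_map_group_hom[OF top[OF x z]] .
    note c' = cl[OF x z] T[OF top[OF x z]]
    show "?e x z \<in> carrier (stalk X E z)" using c' by simp
    have "?P z (?e x z) = inv\<^bsub>stalk X Q z\<^esub> (?P z (b x z)) \<otimes>\<^bsub>stalk X Q z\<^esub> (?t x z \<otimes>\<^bsub>stalk X Q z\<^esub> ?P z (f x z))"
      using c' PT[OF x z] by simp
    also have "\<dots> = germ X Q z (W x, h x)" using c' by (simp add: P.H.m_assoc)
    finally show "?P z (?e x z) = germ X Q z (W x, h x)" .
  qed
  define k where "k x = (SOME \<tau>. defect (W x) (?e x) \<tau>)" for x
  have k: "\<And>x. x \<in> topspace X \<Longrightarrow> defect (W x) (?e x) (k x)" unfolding k_def by (rule someI_ex[OF kex])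
  note uc = split_defect_cocycle[OF s U] and vc = split_defect_cocycle[OF s' V]
  have kc: "\<And>x. x \<in> topspace X \<Longrightarrow> k x \<in> carrier (sec (god_Z X A) (W x))" using k unfolding defect_def by blast
  show ?thesis
  proof (rule Z.cohomologous_onI[OF uc vc W(3,4,5) kc])
    show "Z.cobound W k (cochain_res (god_Z X A) U W u) (cochain_res (god_Z X A) V W v)"
      unfolding Z.cobound_def
    proof (intro ballI)
      fix x y assume t: "x \<in> topspace X" "y \<in> topspace X"
      let ?N = "W x \<inter> W y"
      have o: "openin X (W x)" "openin X (W y)" "openin X ?N" "openin X (U x \<inter> U y)" "openin X (V x \<inter> V y)"
        using W(3) U V t by (simp_all add: point_cover_open point_cover_open2)
      have j: "?N \<subseteq> W x" "?N \<subseteq> W y" "?N \<subseteq> U x \<inter> U y" "?N \<subseteq> V x \<inter> V y" using W(4,5)[OF t(1)] W(4,5)[OF t(2)] by blast+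
      interpret G: group "sec (god_Z X A) ?N" using Z.sec_group[OF o(3)] .
      note kr = Z.res_closed[OF o(1,3) j(1) kc[OF t(1)]] Z.res_closed[OF o(2,3) j(2) kc[OF t(2)]]
      note ur = Z.cochain_res_closed[OF uc W(3,4) t] and vr = Z.cochain_res_closed[OF vc W(3,5) t]
      \<comment> \<open>Both sides are the defect of \<open>(b x)\<inverse> T f y\<close>.\<close>
      have e: "res (god_Z X A) (W x) ?N (k x) \<otimes>\<^bsub>sec (god_Z X A) ?N\<^esub> cochain_res (god_Z X A) V W v x y =
            cochain_res (god_Z X A) U W u x y \<otimes>\<^bsub>sec (god_Z X A) ?N\<^esub> res (god_Z X A) (W y) ?N (k y)"
        unfolding cochain_res_def Ab.god_Z_res
      proof (rule defect_unique[OF o(3) defect_mult[OF o(3) defect_res[OF k[OF t(1)] o(1,3) j(1)] defect_res[OF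
        f(3)[OF t] o(5,3) j(4)]]
            defect_mult[OF o(3) defect_res[OF b(3)[OF t] o(4,3) j(3)] defect_res[OF k[OF t(2)] o(2,3) j(2)]]])
        fix z assume z: "z \<in> ?N"
        have zx: "z \<in> W x" "z \<in> W y" and zt: "z \<in> topspace X" using z top[OF t(1)] by auto
        interpret Ez: group "stalk X E z" using E.st.quot_stalk_group[OF zt] .
        show "?e x z \<otimes>\<^bsub>stalk X E z\<^esub> (inv\<^bsub>stalk X E z\<^esub> f x z \<otimes>\<^bsub>stalk X E z\<^esub> f y z) =
            inv\<^bsub>stalk X E z\<^esub> b x z \<otimes>\<^bsub>stalk X E z\<^esub> b y z \<otimes>\<^bsub>stalk X E z\<^esub> ?e y z"
          using cl(1,2)[OF t(1) zx(1)] cl(1,2)[OF t(2) zx(2)] T[OF zt] by (simp add: Ez.m_assoc)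
      qed
      show "cochain_res (god_Z X A) V W v x y = inv\<^bsub>sec (god_Z X A) ?N\<^esub> (res (god_Z X A) (W x) ?N (k x)) \<otimes>\<^bsub>sec
        (god_Z X A) ?N\<^esub>
          cochain_res (god_Z X A) U W u x y \<otimes>\<^bsub>sec (god_Z X A) ?N\<^esub> res (god_Z X A) (W y) ?N (k y)"
        using kr ur vr by (simp add: G.m_assoc flip: e)
    qed
  qed
qed

lemma conn_shift_eq:
  assumes c: "(U,c) \<in> cocycles X Q" and s: "split_defect U c u b"
  shows "conn_shift X A E Q i p (Q.cech_class (U,c)) = cohomologous X (god_Z X A) `` {(U,u)}"
proof -
  interpret Z: abelian_presheaf X "god_Z X A" by (rule Ab.god_Z_abelian)
  have 1: "\<exists>V d v. (V,d) \<in> Q.cech_class (U,c) \<and> (V,v) \<in> cocycles X (god_Z X A) \<and> shifts_to X A E Q i p V d v \<and>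
    Z.cech_class (U,u) = Z.cech_class (V,v)"
    using shifts_to_iff[OF c, of u] s Q.cech_class_mem[OF c] by blast
  have 2: "\<zeta> = Z.cech_class (U,u)" if "\<exists>V d v. (V,d) \<in> Q.cech_class (U,c) \<and> (V,v) \<in> cocycles X (god_Z X A) \<and>
    shifts_to X A E Q i p V d v \<and> \<zeta> = Z.cech_class (V,v)" for \<zeta>
  proof -
    from that obtain V d v where v: "(V,d) \<in> Q.cech_class (U,c)" "(V,v) \<in> cocycles X (god_Z X A)" "shifts_to X A
      E Q i p V d v" "\<zeta> = Z.cech_class (V,v)"
      by blast
    obtain f where f: "split_defect V d v f" using shifts_to_iff[OF Q.cech_classD(1)[OF v(1)], of v] v by blast
    have "((U,c),(V,d)) \<in> cohomologous X Q" using v(1) unfolding Q.cech_class_def by blast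
    then have "((U,u),(V,v)) \<in> cohomologous X (god_Z X A)" using split_defect_unique[OF s f] by blast
    then show ?thesis unfolding v Z.cech_class_def using equiv_class_eq[OF Z.cohomologous_equiv] by metis
  qed
  show ?thesis unfolding conn_shift_def Z.cech_class_def[symmetric]
    by (rule the_equality, rule 1, rule 2, assumption)
qed

lemma split_defect_mult:
  assumes Ecomm: "abelian_presheaf X E" and c: "(W,c) \<in> cocycles X Q" "(W,d) \<in> cocycles X Q"
    and s: "split_defect W c u b" and s': "split_defect W d v f"
  shows "split_defect W (Q.cochain_mult W c d) (group_presheaf.cochain_mult (god_Z X A) W u v) (\<lambda>x z. b x z
    \<otimes>\<^bsub>stalk X E z\<^esub> f x z)"
proof -
  interpret Z: abelian_presheaf X "god_Z X A" by (rule Ab.god_Z_abelian)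
  interpret Ea: abelian_presheaf X E by (rule Ecomm)
  note W = cocyclesD(1)[OF c(1)]
  note b = split_defectD[OF s] and f = split_defectD[OF s']
  have top: "z \<in> topspace X" if "x \<in> topspace X" "z \<in> W x" for x z
    using point_cover_open[OF W that(1)] that(2) openin_subset by blast
  have eq: "inv\<^bsub>stalk X E z\<^esub> (b x z \<otimes>\<^bsub>stalk X E z\<^esub> f x z) \<otimes>\<^bsub>stalk X E z\<^esub> (b y z \<otimes>\<^bsub>stalk X E z\<^esub> f y z) =
     (inv\<^bsub>stalk X E z\<^esub> (b x z) \<otimes>\<^bsub>stalk X E z\<^esub> b y z) \<otimes>\<^bsub>stalk X E z\<^esub> (inv\<^bsub>stalk X E z\<^esub> (f x z) \<otimes>\<^bsub>stalk X E z\<^esub> f y z)"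
    if t: "x \<in> topspace X" "y \<in> topspace X" and z: "z \<in> W x" "z \<in> W y" for x y z
  proof -
    interpret comm_group "stalk X E z" using Ea.stalk_comm[OF top[OF t(1) z(1)]] .
    show ?thesis using b(1)[OF t(1) z(1)] b(1)[OF t(2) z(2)] f(1)[OF t(1) z(1)] f(1)[OF t(2) z(2)]
      by (simp add: inv_mult m_ac)
  qed
  show ?thesis
  proof (rule split_defectI)
    fix x z assume t: "x \<in> topspace X" and z: "z \<in> W x"
    interpret comm_group "stalk X E z" using Ea.stalk_comm[OF top[OF t z]] .
    show "b x z \<otimes>\<^bsub>stalk X E z\<^esub> f x z \<in> carrier (stalk X E z)" using b(1)[OF t z] f(1)[OF t z] by simp
    fix y assume t': "y \<in> topspace X" and z': "z \<in> W y"
    interpret P: group_hom "stalk X E z" "stalk X Q z" "stalk_map X Q p z" using p.stalk_map_group_hom[OF top[OF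
      t z]] .
    have o: "openin X (W x \<inter> W y)" using point_cover_open2[OF W t t'] .
    have "stalk_map X Q p z ((inv\<^bsub>stalk X E z\<^esub> (b x z) \<otimes>\<^bsub>stalk X E z\<^esub> b y z) \<otimes>\<^bsub>stalk X E z\<^esub> (inv\<^bsub>stalk X E z\<^esub> (f
      x z) \<otimes>\<^bsub>stalk X E z\<^esub> f y z))
      = germ X Q z (W x \<inter> W y, c x y) \<otimes>\<^bsub>stalk X Q z\<^esub> germ X Q z (W x \<inter> W y, d x y)"
      unfolding b(2)[OF t t' z z', symmetric] f(2)[OF t t' z z', symmetric]
      using b(1)[OF t z] b(1)[OF t' z'] f(1)[OF t z] f(1)[OF t' z'] by (intro P.hom_mult) simp_all
    also have "\<dots> = germ X Q z (W x \<inter> W y, Q.cochain_mult W c d x y)"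
      unfolding Q.cochain_mult_def using Q.st.coset_germ_mult[OF o _ cocyclesD(2)[OF c(1) t t'] cocyclesD(2)[OF
        c(2) t t']] z z' by blast
    finally show "stalk_map X Q p z (inv\<^bsub>stalk X E z\<^esub> (b x z \<otimes>\<^bsub>stalk X E z\<^esub> f x z) \<otimes>\<^bsub>stalk X E z\<^esub> (b y z \<otimes>\<^bsub>stalk
      X E z\<^esub> f y z)) =
       germ X Q z (W x \<inter> W y, Q.cochain_mult W c d x y)" unfolding eq[OF t t' z z'] .
  next
    fix x y assume t: "x \<in> topspace X" "y \<in> topspace X"
    have o: "openin X (W x \<inter> W y)" using point_cover_open2[OF W t] .
    show "defect (W x \<inter> W y) (\<lambda>z. inv\<^bsub>stalk X E z\<^esub> (b x z \<otimes>\<^bsub>stalk X E z\<^esub> f x z) \<otimes>\<^bsub>stalk X E z\<^esub> (b y z \<otimes>\<^bsub>stalk X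
      E z\<^esub> f y z)) (Z.cochain_mult W u v x y)"
      unfolding Z.cochain_mult_def by (rule defect_cong[OF defect_mult[OF o b(3)[OF t] f(3)[OF t]]]) (use eq[OF
        t] in auto)
  qed
qed

text \<open>Both steps are additive: the defect is multiplicative, and \<open>cech_to_god\<close> is a homomorphism for every
  sheaf of abelian groups.\<close>

lemma conn2_hom:
  assumes Eab: "abelian_presheaf X E" and Qab: "abelian_presheaf X Q"
  shows "conn2 X A E Q i p \<in> hom (cech_H1 X Q) (sheaf_H2 X A)"
proof -
  interpret Z: abelian_presheaf X "god_Z X A" by (rule Ab.god_Z_abelian)
  interpret Qa: abelian_presheaf X Q by (rule Qab)
  have "conn_shift X A E Q i p \<in> hom (cech_H1 X Q) (cech_H1 X (god_Z X A))"
  proof (rule homI)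
    fix B C assume BC: "B \<in> carrier (cech_H1 X Q)" "C \<in> carrier (cech_H1 X Q)"
    obtain W c d where c: "(W,c) \<in> cocycles X Q" "(W,d) \<in> cocycles X Q" "B = Q.cech_class (W,c)" "C =
      Q.cech_class (W,d)"
      using Q.cech_cases2[OF BC] by blast
    note W = cocyclesD(1)[OF c(1)]
    obtain u b where s: "split_defect W c u b" using split_defect_exists[OF c(1)] by blast
    obtain v f where s': "split_defect W d v f" using split_defect_exists[OF c(2)] by blast
    note uv = split_defect_cocycle[OF s W] split_defect_cocycle[OF s' W]
    show "conn_shift X A E Q i p B \<in> carrier (cech_H1 X (god_Z X A))"
      unfolding c(3) conn_shift_eq[OF c(1) s] using Z.cech_class_closed[OF uv(1)] unfolding Z.cech_class_def .
    show "conn_shift X A E Q i p (B \<otimes>\<^bsub>cech_H1 X Q\<^esub> C) = conn_shift X A E Q i p B \<otimes>\<^bsub>cech_H1 X (god_Z X A)\<^esub>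
      conn_shift X A E Q i p C"
      unfolding c(3,4) Qa.cech_mult[OF c(1,2)] conn_shift_eq[OF c(1) s] conn_shift_eq[OF c(2) s']
        conn_shift_eq[OF Qa.cochain_mult_cocycle[OF c(1,2)] split_defect_mult[OF Eab c(1,2) s s']]
      using Z.cech_mult[OF uv] unfolding Z.cech_class_def by simp
  qed
  then have "cech_to_god X (god_Z X A) \<circ> conn_shift X A E Q i p \<in> hom (cech_H1 X Q) (god_H1 X (god_Z X A))"
    using hom_compose Z.cech_to_god_hom by blast
  then show ?thesis unfolding sheaf_H2_def conn2_def comp_def .
qed

lemma H2_comm_group: "comm_group (sheaf_H2 X A)"
  unfolding sheaf_H2_def using abelian_presheaf.god_H1_comm_group[OF Ab.god_Z_abelian] .

text \<open>If the cocycle of \<open>Q\<close> comes from a cocycle \<open>\<gamma>\<close> of \<open>E\<close>, then the splitting of \<open>\<gamma>\<close> by its own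
  entries has differences \<open>\<gamma> x y\<close>, which are sections of \<open>E\<close> and so have trivial defect.\<close>

lemma conn2_H1_map_trivial:
  assumes z: "\<zeta> \<in> carrier (cech_H1 X E)"
  shows "conn2 X A E Q i p (H1_map X Q p \<zeta>) = \<one>\<^bsub>sheaf_H2 X A\<^esub>"
proof -
  interpret Z: abelian_presheaf X "god_Z X A" by (rule Ab.god_Z_abelian)
  obtain U \<gamma> where g: "(U,\<gamma>) \<in> cocycles X E" "\<zeta> = E.cech_class (U,\<gamma>)" using E.cech_cases[OF z] .
  note U = cocyclesD(1)[OF g(1)]
  let ?b = "E.point_split U \<gamma>"
  note b = E.splitsD[OF E.splits_point_split[OF g(1)]]
  let ?u = "\<lambda>x y. \<one>\<^bsub>sec (god_Z X A) (U x \<inter> U y)\<^esub>"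
  have s: "split_defect U (p.cochain_map U \<gamma>) ?u ?b"
  proof (rule split_defectI)
    show "\<And>x z. \<lbrakk>x \<in> topspace X; z \<in> U x\<rbrakk> \<Longrightarrow> ?b x z \<in> carrier (stalk X E z)" by (rule b(1))
    fix x y assume t: "x \<in> topspace X" "y \<in> topspace X"
    show "stalk_map X Q p z (inv\<^bsub>stalk X E z\<^esub> (?b x z) \<otimes>\<^bsub>stalk X E z\<^esub> ?b y z) = germ X Q z (U x \<inter> U y,
      p.cochain_map U \<gamma> x y)"
      if z: "z \<in> U x" "z \<in> U y" for z
      unfolding b(2)[OF t z] p.cochain_map_def
      using p.stalk_map_germ[OF point_cover_open2[OF U t] _ cocyclesD(2)[OF g(1) t]] z by blast
    show "defect (U x \<inter> U y) (\<lambda>z. inv\<^bsub>stalk X E z\<^esub> (?b x z) \<otimes>\<^bsub>stalk X E z\<^esub> ?b y z) (?u x y)"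
      by (rule defect_cong[OF defect_germ[OF point_cover_open2[OF U t] cocyclesD(2)[OF g(1) t]]]) (use b(2)[OF
        t] in auto)
  qed
  have "conn_shift X A E Q i p (H1_map X Q p \<zeta>) = \<one>\<^bsub>cech_H1 X (god_Z X A)\<^esub>"
    unfolding g(2) p.H1_map_cech_class[OF g(1)] conn_shift_eq[OF p.cochain_map_cocycle[OF g(1)] s]
      Z.cech_one(2)[OF U] Z.cech_class_def ..
  moreover have "cech_to_god X (god_Z X A) \<one>\<^bsub>cech_H1 X (god_Z X A)\<^esub> = \<one>\<^bsub>god_H1 X (god_Z X A)\<^esub>"
    by (rule hom_one[OF Z.cech_to_god_hom comm_group.axioms(2)[OF Z.cech_comm_group] comm_group.axioms(2)[OF
      Z.god_H1_comm_group]])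
  ultimately show ?thesis unfolding conn2_def sheaf_H2_def by simp
qed

end

section \<open>Naturality of the connecting maps\<close>

lemma presheaf_hom_id: "group_presheaf X F \<Longrightarrow> presheaf_hom X F F (\<lambda>U s. s)"
  by (simp add: presheaf_hom_def presheaf_hom_axioms_def hom_def)

text \<open>Here \<open>e\<close> is the map of kernels; in the applications it is an identity or the projection
  \<open>H\<^sub>j\<^sub>+\<^sub>1/H\<^sub>j\<^sub>+\<^sub>3 \<rightarrow> A\<^sub>j\<^sub>+\<^sub>1\<close>.\<close>

locale exact_seq_hom = S: exact_seq X A E Q i p + T: exact_seq X A' E' Q' i' p' +
  e: presheaf_hom X A A' e + f: presheaf_hom X E E' f + g: presheaf_hom X Q Q' g
  for X :: "'x topology" and A :: "('x, 'a) sheaf" and E :: "('x, 'e) sheaf" and Q :: "('x, 'q) sheaf" and i p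
    and A' :: "('x, 'b) sheaf" and E' :: "('x, 'f) sheaf" and Q' :: "('x, 'r) sheaf" and i' p' e f g +
  assumes f_i: "\<lbrakk>openin X U; a \<in> carrier (sec A U)\<rbrakk> \<Longrightarrow> f U (i U a) = i' U (e U a)"
    and p_f: "\<lbrakk>openin X U; s \<in> carrier (sec E U)\<rbrakk> \<Longrightarrow> p' U (f U s) = g U (p U s)"
begin

lemma lift_data_map:
  assumes l: "S.lift_data s U h a" and s: "s \<in> carrier (sec Q (topspace X))"
  shows "T.lift_data (g (topspace X) s) U (\<lambda>x. f (U x) (h x)) (e.cochain_map U a)"
proof -
  note h = S.lift_dataD[OF l]
  note U = cocyclesD(1)[OF h(1)]
  show ?thesis
  proof (rule T.lift_data_if[OF U _ _ cocyclesD(2)[OF e.cochain_map_cocycle[OF h(1)]]])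
    fix x assume x: "x \<in> topspace X"
    have o: "openin X (U x)" "U x \<subseteq> topspace X" using point_cover_open[OF U x] openin_subset by auto
    show "f (U x) (h x) \<in> carrier (sec E' (U x))" using f.map_closed[OF o(1) h(2)[OF x]] .
    show "p' (U x) (f (U x) (h x)) = res Q' (topspace X) (U x) (g (topspace X) s)"
      unfolding p_f[OF o(1) h(2)[OF x]] h(3)[OF x] g.map_res[OF openin_topspace o s] ..
    fix y assume y: "y \<in> topspace X"
    have o': "openin X (U y)" "openin X (U x \<inter> U y)" using point_cover_open[OF U y] o by auto
    note r = S.E.res_closed[OF o(1) o'(2) Int_lower1 h(2)[OF x]] S.E.res_closed[OF o'(1) o'(2) Int_lower2 h(2)[OF y]]
    show "i' (U x \<inter> U y) (e.cochain_map U a x y) = inv\<^bsub>sec E' (U x \<inter> U y)\<^esub> (res E' (U x) (U x \<inter> U y) (f (U x) (h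
      x))) \<otimes>\<^bsub>sec E' (U x \<inter> U y)\<^esub> res E' (U y) (U x \<inter> U y) (f (U y) (h y))"
      unfolding e.cochain_map_def f_i[OF o'(2) cocyclesD(2)[OF h(1) x y], symmetric] h(4)[OF x y]
        f.map_res[OF o(1) o'(2) Int_lower1 h(2)[OF x]] f.map_res[OF o'(1) o'(2) Int_lower2 h(2)[OF y]]
      using r o'(2) by (simp add: f.map_mult f.map_inv S.E.inv_closed)
  qed
qed

lemma conn1_natural:
  assumes s: "s \<in> carrier (sec Q (topspace X))"
  shows "conn1 X A' E' Q' i' p' (g (topspace X) s) = H1_map X A' e (conn1 X A E Q i p s)"
proof -
  obtain U h a where l: "S.lift_data s U h a" using S.lift_data_exists[OF s] by blast
  show ?thesis unfolding S.conn1_eq[OF l s] T.conn1_eq[OF lift_data_map[OF l s] g.map_closed[OF openin_topspace s]]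
    e.H1_map_cech_class[OF S.lift_dataD(1)[OF l]] ..
qed

end

text \<open>The two rows have the same kernel \<open>A\<close>, so that their connecting maps take values in the same groups.\<close>

locale central_seq_hom = S: central_seq X A E Q i p + T: central_seq X A E' Q' i' p' +
  f: presheaf_hom X E E' f + g: presheaf_hom X Q Q' g
  for X :: "'x topology" and A :: "('x, 'a) sheaf" and E :: "('x, 'e) sheaf" and Q :: "('x, 'q) sheaf" and i p
    and E' :: "('x, 'f) sheaf" and Q' :: "('x, 'r) sheaf" and i' p' f g +
  assumes f_i: "\<lbrakk>openin X U; a \<in> carrier (sec A U)\<rbrakk> \<Longrightarrow> f U (i U a) = i' U a"
    and p_f: "\<lbrakk>openin X U; s \<in> carrier (sec E U)\<rbrakk> \<Longrightarrow> p' U (f U s) = g U (p U s)"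
begin

lemma conn1_natural:
  assumes s: "s \<in> carrier (sec Q (topspace X))"
  shows "conn1 X A E' Q' i' p' (g (topspace X) s) = conn1 X A E Q i p s"
proof -
  interpret N: exact_seq_hom X A E Q i p A E' Q' i' p' "\<lambda>U a. a" f g
    by (rule exact_seq_hom.intro[OF S.exact_seq_axioms T.exact_seq_axioms _ f.presheaf_hom_axioms
      g.presheaf_hom_axioms exact_seq_hom_axioms.intro])
      (simp_all add: presheaf_hom_id S.A.group_presheaf_axioms f_i p_f)
  obtain U h a where l: "S.lift_data s U h a" using S.lift_data_exists[OF s] by blast
  show ?thesis unfolding N.conn1_natural[OF s] S.conn1_eq[OF l s] N.e.H1_map_cech_class[OF S.lift_dataD(1)[OF
    l]] N.e.cochain_map_def ..
qed

lemma stalk_f_i: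
  assumes x: "x \<in> topspace X" and a: "a \<in> carrier (stalk X A x)"
  shows "stalk_map X E' f x (stalk_map X E i x a) = stalk_map X E' i' x a"
proof -
  obtain U s where U: "openin X U" "x \<in> U" "s \<in> carrier (sec A U)" "a = germ X A x (U,s)"
    using S.A.st.quot_stalk_cases[OF a] .
  then show ?thesis by (simp add: S.i.stalk_map_germ f.stalk_map_germ S.i.map_closed T.i.stalk_map_germ f_i)
qed

lemma stalk_p_f:
  assumes x: "x \<in> topspace X" and a: "e \<in> carrier (stalk X E x)"
  shows "stalk_map X Q' p' x (stalk_map X E' f x e) = stalk_map X Q' g x (stalk_map X Q p x e)"
proof -
  obtain U s where U: "openin X U" "x \<in> U" "s \<in> carrier (sec E U)" "e = germ X E x (U,s)"
    using S.E.st.quot_stalk_cases[OF a] .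
  then show ?thesis by (simp add: S.p.stalk_map_germ f.stalk_map_germ S.p.map_closed f.map_closed
    T.p.stalk_map_germ g.stalk_map_germ p_f)
qed

text \<open>A factorization \<open>e = \<alpha> \<gamma>\<close> is mapped to a factorization with the same \<open>\<alpha>\<close>.\<close>

lemma defect_map:
  assumes t: "S.defect V e \<tau>"
  shows "T.defect V (\<lambda>z. stalk_map X E' f z (e z)) \<tau>"
  unfolding T.defect_def
proof (intro conjI ballI)
  show "\<tau> \<in> carrier (sec (god_Z X A) V)" using t unfolding S.defect_def by blast
  fix z assume "z \<in> V"
  then obtain N \<gamma> \<alpha> where N: "openin X N" "z \<in> N" "N \<subseteq> V" "S.local_defect e N \<gamma> \<alpha>" "restrict \<tau> N = S.Ab.god_proj N \<alpha>"
    using t unfolding S.defect_def by blast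
  have "T.local_defect (\<lambda>z. stalk_map X E' f z (e z)) N (f N \<gamma>) \<alpha>" unfolding T.local_defect_def
  proof (intro conjI ballI)
    have g: "\<gamma> \<in> carrier (sec E N)" "\<alpha> \<in> carrier (sec (god0 X A) N)" using N(4) unfolding S.local_defect_def by auto
    show "f N \<gamma> \<in> carrier (sec E' N)" "\<alpha> \<in> carrier (sec (god0 X A) N)" using f.map_closed N(1) g by auto
    fix w assume w: "w \<in> N"
    have wt: "w \<in> topspace X" using w N(1) openin_subset by blast
    interpret F: group_hom "stalk X E w" "stalk X E' w" "stalk_map X E' f w" using f.stalk_map_group_hom[OF wt] .
    have ac: "\<alpha> w \<in> carrier (stalk X A w)" using g(2) w unfolding god0_carrier by auto
    have gc: "germ X E w (N,\<gamma>) \<in> carrier (stalk X E w)" using S.E.st.coset_germ_closed N w g by auto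
    have "e w = stalk_map X E i w (\<alpha> w) \<otimes>\<^bsub>stalk X E w\<^esub> germ X E w (N, \<gamma>)" using N(4) w unfolding
      S.local_defect_def by simp
    then show "stalk_map X E' i' w (\<alpha> w) \<otimes>\<^bsub>stalk X E' w\<^esub> germ X E' w (N, f N \<gamma>) = stalk_map X E' f w (e w)"
      using S.i.stalk_map_closed[OF wt ac] gc stalk_f_i[OF wt ac] f.stalk_map_germ[OF N(1) w g(1)] by simp
  qed
  then show "\<exists>N \<gamma> \<alpha>. openin X N \<and> z \<in> N \<and> N \<subseteq> V \<and> T.local_defect (\<lambda>z. stalk_map X E' f z (e z)) N \<gamma> \<alpha> \<and> restrict
    \<tau> N = S.Ab.god_proj N \<alpha>"
    using N by blast
qed

lemma split_defect_map:
  assumes s: "S.split_defect U c u b" and c: "(U,c) \<in> cocycles X Q"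
  shows "T.split_defect U (g.cochain_map U c) u (\<lambda>x z. stalk_map X E' f z (b x z))"
proof -
  note U = cocyclesD(1)[OF c] and b = S.split_defectD[OF s]
  have top: "z \<in> topspace X" if "x \<in> topspace X" "z \<in> U x" for x z
    using point_cover_open[OF U that(1)] that(2) openin_subset by blast
  have eq: "inv\<^bsub>stalk X E' z\<^esub> (stalk_map X E' f z (b x z)) \<otimes>\<^bsub>stalk X E' z\<^esub> stalk_map X E' f z (b y z) =
      stalk_map X E' f z (inv\<^bsub>stalk X E z\<^esub> (b x z) \<otimes>\<^bsub>stalk X E z\<^esub> b y z)" "inv\<^bsub>stalk X E z\<^esub> (b x z) \<otimes>\<^bsub>stalk X E
        z\<^esub> b y z \<in> carrier (stalk X E z)"
    if t: "x \<in> topspace X" "y \<in> topspace X" and z: "z \<in> U x" "z \<in> U y" for x y z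
  proof -
    interpret F: group_hom "stalk X E z" "stalk X E' z" "stalk_map X E' f z" using f.stalk_map_group_hom[OF
      top[OF t(1) z(1)]] .
    show "inv\<^bsub>stalk X E' z\<^esub> (stalk_map X E' f z (b x z)) \<otimes>\<^bsub>stalk X E' z\<^esub> stalk_map X E' f z (b y z) =
      stalk_map X E' f z (inv\<^bsub>stalk X E z\<^esub> (b x z) \<otimes>\<^bsub>stalk X E z\<^esub> b y z)" "inv\<^bsub>stalk X E z\<^esub> (b x z) \<otimes>\<^bsub>stalk X E
        z\<^esub> b y z \<in> carrier (stalk X E z)"
      using b(1)[OF t(1) z(1)] b(1)[OF t(2) z(2)] by simp_all
  qed
  show ?thesis
  proof (rule T.split_defectI)
    fix x z assume t: "x \<in> topspace X" and z: "z \<in> U x"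
    show "stalk_map X E' f z (b x z) \<in> carrier (stalk X E' z)" using f.stalk_map_closed[OF top[OF t z] b(1)[OF t z]] .
    fix y assume t': "y \<in> topspace X" and z': "z \<in> U y"
    show "stalk_map X Q' p' z (inv\<^bsub>stalk X E' z\<^esub> (stalk_map X E' f z (b x z)) \<otimes>\<^bsub>stalk X E' z\<^esub> stalk_map X E' f z
      (b y z)) =
       germ X Q' z (U x \<inter> U y, g.cochain_map U c x y)"
      unfolding eq(1)[OF t t' z z'] stalk_p_f[OF top[OF t z] eq(2)[OF t t' z z']] b(2)[OF t t' z z'] g.cochain_map_def
      using g.stalk_map_germ[OF point_cover_open2[OF U t t'] _ cocyclesD(2)[OF c t t']] z z' by blast
  next
    fix x y assume t: "x \<in> topspace X" "y \<in> topspace X"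
    show "T.defect (U x \<inter> U y) (\<lambda>z. inv\<^bsub>stalk X E' z\<^esub> (stalk_map X E' f z (b x z)) \<otimes>\<^bsub>stalk X E' z\<^esub> stalk_map X
      E' f z (b y z)) (u x y)"
      by (rule T.defect_cong[OF defect_map[OF b(3)[OF t]]]) (use eq(1)[OF t] in auto)
  qed
qed

lemma conn2_natural:
  assumes x: "\<xi> \<in> carrier (cech_H1 X Q)"
  shows "conn2 X A E' Q' i' p' (H1_map X Q' g \<xi>) = conn2 X A E Q i p \<xi>"
proof -
  obtain U c where c: "(U,c) \<in> cocycles X Q" "\<xi> = S.Q.cech_class (U,c)" using S.Q.cech_cases[OF x] .
  obtain u b where s: "S.split_defect U c u b" using S.split_defect_exists[OF c(1)] by blast
  show ?thesis
    unfolding conn2_def c(2) g.H1_map_cech_class[OF c(1)] T.conn_shift_eq[OF g.cochain_map_cocycle[OF c(1)]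
      split_defect_map[OF s c(1)]] S.conn_shift_eq[OF c(1) s] ..
qed

end

section \<open>Quotients of a normal series\<close>

locale aq_series =
  fixes X :: "'x topology" and G :: "('x, 'a) sheaf" and H :: "nat \<Rightarrow> 'x set \<Rightarrow> 'a set"
  assumes aq: "AQ_normal_series X G H"
begin

sublocale G: group_presheaf X G
proof (rule group_presheafI)
  show "group_sheaf X G" using aq unfolding AQ_normal_series_def by (elim conjE)
qed

lemma H_mono: assumes U: "openin X U" and ij: "i \<le> j" shows "H j U \<subseteq> H i U"
  using ij
proof (induction rule: dec_induct)
  case (step n)
  have "H (Suc n) U \<subseteq> H n U" using aq U unfolding AQ_normal_series_def by simp
  then show ?case using step.IH by (rule order_trans)
qed simp

lemma H_normal: "openin X U \<Longrightarrow> H i U \<lhd> sec G U"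
  using aq unfolding AQ_normal_series_def is_normal_subsheaf_def by blast

lemma H_subgroup: "openin X U \<Longrightarrow> subgroup (H i U) (sec G U)"
  using H_normal normal_imp_subgroup by blast

lemma H_carrier: "openin X U \<Longrightarrow> s \<in> H i U \<Longrightarrow> s \<in> carrier (sec G U)"
  using H_subgroup subgroup.mem_carrier by metis

lemma sub_sec [simp]: "sec (subsheaf G K) U = (sec G U)\<lparr>carrier := K U\<rparr>" and sub_res [simp]: "res (subsheaf G K)
  = res G"
  by (simp_all add: subsheaf_def)

lemma sub_presheaf: "group_presheaf X (subsheaf G (H i))"
proof (rule group_presheafI)
  have "is_normal_subsheaf X G (H i)" using aq unfolding AQ_normal_series_def by (elim conjE) (erule spec)
  then show "group_sheaf X (subsheaf G (H i))" unfolding is_normal_subsheaf_def by (elim conjE)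
qed

lemma sub_normal: assumes il: "i \<le> l" shows "normal_presheaf X (subsheaf G (H i)) (H l)"
proof (rule normal_presheaf.intro[OF sub_presheaf normal_presheaf_axioms.intro])
  show "H l U \<lhd> sec (subsheaf G (H i)) U" if "openin X U" for U
    unfolding sub_sec by (rule group.normal_restrict_supergroup[OF G.sec_group H_subgroup H_normal H_mono]) (use
      that il in auto)
  interpret L: group_presheaf X "subsheaf G (H l)" by (rule sub_presheaf)
  show "\<lbrakk>openin X U; openin X V; V \<subseteq> U; s \<in> H l U\<rbrakk> \<Longrightarrow> res (subsheaf G (H i)) U V s \<in> H l V" for U V s
    using L.res_closed[of U V s] by simp
qed

abbreviation quot_germ where "quot_germ i l \<equiv> coset_germ X (subsheaf G (H i)) (H l)"
abbreviation quot where "quot i l \<equiv> aq_quot X G H i l"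
abbreviation can where "can i l \<equiv> aq_can X G H i l"

text \<open>The condition on the right does not mention \<open>i\<close>: enlarging the ambient sheaf \<open>H\<^sub>i\<close> does not
  identify further germs. Hence \<open>H\<^sub>b/H\<^sub>c \<rightarrow> H\<^sub>a/H\<^sub>c\<close> is injective.\<close>

lemma quot_germ_eq_iff:
  assumes il: "i \<le> l" and U: "openin X U" "x \<in> U" "s \<in> H i U" and V: "openin X V" "x \<in> V" "t \<in> H i V"
  shows "quot_germ i l x (U,s) = quot_germ i l x (V,t) \<longleftrightarrow> (\<exists>W. openin X W \<and> x \<in> W \<and> W \<subseteq> U \<and> W \<subseteq> V \<and>
       res G U W s \<otimes>\<^bsub>sec G W\<^esub> inv\<^bsub>sec G W\<^esub> (res G V W t) \<in> H l W)"
proof -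
  interpret N: normal_presheaf X "subsheaf G (H i)" "H l" by (rule sub_normal[OF il])
  \<comment> \<open>The inverse is formed in the subgroup \<open>H i W\<close>, but agrees with the one in \<open>G\<close>.\<close>
  have "inv\<^bsub>sec (subsheaf G (H i)) W\<^esub> (res G V W t) = inv\<^bsub>sec G W\<^esub> (res G V W t)" if W: "openin X W" "W \<subseteq> V" for W
    unfolding sub_sec using group.m_inv_consistent[OF G.sec_group H_subgroup] W N.res_closed[OF V(1) W, of t] V
      by simp
  then show ?thesis using N.coset_germ_eq_iff[of U x s V t] U V by auto
qed

lemma aq_separated: "i \<le> l \<Longrightarrow> separated_presheaf X (quot i l)"
  unfolding aq_quot_def by (rule normal_presheaf.quot_sep[OF sub_normal])

lemma can_normal_hom:
  assumes "i \<le> i'" "i' \<le> l'" "i \<le> l" "l \<le> l'"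
  shows "normal_hom X (subsheaf G (H i')) (subsheaf G (H i)) (\<lambda>U s. s) (H l') (H l)"
proof (rule normal_hom.intro[OF _ sub_normal[OF assms(2)] sub_normal[OF assms(3)] normal_hom_axioms.intro])
  show "presheaf_hom X (subsheaf G (H i')) (subsheaf G (H i)) (\<lambda>U s. s)"
    by (rule presheaf_hom.intro[OF sub_presheaf sub_presheaf presheaf_hom_axioms.intro])
      (use H_mono[OF _ assms(1)] in \<open>auto simp: hom_def\<close>)
  show "\<And>U s. openin X U \<Longrightarrow> s \<in> H l' U \<Longrightarrow> s \<in> H l U" using H_mono[OF _ assms(4)] by blast
qed

lemma can_quot_sheaf_map:
  assumes "i \<le> i'" "i' \<le> l'" "i \<le> l" "l \<le> l'"
  shows "can i l = normal_hom.quot_sheaf_map X (subsheaf G (H i)) (\<lambda>U s. s) (H l)"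
proof -
  interpret N: normal_hom X "subsheaf G (H i')" "subsheaf G (H i)" "\<lambda>U s. s" "H l'" "H l" by (rule
    can_normal_hom[OF assms])
  show ?thesis by (auto simp: fun_eq_iff aq_can_def N.quot_sheaf_map_def N.quot_stalk_map_def)
qed

lemma can_hom:
  assumes "i \<le> i'" "i' \<le> l'" "i \<le> l" "l \<le> l'"
  shows "presheaf_hom X (quot i' l') (quot i l) (can i l)"
  unfolding aq_quot_def can_quot_sheaf_map[OF assms] by (rule normal_hom.quot_sheaf_map_hom[OF can_normal_hom[OF
    assms]])

lemma can_germ:
  assumes "i \<le> i'" "i' \<le> l'" "i \<le> l" "l \<le> l'" and V: "openin X V" "s \<in> H i' V"
    and x: "x \<in> U" "x \<in> V" "\<sigma> x = quot_germ i' l' x (V,s)"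
  shows "can i l U \<sigma> x = quot_germ i l x (V,s)"
proof -
  interpret N: normal_hom X "subsheaf G (H i')" "subsheaf G (H i)" "\<lambda>U s. s" "H l'" "H l" by (rule
    can_normal_hom[OF assms(1-4)])
  show ?thesis unfolding can_quot_sheaf_map[OF assms(1-4)] N.quot_sheaf_map_def using N.quot_stalk_map_germ[OF
    V(1) x(2), of s] V x by simp
qed

lemma aq_secE:
  assumes s: "\<sigma> \<in> carrier (sec (quot i l) U)" and il: "i \<le> l" and x: "x \<in> U"
  obtains V s where "openin X V" "x \<in> V" "V \<subseteq> U" "s \<in> H i V" "\<forall>y\<in>V. \<sigma> y = quot_germ i l y (V,s)"
proof -
  interpret N: normal_presheaf X "subsheaf G (H i)" "H l" by (rule sub_normal[OF il])
  show ?thesis using that s x unfolding aq_quot_def N.quot_sec_iff by auto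
qed

lemma aq_eqI:
  assumes il: "i \<le> l" and st: "\<sigma> \<in> carrier (sec (quot i l) U)" "\<tau> \<in> carrier (sec (quot i l) U)"
    and eq: "\<And>x. x \<in> U \<Longrightarrow> \<sigma> x = \<tau> x"
  shows "\<sigma> = \<tau>"
  using normal_presheaf.quot_sec_eqI[OF sub_normal[OF il]] st eq unfolding aq_quot_def by blast

lemma aq_one:
  assumes il: "i \<le> l" and V: "openin X V" "x \<in> V" and x: "x \<in> U"
  shows "\<one>\<^bsub>sec (quot i l) U\<^esub> x = quot_germ i l x (V, \<one>\<^bsub>sec G V\<^esub>)"
proof -
  interpret N: normal_presheaf X "subsheaf G (H i)" "H l" by (rule sub_normal[OF il])
  show ?thesis unfolding aq_quot_def N.quot_sec_one using N.coset_germ_one[OF V] x by simp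
qed

lemma H_one: "openin X V \<Longrightarrow> \<one>\<^bsub>sec G V\<^esub> \<in> H i V"
  using H_subgroup subgroup.one_closed by metis

text \<open>Canonical maps only forget, so every composite of them is the canonical map to its target.\<close>

lemma can_can:
  assumes "i \<le> i'" "i' \<le> i''" "i'' \<le> l''" "i' \<le> l'" "l' \<le> l''" "i \<le> l" "l \<le> l'"
    and U: "openin X U" and s: "\<sigma> \<in> carrier (sec (quot i'' l'') U)"
  shows "can i l U (can i' l' U \<sigma>) = can i l U \<sigma>"
proof (rule aq_eqI)
  show "i \<le> l" by fact
  interpret c1: presheaf_hom X "quot i'' l''" "quot i' l'" "can i' l'" by (rule can_hom) (use assms in auto)
  interpret c2: presheaf_hom X "quot i' l'" "quot i l" "can i l" by (rule can_hom) (use assms in auto)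
  interpret c3: presheaf_hom X "quot i'' l''" "quot i l" "can i l" by (rule can_hom) (use assms in auto)
  show "can i l U (can i' l' U \<sigma>) \<in> carrier (sec (quot i l) U)" "can i l U \<sigma> \<in> carrier (sec (quot i l) U)"
    using U s by (simp_all add: c1.map_closed c2.map_closed c3.map_closed)
  fix x assume x: "x \<in> U"
  obtain V t where V: "openin X V" "x \<in> V" "V \<subseteq> U" "t \<in> H i'' V" "\<forall>y\<in>V. \<sigma> y = quot_germ i'' l'' y (V,t)"
    using aq_secE[OF s assms(3) x] .
  have t: "t \<in> H i' V" using H_mono[OF V(1) assms(2)] V(4) by blast
  have "can i' l' U \<sigma> x = quot_germ i' l' x (V,t)" by (rule can_germ[OF _ _ _ _ V(1,4) x V(2)]) (use assms V in auto)
  then have "can i l U (can i' l' U \<sigma>) x = quot_germ i l x (V,t)" by (intro can_germ[OF _ _ _ _ V(1) t x V(2)])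
    (use assms in auto)
  moreover have "can i l U \<sigma> x = quot_germ i l x (V,t)" by (rule can_germ[OF _ _ _ _ V(1,4) x V(2)]) (use assms
    V in auto)
  ultimately show "can i l U (can i' l' U \<sigma>) x = can i l U \<sigma> x" by simp
qed

text \<open>The first map is injective by \<open>quot_germ_eq_iff\<close>. A section of \<open>H\<^sub>a/H\<^sub>c\<close> that dies in
  \<open>H\<^sub>a/H\<^sub>b\<close> is locally represented by sections of \<open>H\<^sub>b\<close>, and a local representative of a section
  of \<open>H\<^sub>a/H\<^sub>b\<close> also represents a section of \<open>H\<^sub>a/H\<^sub>c\<close>.\<close>

lemma aq_exact:
  assumes abc: "a \<le> b" "b \<le> c"
  shows "exact_seq X (quot b c) (quot a c) (quot a b) (can a c) (can a b)"
proof -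
  have ac: "a \<le> c" using abc by simp
  have hi: "presheaf_hom X (quot b c) (quot a c) (can a c)" by (rule can_hom) (use abc in auto)
  have hp: "presheaf_hom X (quot a c) (quot a b) (can a b)" by (rule can_hom) (use abc in auto)
  interpret i: presheaf_hom X "quot b c" "quot a c" "can a c" by (rule hi)
  interpret p: presheaf_hom X "quot a c" "quot a b" "can a b" by (rule hp)
  show ?thesis
  proof (rule exact_seq.intro[OF aq_separated[OF abc(2)] aq_separated[OF ac] aq_separated[OF abc(1)] hi hp
    exact_seq_axioms.intro])
    fix U \<sigma> assume U: "openin X U" and s: "\<sigma> \<in> carrier (sec (quot b c) U)"
    {
      assume e: "can a c U \<sigma> = \<one>\<^bsub>sec (quot a c) U\<^esub>"
      show "\<sigma> = \<one>\<^bsub>sec (quot b c) U\<^esub>"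
      proof (rule aq_eqI[OF abc(2) s i.src.one_closed[OF U]])
        fix x assume x: "x \<in> U"
        obtain V t where V: "openin X V" "x \<in> V" "V \<subseteq> U" "t \<in> H b V" "\<forall>y\<in>V. \<sigma> y = quot_germ b c y (V,t)"
          using aq_secE[OF s abc(2) x] .
        have t: "t \<in> H a V" using H_mono[OF V(1) abc(1)] V(4) by blast
        have "can a c U \<sigma> x = quot_germ a c x (V,t)" by (rule can_germ[OF _ _ _ _ V(1,4) x V(2)]) (use abc V in auto)
        then have "quot_germ a c x (V,t) = quot_germ a c x (V, \<one>\<^bsub>sec G V\<^esub>)" using aq_one[OF ac V(1,2) x] e by simp
        then have "quot_germ b c x (V,t) = quot_germ b c x (V, \<one>\<^bsub>sec G V\<^esub>)"
          unfolding quot_germ_eq_iff[OF ac V(1,2) t V(1,2) H_one[OF V(1)]] quot_germ_eq_iff[OF abc(2) V(1,2,4)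
            V(1,2) H_one[OF V(1)]] .
        then show "\<sigma> x = \<one>\<^bsub>sec (quot b c) U\<^esub> x" using aq_one[OF abc(2) V(1,2) x] V by simp
      qed
    }
    show "can a b U (can a c U \<sigma>) = \<one>\<^bsub>sec (quot a b) U\<^esub>"
    proof (rule aq_eqI[OF abc(1) p.map_closed[OF U i.map_closed[OF U s]] p.tgt.one_closed[OF U]])
      fix x assume x: "x \<in> U"
      obtain V t where V: "openin X V" "x \<in> V" "V \<subseteq> U" "t \<in> H b V" "\<forall>y\<in>V. \<sigma> y = quot_germ b c y (V,t)"
        using aq_secE[OF s abc(2) x] .
      have t: "t \<in> H a V" using H_mono[OF V(1) abc(1)] V(4) by blast
      have "can a c U \<sigma> x = quot_germ a c x (V,t)" by (rule can_germ[OF _ _ _ _ V(1,4) x V(2)]) (use abc V in auto)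
      then have 1: "can a b U (can a c U \<sigma>) x = quot_germ a b x (V,t)" by (intro can_germ[OF _ _ _ _ V(1) t x
        V(2)]) (use abc in auto)
      interpret g: group "sec G V" using G.sec_group V by blast
      have "t \<otimes>\<^bsub>sec G V\<^esub> inv\<^bsub>sec G V\<^esub> \<one>\<^bsub>sec G V\<^esub> \<in> H b V" using H_carrier[OF V(1,4)] V(4) by simp
      then have "quot_germ a b x (V,t) = quot_germ a b x (V, \<one>\<^bsub>sec G V\<^esub>)"
        unfolding quot_germ_eq_iff[OF abc(1) V(1,2) t V(1,2) H_one[OF V(1)]]
        using V(1,2) H_carrier[OF V(1,4)] by (intro exI[of _ V]) (simp add: G.res_id G.one_closed)
      then show "can a b U (can a c U \<sigma>) x = \<one>\<^bsub>sec (quot a b) U\<^esub> x" using 1 aq_one[OF abc(1) V(1,2) x] by simp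
    qed
  next
    fix U \<sigma> assume U: "openin X U" and s: "\<sigma> \<in> carrier (sec (quot a c) U)" and e: "can a b U \<sigma> = \<one>\<^bsub>sec (quot a b) U\<^esub>"
    interpret N: normal_presheaf X "subsheaf G (H b)" "H c" by (rule sub_normal[OF abc(2)])
    \<comment> \<open>A local representative with trivial class modulo \<open>H b\<close> lies in \<open>H b\<close> after shrinking.\<close>
    have ex: "\<exists>W t. openin X W \<and> x \<in> W \<and> W \<subseteq> U \<and> t \<in> H b W \<and> (\<forall>y\<in>W. \<sigma> y = quot_germ a c y (W,t))" if x: "x \<in> U" for x
    proof -
      obtain V t where V: "openin X V" "x \<in> V" "V \<subseteq> U" "t \<in> H a V" "\<forall>y\<in>V. \<sigma> y = quot_germ a c y (V,t)"
        using aq_secE[OF s ac x] .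
      have "can a b U \<sigma> x = quot_germ a b x (V,t)" by (rule can_germ[OF _ _ _ _ V(1,4) x V(2)]) (use abc V in auto)
      then have "quot_germ a b x (V,t) = quot_germ a b x (V, \<one>\<^bsub>sec G V\<^esub>)" using aq_one[OF abc(1) V(1,2) x] e by simp
      then obtain W where W: "openin X W" "x \<in> W" "W \<subseteq> V" "res G V W t \<otimes>\<^bsub>sec G W\<^esub> inv\<^bsub>sec G W\<^esub> (res G V W \<one>\<^bsub>sec
        G V\<^esub>) \<in> H b W"
        unfolding quot_germ_eq_iff[OF abc(1) V(1,2,4) V(1,2) H_one[OF V(1)]] by blast
      interpret g: group "sec G W" using G.sec_group W by blast
      have tc: "t \<in> carrier (sec G V)" using H_carrier[OF V(1,4)] .
      have "res G V W t \<in> H b W" using W(4) G.res_closed[OF V(1) W(1,3) tc] by (simp add: G.res_one[OF V(1) W(1,3)])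
      moreover have "\<sigma> y = quot_germ a c y (W, res G V W t)" if y: "y \<in> W" for y
        using normal_presheaf.coset_germ_res[OF sub_normal[OF ac], of V t W y] V W y by auto
      ultimately show ?thesis using W V(3) by blast
    qed
    obtain \<alpha> where \<alpha>: "\<alpha> \<in> carrier (sec (quot_sheaf X (subsheaf G (H b)) (H c)) U)"
      "\<And>V t. \<lbrakk>openin X V; V \<subseteq> U; t \<in> carrier (sec (subsheaf G (H b)) V); \<forall>y\<in>V. \<sigma> y = quot_germ a c y (V,t)\<rbrakk> \<Longrightarrow>
        restrict \<alpha> V = quot_proj X (subsheaf G (H b)) (H c) V t"
    proof (rule N.quot_glue[OF U, of "\<lambda>V t. \<forall>y\<in>V. \<sigma> y = quot_germ a c y (V,t)"])
      show "\<And>x. x \<in> U \<Longrightarrow> \<exists>V t. openin X V \<and> x \<in> V \<and> V \<subseteq> U \<and> t \<in> carrier (sec (subsheaf G (H b)) V) \<and> (\<forall>y\<in>V. \<sigma> y =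
        quot_germ a c y (V,t))"
        using ex by simp
      fix V t V' t' x assume V: "openin X V" "V \<subseteq> U" "t \<in> carrier (sec (subsheaf G (H b)) V)" "\<forall>y\<in>V. \<sigma> y =
        quot_germ a c y (V,t)"
        and V': "openin X V'" "V' \<subseteq> U" "t' \<in> carrier (sec (subsheaf G (H b)) V')" "\<forall>y\<in>V'. \<sigma> y = quot_germ a c y
          (V',t')" and x: "x \<in> V" "x \<in> V'"
      have t: "t \<in> H b V" "t' \<in> H b V'" "t \<in> H a V" "t' \<in> H a V'" using V V' H_mono[OF V(1) abc(1)] H_mono[OF
        V'(1) abc(1)] by auto
      have "quot_germ a c x (V,t) = quot_germ a c x (V',t')" using V(4) V'(4) x by metis
      then show "quot_germ b c x (V,t) = quot_germ b c x (V',t')"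
        unfolding quot_germ_eq_iff[OF ac V(1) x(1) t(3) V'(1) x(2) t(4)] quot_germ_eq_iff[OF abc(2) V(1) x(1)
          t(1) V'(1) x(2) t(2)] .
    qed blast
    have ac': "\<alpha> \<in> carrier (sec (quot b c) U)" using \<alpha>(1) unfolding aq_quot_def .
    have "can a c U \<alpha> = \<sigma>"
    proof (rule aq_eqI[OF ac i.map_closed[OF U ac'] s])
      fix x assume x: "x \<in> U"
      obtain V t where V: "openin X V" "x \<in> V" "V \<subseteq> U" "t \<in> H b V" "\<forall>y\<in>V. \<sigma> y = quot_germ a c y (V,t)" using
        ex[OF x] by blast
      have "\<alpha> x = quot_germ b c x (V,t)" using fun_cong[OF \<alpha>(2)[OF V(1,3) _ V(5)], of x] V(2,4) by (simp add:
        quot_proj_def)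
      then have "can a c U \<alpha> x = quot_germ a c x (V,t)" by (intro can_germ[OF _ _ _ _ V(1,4) x V(2)]) (use abc
        in auto)
      then show "can a c U \<alpha> x = \<sigma> x" using V by simp
    qed
    then show "\<exists>\<alpha>\<in>carrier (sec (quot b c) U). can a c U \<alpha> = \<sigma>" using ac' by blast
  next
    fix U \<tau> x assume U: "openin X U" and s: "\<tau> \<in> carrier (sec (quot a b) U)" and x: "x \<in> U"
    interpret N: normal_presheaf X "subsheaf G (H a)" "H c" by (rule sub_normal[OF ac])
    obtain V t where V: "openin X V" "x \<in> V" "V \<subseteq> U" "t \<in> H a V" "\<forall>y\<in>V. \<tau> y = quot_germ a b y (V,t)"
      using aq_secE[OF s abc(1) x] .
    let ?s = "quot_proj X (subsheaf G (H a)) (H c) V t"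
    have c: "?s \<in> carrier (sec (quot a c) V)" unfolding aq_quot_def using N.quot_proj_closed[OF V(1), of t] V(4)
      by simp
    have "can a b V ?s = res (quot a b) U V \<tau>"
    proof (rule aq_eqI[OF abc(1) p.map_closed[OF V(1) c] p.tgt.res_closed[OF U V(1,3) s]])
      fix y assume y: "y \<in> V"
      have "can a b V ?s y = quot_germ a b y (V,t)" by (rule can_germ[OF _ _ _ _ V(1,4) y y]) (use abc y in
        \<open>auto simp: quot_proj_def\<close>)
      then show "can a b V ?s y = res (quot a b) U V \<tau> y" using y V by (simp add: aq_quot_def quot_sheaf_def)
    qed
    then show "\<exists>V s. openin X V \<and> x \<in> V \<and> V \<subseteq> U \<and> s \<in> carrier (sec (quot a c) V) \<and> can a b V s = res (quot a b) U V \<tau>"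
      using V c by blast
  qed
qed

lemma A_abelian: "abelian_presheaf X (quot j (j+1))"
proof (rule abelian_presheaf.intro[OF _ abelian_presheaf_axioms.intro])
  show "group_presheaf X (quot j (j+1))" using aq_separated[of j "j+1"] separated_presheaf.axioms(1) by auto
  show "\<And>U. openin X U \<Longrightarrow> comm_group (sec (quot j (j+1)) U)" using aq unfolding AQ_normal_series_def
    abelian_sheaf_def by blast
qed

lemma central_seqI:
  assumes "central_at X G H k m"
  shows "central_seq X (quot m (m+1)) (quot k (m+1)) (quot k m) (can k (m+1)) (can k m)"
proof (rule central_seq.intro[OF aq_exact A_abelian central_seq_axioms.intro])
  show "k \<le> m" "m \<le> m + 1" using assms unfolding central_at_def by auto
qed (use assms in \<open>auto simp: central_at_def\<close>)

end

locale aq_series_degree2 = aq_series +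
  assumes deg: "AQ_degree X G H 2"
begin

lemma E_abelian: "abelian_presheaf X (quot j (j+2))"
proof (rule abelian_presheaf.intro[OF _ abelian_presheaf_axioms.intro])
  show "group_presheaf X (quot j (j+2))" using aq_separated[of j "j+2"] separated_presheaf.axioms(1) by auto
  show "\<And>U. openin X U \<Longrightarrow> comm_group (sec (quot j (j+2)) U)" using deg unfolding AQ_degree_def abelian_sheaf_def
    by fastforce
qed

lemma central_at_pred: "central_at X G H j (j+1)"
  unfolding central_at_def
proof (intro conjI allI impI ballI)
  interpret E: abelian_presheaf X "quot j (j+2)" by (rule E_abelian)
  interpret i: presheaf_hom X "quot (j+1) (j+2)" "quot j (j+2)" "can j (j+2)" by (rule can_hom) auto
  fix U \<sigma> \<tau> assume "openin X U" "\<sigma> \<in> carrier (sec (quot (j+1) (j+1+1)) U)" "\<tau> \<in> carrier (sec (quot j (j+1+1)) U)"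
  then show "can j (j+1+1) U \<sigma> \<otimes>\<^bsub>sec (quot j (j+1+1)) U\<^esub> \<tau> = \<tau> \<otimes>\<^bsub>sec (quot j (j+1+1)) U\<^esub> can j (j+1+1) U \<sigma>"
    using E.mult_comm[of U "can j (j+2) U \<sigma>" \<tau>] i.map_closed[of U \<sigma>] by (simp add: numeral_2_eq_2)
qed simp

text \<open>The connecting maps of the abelian extension \<open>A\<^sub>j\<^sub>+\<^sub>1 \<rightarrow> H\<^sub>j/H\<^sub>j\<^sub>+\<^sub>2 \<rightarrow> A\<^sub>j\<close>.\<close>

abbreviation step_conn1 where
  "step_conn1 j \<equiv> conn1 X (quot (j+1) (j+2)) (quot j (j+2)) (quot j (j+1)) (can j (j+2)) (can j (j+1))"
abbreviation step_conn2 where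
  "step_conn2 j \<equiv> conn2 X (quot (j+1) (j+2)) (quot j (j+2)) (quot j (j+1)) (can j (j+2)) (can j (j+1))"

lemma central_seq_at:
  assumes "central_at X G H k (j+1)"
  shows "central_seq X (quot (j+1) (j+2)) (quot k (j+2)) (quot k (j+1)) (can k (j+2)) (can k (j+1))"
  using central_seqI[OF assms] by (simp add: numeral_2_eq_2)

text \<open>The abelian extension maps to the central sequence formed with any admissible \<open>k\<close>, which lies below
  or at \<open>j\<close>.\<close>

lemma central_seq_hom_at:
  assumes k: "central_at X G H k (j+1)"
  shows "central_seq_hom X (quot (j+1) (j+2)) (quot j (j+2)) (quot j (j+1)) (can j (j+2)) (can j (j+1))
    (quot k (j+2)) (quot k (j+1)) (can k (j+2)) (can k (j+1)) (can k (j+2)) (can k (j+1))"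
proof (rule central_seq_hom.intro[OF central_seq_at[OF central_at_pred] central_seq_at[OF k] can_hom can_hom
  central_seq_hom_axioms.intro])
  have kj: "k \<le> j" using k unfolding central_at_def by simp
  show "k \<le> j" "k \<le> j" by (rule kj)+
  show "k \<le> j + 2" "k \<le> j + 1" using kj by auto
  show "can k (j+2) U (can j (j+2) U a) = can k (j+2) U a" if "openin X U" "a \<in> carrier (sec (quot (j+1) (j+2))
    U)" for U a
    by (rule can_can[OF _ _ _ _ _ _ _ that]) (use kj in auto)
  show "can k (j+1) U (can k (j+2) U s) = can k (j+1) U (can j (j+1) U s)" if "openin X U" "s \<in> carrier (sec
    (quot j (j+2)) U)" for U s
    using can_can[of k k j "j+2" "j+2" "j+1", OF _ _ _ _ _ _ _ that] can_can[of k j j "j+2" "j+1" "j+1", OF _ _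
      _ _ _ _ _ that] kj by simp
qed auto

text \<open>By naturality the choice of \<open>k\<close> does not matter.\<close>

lemma primary1_eq:
  assumes k: "central_at X G H k (j+1)" and s: "s \<in> carrier (sheaf_H0 X (quot j (j+1)))"
  shows "primary1 X G H k (j+1) s = step_conn1 j s"
  using central_seq_hom.conn1_natural[OF central_seq_hom_at[OF k] s]
  unfolding primary1_def aq_conn1_def by (simp add: numeral_2_eq_2)

lemma primary2_eq:
  assumes k: "central_at X G H k (j+1)" and x: "\<xi> \<in> carrier (cech_H1 X (quot j (j+1)))"
  shows "primary2 X G H k (j+1) \<xi> = step_conn2 j \<xi>"
  using central_seq_hom.conn2_natural[OF central_seq_hom_at[OF k] x]
  unfolding primary2_def aq_conn2_def by (simp add: numeral_2_eq_2)

text \<open>The connecting map of \<open>H\<^sub>j\<^sub>+\<^sub>1/H\<^sub>j\<^sub>+\<^sub>3 \<rightarrow> H\<^sub>j/H\<^sub>j\<^sub>+\<^sub>3 \<rightarrow> A\<^sub>j\<close> lifts the first map through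
  \<open>H\<^sup>1(H\<^sub>j\<^sub>+\<^sub>1/H\<^sub>j\<^sub>+\<^sub>3)\<close>, and the second map vanishes on the image of this group.\<close>

lemma step_conn2_step_conn1:
  assumes s: "s \<in> carrier (sheaf_H0 X (quot j (j+1)))"
  shows "step_conn2 (j+1) (step_conn1 j s) = \<one>\<^bsub>sheaf_H2 X (quot (j+2) (j+3))\<^esub>"
proof -
  interpret N: exact_seq_hom X "quot (j+1) (j+3)" "quot j (j+3)" "quot j (j+1)" "can j (j+3)" "can j (j+1)"
    "quot (j+1) (j+2)" "quot j (j+2)" "quot j (j+1)" "can j (j+2)" "can j (j+1)" "can (j+1) (j+2)" "can j (j+2)"
      "\<lambda>U s. s"
  proof (rule exact_seq_hom.intro[OF aq_exact aq_exact can_hom can_hom presheaf_hom_id exact_seq_hom_axioms.intro])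
    show "group_presheaf X (quot j (j+1))" using A_abelian abelian_presheaf.axioms(1) by blast
    show "can j (j+2) U (can j (j+3) U a) = can j (j+2) U (can (j+1) (j+2) U a)" if "openin X U" "a \<in> carrier
      (sec (quot (j+1) (j+3)) U)" for U a
      using can_can[of j j "j+1" "j+3" "j+3" "j+2", OF _ _ _ _ _ _ _ that] can_can[of j "j+1" "j+1" "j+3" "j+2"
        "j+2", OF _ _ _ _ _ _ _ that] by simp
    show "can j (j+1) U (can j (j+2) U a) = can j (j+1) U a" if "openin X U" "a \<in> carrier (sec (quot j (j+3))
      U)" for U a
      by (rule can_can[OF _ _ _ _ _ _ _ that]) auto
  qed auto
  have c: "central_at X G H (j+1) (j+1+1)" by (rule central_at_pred)
  interpret C: central_seq X "quot (j+2) (j+3)" "quot (j+1) (j+3)" "quot (j+1) (j+2)" "can (j+1) (j+3)" "can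
    (j+1) (j+2)"
    using central_seq_at[OF c] by (simp add: numeral_eq_Suc)
  have "step_conn2 (j+1) (step_conn1 j s) = conn2 X (quot (j+2) (j+3)) (quot (j+1) (j+3)) (quot (j+1) (j+2))
    (can (j+1) (j+3)) (can (j+1) (j+2))
     (H1_map X (quot (j+1) (j+2)) (can (j+1) (j+2)) (conn1 X (quot (j+1) (j+3)) (quot j (j+3)) (quot j (j+1))
       (can j (j+3)) (can j (j+1)) s))"
    using N.conn1_natural[OF s] by (simp add: numeral_eq_Suc)
  also have "\<dots> = \<one>\<^bsub>sheaf_H2 X (quot (j+2) (j+3))\<^esub>"
    by (rule C.conn2_H1_map_trivial[OF N.S.conn1_closed[OF s]])
  finally show ?thesis .
qed

end

section \<open>The primary complex\<close>

lemma hom_cong: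
  assumes "group M" "f \<in> hom M M'" "\<And>v. v \<in> carrier M \<Longrightarrow> g v = f v"
  shows "g \<in> hom M M'"
proof -
  interpret group M by fact
  show ?thesis using assms(2,3) by (auto simp: hom_def)
qed

text \<open>A map is linear if it agrees with a linear one on the carrier. The scalar multiplication has to
  preserve the carrier, which is part of being a vector space.\<close>

lemma complex_linear_cong:
  assumes M: "complex_vs M sm" "group M" and f: "complex_linear M sm M' sm' f" and fg: "\<And>v. v \<in> carrier M \<Longrightarrow> g v = f v"
  shows "complex_linear M sm M' sm' g"
proof -
  have "sm r v \<in> carrier M" if "v \<in> carrier M" for r v
    using module.smult_closed[of complex_ring "as_module M sm" r v] M(1) that
    unfolding complex_vs_def by (simp add: complex_ring_def as_module_def)
  moreover have "g \<in> hom M M'" using f unfolding complex_linear_def by (intro hom_cong[OF M(2) _ fg]) simp_all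
  ultimately show ?thesis using f fg unfolding complex_linear_def by simp
qed

theorem theorem3p1:
  fixes X :: "'x topology" and G :: "('x, 'a) sheaf" and H :: "nat \<Rightarrow> 'x set \<Rightarrow> 'a set"
  assumes "AQ_normal_series X G H" and "AQ_degree X G H 2"
  shows "(\<forall>m>0. \<exists>k. central_at X G H k m) \<and>
    (\<forall>j k l. central_at X G H k (j + 1) \<and> central_at X G H l (j + 2) \<longrightarrow>
      (let H0 = sheaf_H0 X (aq_quot X G H j (j + 1));
           H1 = cech_H1 X (aq_quot X G H (j + 1) (j + 2));
           H2 = sheaf_H2 X (aq_quot X G H (j + 2) (j + 3));
           d1 = primary1 X G H k (j + 1);
           d2 = primary2 X G H l (j + 2)
       in comm_group H0 \<and> comm_group H1 \<and> comm_group H2 \<and>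
          d1 \<in> hom H0 H1 \<and> d2 \<in> hom H1 H2 \<and> (\<forall>s \<in> carrier H0. d2 (d1 s) = \<one>\<^bsub>H2\<^esub>) \<and>
          (\<forall>s\<^sub>0 s\<^sub>1 s\<^sub>2. cohomology_vs X G H s\<^sub>0 s\<^sub>1 s\<^sub>2 \<longrightarrow>
             complex_vs H0 (s\<^sub>0 j (j + 1)) \<and>
             complex_vs H1 (s\<^sub>1 (j + 1) (j + 2)) \<and>
             complex_vs H2 (s\<^sub>2 (j + 2) (j + 3)) \<and>
             complex_linear H0 (s\<^sub>0 j (j + 1)) H1 (s\<^sub>1 (j + 1) (j + 2)) d1 \<and>
             complex_linear H1 (s\<^sub>1 (j + 1) (j + 2)) H2 (s\<^sub>2 (j + 2) (j + 3)) d2)))"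
proof -
  interpret aq_series_degree2 X G H
    using assms by (intro aq_series_degree2.intro aq_series.intro aq_series_degree2_axioms.intro)
  have 1: "\<exists>k. central_at X G H k m" if "m > 0" for m
    using central_at_pred[of "m - 1"] that by auto
  have main: "comm_group H0 \<and> comm_group H1 \<and> comm_group H2 \<and>
          d1 \<in> hom H0 H1 \<and> d2 \<in> hom H1 H2 \<and> (\<forall>s \<in> carrier H0. d2 (d1 s) = \<one>\<^bsub>H2\<^esub>) \<and>
          (\<forall>s\<^sub>0 s\<^sub>1 s\<^sub>2. cohomology_vs X G H s\<^sub>0 s\<^sub>1 s\<^sub>2 \<longrightarrow>
             complex_vs H0 (s\<^sub>0 j (j + 1)) \<and>
             complex_vs H1 (s\<^sub>1 (j + 1) (j + 2)) \<and>
             complex_vs H2 (s\<^sub>2 (j + 2) (j + 3)) \<and>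
             complex_linear H0 (s\<^sub>0 j (j + 1)) H1 (s\<^sub>1 (j + 1) (j + 2)) d1 \<and>
             complex_linear H1 (s\<^sub>1 (j + 1) (j + 2)) H2 (s\<^sub>2 (j + 2) (j + 3)) d2)"
    if k: "central_at X G H k (j + 1)" and l: "central_at X G H l (j + 2)"
      and d: "H0 = sheaf_H0 X (quot j (j + 1))" "H1 = cech_H1 X (quot (j + 1) (j + 2))" "H2 = sheaf_H2 X (quot
        (j + 2) (j + 3))"
        "d1 = primary1 X G H k (j + 1)" "d2 = primary2 X G H l (j + 2)"
    for j k l H0 H1 H2 d1 d2
  proof -
    \<comment> \<open>The second map is the step at \<open>j + 1\<close>, with indices shifted accordingly.\<close>
    have n: "j + 1 + 1 = j + 2" "j + 1 + 2 = j + 3" by simp_all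
    have l': "central_at X G H l (j + 1 + 1)" using l by (simp add: n)
    interpret A0: abelian_presheaf X "quot j (j+1)" by (rule A_abelian)
    interpret A1: abelian_presheaf X "quot (j+1) (j+2)" using A_abelian[of "j+1"] unfolding n .
    interpret C1: central_seq X "quot (j+1) (j+2)" "quot j (j+2)" "quot j (j+1)" "can j (j+2)" "can j (j+1)"
      by (rule central_seq_at[OF central_at_pred])
    interpret C2: central_seq X "quot (j+2) (j+3)" "quot (j+1) (j+3)" "quot (j+1) (j+2)" "can (j+1) (j+3)" "can
      (j+1) (j+2)"
      using central_seq_at[OF central_at_pred, of "j+1"] unfolding n .
    have H0: "comm_group H0" unfolding d using A0.sec_comm[OF openin_topspace] .
    have H1: "comm_group H1" unfolding d using A1.cech_comm_group .
    have H2: "comm_group H2" unfolding d using C2.H2_comm_group .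
    note g0 = comm_group.axioms(2)[OF H0] and g1 = comm_group.axioms(2)[OF H1]
    have d1: "d1 s = step_conn1 j s" if "s \<in> carrier H0" for s
      using primary1_eq[OF k] that unfolding d by blast
    have d2: "d2 \<xi> = step_conn2 (j+1) \<xi>" if "\<xi> \<in> carrier H1" for \<xi>
      using primary2_eq[OF l'] that unfolding d n by blast
    have h1: "step_conn1 j \<in> hom H0 H1" unfolding d by (rule C1.conn1_hom)
    have h2: "step_conn2 (j+1) \<in> hom H1 H2"
      unfolding d n using C2.conn2_hom[OF E_abelian[of "j+1", unfolded n] A1.abelian_presheaf_axioms] .
    have z: "d2 (d1 s) = \<one>\<^bsub>H2\<^esub>" if s: "s \<in> carrier H0" for s
    proof -
      have "step_conn1 j s \<in> carrier H1" using h1 s by (auto simp: hom_def)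
      then show ?thesis using d1[OF s] d2 step_conn2_step_conn1 s unfolding d by simp
    qed
    have vs: "complex_vs H0 (s\<^sub>0 j (j + 1)) \<and>
             complex_vs H1 (s\<^sub>1 (j + 1) (j + 2)) \<and>
             complex_vs H2 (s\<^sub>2 (j + 2) (j + 3)) \<and>
             complex_linear H0 (s\<^sub>0 j (j + 1)) H1 (s\<^sub>1 (j + 1) (j + 2)) d1 \<and>
             complex_linear H1 (s\<^sub>1 (j + 1) (j + 2)) H2 (s\<^sub>2 (j + 2) (j + 3)) d2"
      if c: "cohomology_vs X G H s\<^sub>0 s\<^sub>1 s\<^sub>2" for s\<^sub>0 s\<^sub>1 s\<^sub>2
    proof -
      note c1 = conjunct1[OF c[unfolded cohomology_vs_def], rule_format]
      note c2 = conjunct2[OF c[unfolded cohomology_vs_def Let_def], rule_format]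
      have v0: "complex_vs H0 (s\<^sub>0 j (j + 1))" unfolding d using c1[of "j+1" j] by simp
      have v1: "complex_vs H1 (s\<^sub>1 (j + 1) (j + 2))" unfolding d using c1[of "j+1+1" "j+1"] unfolding n by simp
      have v2: "complex_vs H2 (s\<^sub>2 (j + 2) (j + 3))" unfolding d using c1[of "j+2+1" "j+2"] by (simp add:
        numeral_eq_Suc)
      have l1: "complex_linear H0 (s\<^sub>0 j (j + 1)) H1 (s\<^sub>1 (j + 1) (j + 2)) (step_conn1 j)"
        unfolding d using c2[of j] by blast
      have l2: "complex_linear H1 (s\<^sub>1 (j + 1) (j + 2)) H2 (s\<^sub>2 (j + 2) (j + 3)) (step_conn2 (j+1))"
        unfolding d n using c2[of "j+1"] unfolding n by blast
      show ?thesis using v0 v1 v2 complex_linear_cong[OF v0 g0 l1 d1] complex_linear_cong[OF v1 g1 l2 d2] by blast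
    qed
    show ?thesis using H0 H1 H2 hom_cong[OF g0 h1 d1] hom_cong[OF g1 h2 d2] z vs by blast
  qed
  show ?thesis unfolding Let_def using 1 main[OF _ _ refl refl refl refl refl] by blast
qed

end
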